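(* Let $\sigma>2$. There is a constant $C=C(\sigma)>0$ such that the following holds. Suppose that $g:\mathbb{R}^2\to\mathbb{C}$ satisfies $$\|g\|_{X^{\sigma+1}(\mathbb{R}^2)}+\|\nabla g\|_{X^{\sigma+1}(\mathbb{R}^2)}\le B .$$ Then for every $L>1$, $$\left\| \mathcal T(g,g,g)(K)-\mathcal{T}_L(g,g,g)(K)\right\|_{X^\sigma_L(\mathbb{Z}^2_L)}\le C\,\frac{B^3}{\log L},$$ where $\mathcal{T}(g,g,g)$ is restricted to $K\in\mathbb{Z}^2_L$, and $\mathcal{T}_L(g,g,g)$ denotes $\mathcal{T}_L$ applied to the sequence $\{g(K)\}_{K\in\mathbb{Z}^2_L}$ in each argument.
   Context: Notation: $\langle x\rangle=\sqrt{1+|x|^2}$; $\mathbb{Z}^2_L=L^{-1}\mathbb{Z}^2$; $x^\perp$ is the rotation of $x\in\mathbb{R}^2$ by $+\pi/2$. $\|g\|_{X^\sigma(\mathbb{R}^2)}=\|\langle x\rangle^\sigma g\|_{L^\infty(\mathbb{R}^2)}$, and for sequences $\|a\|_{X^\sigma_L}=\sup_{K\in\mathbb{Z}^2_L}\langle K\rangle^\sigma|a_K|$. (A function with $g,\nabla g$ bounded is Lipschitz, and $g(K)$ refers to its continuous representative.) The continuous trilinear operator is $$\mathcal{T}(f,g,h)(\xi)=\int_{-1}^1\int_{\mathbb{R}^2}f(\xi+x)\,\overline{g(\xi+x+\lambda x^\perp)}\,h(\xi+\lambda x^\perp)\,dx\,d\lambda,\qquad \xi\in\mathbb{R}^2.$$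 The discrete one is $$\mathcal{T}_L(e,f,g)(K)=\frac{\zeta(2)}{2L^2\log L}\sum_{(K_1,K_2,K_3)\in\mathcal{R}(K)}e_{K_1}\overline{f_{K_2}}g_{K_3},\qquad \zeta(2)=\frac{\pi^2}{6},$$ with $\mathcal{R}(K)=\{(K_1,K_2,K_3)\in(\mathbb{Z}^2_L)^3: K_1-K_2+K_3=K,\ |K_1|^2-|K_2|^2+|K_3|^2=|K|^2\}$. *)

theory Defs
  imports "HOL-Analysis.Analysis" "HOL-Probability.Essential_Supremum"
begin

definition japanese :: "'a::real_normed_vector \<Rightarrow> real" where
  "japanese x = sqrt (1 + (norm x)\<^sup>2)"

definition perp :: "real^2 \<Rightarrow> real^2" where
  "perp x = vector [- (x $ 2), x $ 1]"

definition scaled_lattice :: "real \<Rightarrow> (real^2) set" where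
  "scaled_lattice L = (\<lambda>v. (1 / L) *\<^sub>R v) ` {v. \<forall>i. v $ i \<in> \<int>}"

text \<open>
  Both norms take values in the extended reals, so that an unbounded function has norm
  \<open>\<infinity>\<close>. The library's \<^const>\<open>esssup\<close> is also \<open>\<infinity>\<close> if the weighted function is
  not Lebesgue measurable.
\<close>

definition X_norm :: "real \<Rightarrow> (real^2 \<Rightarrow> 'b::real_normed_vector) \<Rightarrow> ereal" where
  "X_norm \<sigma> g = esssup lebesgue (\<lambda>x. ereal (japanese x powr \<sigma> * norm (g x)))"

definition X_norm_lattice :: "real \<Rightarrow> real \<Rightarrow> (real^2 \<Rightarrow> 'b::real_normed_vector) \<Rightarrow> ereal" where
  "X_norm_lattice L \<sigma> a = (SUP K\<in>scaled_lattice L. ereal (japanese K powr \<sigma> * norm (a K)))"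

text \<open>
  Real-valued elements of \<open>C\<^sub>c\<^sup>\<infinity>\<close>: \<open>D i j\<close> is the partial derivative of
  order \<open>i\<close> in the first and \<open>j\<close> in the second variable.
\<close>

definition test_function :: "(real^2 \<Rightarrow> real) \<Rightarrow> bool" where
  "test_function \<phi> \<longleftrightarrow>
     (\<exists>D :: nat \<Rightarrow> nat \<Rightarrow> real^2 \<Rightarrow> real. D 0 0 = \<phi> \<and>
        (\<forall>i j x. (D i j has_derivative
           (\<lambda>h. h $ 1 * D (Suc i) j x + h $ 2 * D i (Suc j) x)) (at x))) \<and>
     compact (closure {x. \<phi> x \<noteq> 0})"

text \<open>
  The gradient in the sense of distributions of a locally integrable function; the norm on
  \<^typ>\<open>complex^2\<close> is the Euclidean one, \<open>\<bar>\<nabla>g\<bar>\<^sup>2 = \<bar>\<partial>\<^sub>1g\<bar>\<^sup>2 + \<bar>\<partial>\<^sub>2g\<bar>\<^sup>2\<close>.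
\<close>

definition has_weak_gradient :: "(real^2 \<Rightarrow> complex) \<Rightarrow> (real^2 \<Rightarrow> complex^2) \<Rightarrow> bool" where
  "has_weak_gradient g G \<longleftrightarrow>
     (\<forall>S. compact S \<longrightarrow> set_integrable lebesgue S g \<and> set_integrable lebesgue S G) \<and>
     (\<forall>\<phi> i. test_function \<phi> \<longrightarrow>
        (LINT x|lebesgue. frechet_derivative \<phi> (at x) (axis i 1) *\<^sub>R g x) =
        - (LINT x|lebesgue. \<phi> x *\<^sub>R (G x $ i)))"

text \<open>
  Unique when it exists, since two continuous functions that agree almost everywhere are equal.
\<close>

definition continuous_rep :: "(real^2 \<Rightarrow> complex) \<Rightarrow> real^2 \<Rightarrow> complex" where
  "continuous_rep g = (THE h. continuous_on UNIV h \<and> (AE x in lebesgue. h x = g x))"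

definition trilinear ::
  "(real^2 \<Rightarrow> complex) \<Rightarrow> (real^2 \<Rightarrow> complex) \<Rightarrow> (real^2 \<Rightarrow> complex) \<Rightarrow> real^2 \<Rightarrow> complex" where
  "trilinear f g h \<xi> =
     (LINT l:{-1..1}|lebesgue. (LINT x|lebesgue.
        f (\<xi> + x) * cnj (g (\<xi> + x + l *\<^sub>R perp x)) * h (\<xi> + l *\<^sub>R perp x)))"

definition resonant_set :: "real \<Rightarrow> real^2 \<Rightarrow> ((real^2) \<times> (real^2) \<times> (real^2)) set" where
  "resonant_set L K = {(K1, K2, K3).
     K1 \<in> scaled_lattice L \<and> K2 \<in> scaled_lattice L \<and> K3 \<in> scaled_lattice L \<and>
     K1 - K2 + K3 = K \<and> (norm K1)\<^sup>2 - (norm K2)\<^sup>2 + (norm K3)\<^sup>2 = (norm K)\<^sup>2}"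

text \<open>
  Sequences indexed by the lattice are functions on the plane of which only the values at lattice
  points are used. The prefactor contains \<open>\<zeta>(2) = \<pi>\<^sup>2 / 6\<close>.
\<close>

definition trilinear_discrete ::
  "real \<Rightarrow> (real^2 \<Rightarrow> complex) \<Rightarrow> (real^2 \<Rightarrow> complex) \<Rightarrow> (real^2 \<Rightarrow> complex) \<Rightarrow> real^2 \<Rightarrow> complex" where
  "trilinear_discrete L e f g K =
     complex_of_real ((pi\<^sup>2 / 6) / (2 * L\<^sup>2 * ln L)) *
     (\<Sum>\<^sub>\<infinity>(K1, K2, K3)\<in>resonant_set L K. e K1 * cnj (f K2) * g K3)"

end

theory Submission
  imports Defs "HOL-Computational_Algebra.Polynomial"
begin

text \<open>
  Put \<open>K\<^sub>1 = K + N\<close> and \<open>K\<^sub>3 = K + N'\<close>. The two resonance conditions then say that \<open>K\<^sub>2 = K + N + N'\<close> and that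
  \<open>N\<close> and \<open>N'\<close> are orthogonal, so that the four points are the corners of a rectangle. Since the same
  function stands in all three slots, exchanging \<open>N\<close> and \<open>N'\<close> does not change the summand, and up to this
  exchange every orthogonal pair other than \<open>(0,0)\<close> can be written in exactly one way as
  \<open>N = q M / L\<close>, \<open>N' = p M\<^sup>\<bottom> / L\<close> with \<open>q \<ge> 1\<close>, \<open>- q \<le> p < q\<close> coprime to \<open>q\<close>, and \<open>M \<noteq> 0\<close> an integer vector
  (\<open>orth_pairs_eq\<close>, \<open>inj_on_rect_pair\<close>, \<open>rect_pair_swap_disjoint\<close>). With
  \<open>P(x,\<lambda>) = g(K + x) \<cdot> cnj (g(K + x + \<lambda> x\<^sup>\<bottom>)) \<cdot> g(K + \<lambda> x\<^sup>\<bottom>)\<close> the resonant sum is therefore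
  \<open>P(0,0) + 2 \<Sum>\<^sub>q \<Sum>\<^sub>p \<Sum>\<^sub>M P(q M / L, p / q)\<close> (\<open>resonant_sum\<close>), while \<open>T(g,g,g)(K)\<close> is the integral over
  \<open>\<bar>\<lambda>\<bar> \<le> 1\<close> of \<open>I(\<lambda>) = \<integral> P(x,\<lambda>) dx\<close>.

  For \<open>q \<le> L\<close> the sum over \<open>M\<close> is a Riemann sum of mesh \<open>q / L\<close> and equals \<open>(L/q)\<^sup>2 I(p/q)\<close> up to \<open>O(L/q)\<close>
  (\<open>riemann_sum\<close>). These errors add up to \<open>O(L\<^sup>2)\<close>, and so do all terms with \<open>q > L\<close> (\<open>rectangle_sum_tail\<close>).
  What is left is \<open>2 L\<^sup>2 A(L)\<close> with \<open>A(n) = \<Sum>\<^sub>q\<^sub>\<le>\<^sub>n q\<^sup>-\<^sup>2 \<Sum>\<^sub>p I(p/q)\<close>, and the claim becomes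
  \<open>\<zeta>(2) A(n) = log n \<integral> I + O(1)\<close> (\<open>farey_average\<close>). To see it without Moebius inversion, sum over all
  fractions \<open>p/m\<close> instead of the reduced ones: on the one hand
  \<open>\<Sum>\<^sub>m\<^sub>\<le>\<^sub>n m\<^sup>-\<^sup>2 \<Sum>\<^sub>p I(p/m) = log n \<integral> I + O(1)\<close>, on the other hand reducing the fractions turns this sum into
  \<open>\<Sum>\<^sub>d\<^sub>\<le>\<^sub>n d\<^sup>-\<^sup>2 A(n/d)\<close>, which is \<open>\<zeta>(2) A(n) + O(1)\<close> because \<open>A\<close> grows only logarithmically. The prefactor
  \<open>\<zeta>(2) / (2 L\<^sup>2 log L)\<close> finally produces \<open>\<integral> I\<close> and an error \<open>O(1 / log L)\<close>.

  All error terms need to decay like \<open>\<langle>K\<rangle>\<^sup>-\<^sup>\<sigma>\<close>. In a rectangle \<open>\<bar>K\<bar>\<^sup>2 \<le> \<bar>K\<^sub>1\<bar>\<^sup>2 + \<bar>K\<^sub>3\<bar>\<^sup>2\<close>, so one of the two corners next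
  to \<open>K\<close> is about as far from the origin as \<open>K\<close>, and its factor supplies the decay in \<open>K\<close>, while the other two
  factors make the integral over \<open>x\<close> converge (\<open>rectangle_product_le\<close>). A pointwise weighted Lipschitz bound for
  the continuous representative of \<open>g\<close> is extracted from the distributional gradient by testing with
  smooth approximations of indicators of boxes and differentiating the resulting averages
  (\<open>weak_gradient_continuous_rep\<close>).
\<close>

section \<open>Weights and rectangles\<close>

lemma japanese_ge_1: "1 \<le> japanese x"
  by (simp add: japanese_def)

lemma japanese_pos: "0 < japanese x"
  by (simp add: japanese_def add_pos_nonneg)

lemma japanese_sq: "(japanese x)\<^sup>2 = 1 + (norm x)\<^sup>2"
  by (simp add: japanese_def add_nonneg_nonneg)

lemma norm_le_japanese: "norm x \<le> japanese x"
  unfolding japanese_def by (rule real_le_rsqrt) simp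

lemma japanese_uminus: "japanese (- x) = japanese x"
  by (simp add: japanese_def)

lemma japanese_add_le: "japanese (x + y) \<le> sqrt 2 * japanese x * japanese y"
proof -
  have "(norm (x + y))\<^sup>2 \<le> (norm x + norm y)\<^sup>2"
    by (simp add: norm_triangle_ineq power_mono)
  also have "\<dots> \<le> 2 * (norm x)\<^sup>2 + 2 * (norm y)\<^sup>2"
    using sum_squares_bound[of "norm x" "norm y"] by (simp add: power2_sum)
  finally have le: "(norm (x + y))\<^sup>2 \<le> 2 * (norm x)\<^sup>2 + 2 * (norm y)\<^sup>2" .
  have "2 * ((1 + (norm x)\<^sup>2) * (1 + (norm y)\<^sup>2)) =
      2 + 2 * (norm x)\<^sup>2 + 2 * (norm y)\<^sup>2 + 2 * ((norm x)\<^sup>2 * (norm y)\<^sup>2)"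
    by (simp add: algebra_simps)
  with le have "1 + (norm (x + y))\<^sup>2 \<le> 2 * ((1 + (norm x)\<^sup>2) * (1 + (norm y)\<^sup>2))"
    using mult_nonneg_nonneg[OF zero_le_power2[of "norm x"] zero_le_power2[of "norm y"]]
    by linarith
  then have "japanese (x + y) \<le> sqrt (2 * ((1 + (norm x)\<^sup>2) * (1 + (norm y)\<^sup>2)))"
    unfolding japanese_def by (rule real_sqrt_le_mono)
  then show ?thesis
    unfolding japanese_def real_sqrt_mult mult.assoc .
qed

definition wt :: "real \<Rightarrow> 'a::real_normed_vector \<Rightarrow> real" where
  "wt s x = japanese x powr (- s)"

lemma wt_pos: "0 < wt s x"
  using japanese_pos[of x] by (simp add: wt_def)

lemma wt_le_1: "0 \<le> s \<Longrightarrow> wt s x \<le> 1"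
  using japanese_ge_1[of x] by (simp add: wt_def powr_minus inverse_le_1_iff ge_one_powr_ge_zero)

lemma wt_antimono: "0 \<le> s \<Longrightarrow> japanese y \<le> c * japanese x \<Longrightarrow> 0 < c \<Longrightarrow> wt s x \<le> c powr s * wt s y"
proof -
  assume a: "0 \<le> s" "japanese y \<le> c * japanese x" "0 < c"
  have "japanese y powr s \<le> (c * japanese x) powr s"
    using a japanese_pos[of y] by (intro powr_mono2) auto
  also have "\<dots> = c powr s * japanese x powr s"
    using a japanese_pos[of x] by (simp add: powr_mult)
  finally show ?thesis
    using japanese_pos[of x] japanese_pos[of y] by (simp add: wt_def powr_minus field_simps)
qed

lemma wt_exp_mono: "s \<le> t \<Longrightarrow> wt t x \<le> wt s x"
  using japanese_ge_1[of x] by (simp add: wt_def powr_mono)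

lemma wt_add: "wt (s + t) x = wt s x * wt t x"
  by (simp add: wt_def flip: powr_add)

lemma wt_one: "wt 1 x = 1 / japanese x"
  using japanese_pos[of x] by (simp add: wt_def powr_minus_divide)

text \<open>
  Two points at distance \<open>\<bar>x - y\<bar>\<close> cannot both be close to the origin.
\<close>

lemma wt_mult_le: "0 \<le> s \<Longrightarrow> wt s x * wt s y \<le> 2 powr (s/2) * wt s (x - y)"
proof -
  assume s: "0 \<le> s"
  have le: "japanese (x - y) \<le> sqrt 2 * (japanese x * japanese y)"
    using japanese_add_le[of x "-y"] by (simp add: japanese_uminus mult.assoc)
  have "japanese (x - y) powr s \<le> (sqrt 2 * (japanese x * japanese y)) powr s"
    using s japanese_pos[of "x-y"] le by (intro powr_mono2) auto
  also have "\<dots> = sqrt 2 powr s * (japanese x powr s * japanese y powr s)"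
    using japanese_pos[of x] japanese_pos[of y] by (simp add: powr_mult)
  also have "sqrt 2 powr s = 2 powr (s/2)"
    by (simp add: powr_half_sqrt[symmetric] powr_powr)
  finally show ?thesis
    using japanese_pos[of x] japanese_pos[of y] japanese_pos[of "x-y"]
    by (simp add: wt_def powr_minus field_simps)
qed

lemma wt_shift: "0 \<le> s \<Longrightarrow> wt s (x + v) \<le> (sqrt 2 * japanese v) powr s * wt s x"
  using japanese_add_le[of "x + v" "- v"] japanese_pos[of v]
  by (intro wt_antimono) (auto simp: japanese_uminus algebra_simps)

text \<open>
  The weight varies by at most a constant factor over unit distances.
\<close>

lemma wt_near: "0 \<le> s \<Longrightarrow> norm (x - y) \<le> 1 \<Longrightarrow> wt s y \<le> 2 powr s * wt s x"
proof -
  assume a: "0 \<le> s" "norm (x - y) \<le> 1"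
  have "(japanese (y - x))\<^sup>2 \<le> 2" unfolding japanese_sq using a(2)
    by (simp add: norm_minus_commute power_le_one)
  then have "japanese (y - x) \<le> sqrt 2" by (rule real_le_rsqrt)
  then have "sqrt 2 * japanese (y - x) \<le> sqrt 2 * sqrt 2" by (intro mult_left_mono) auto
  then have "(sqrt 2 * japanese (y - x)) powr s \<le> 2 powr s"
    using a japanese_pos[of "y-x"] by (intro powr_mono2) auto
  with wt_shift[of s x "y - x"] a wt_pos[of s x] show ?thesis
    by (smt (verit) add_diff_cancel_left' diff_add_cancel mult_right_mono add.commute)
qed

lemma continuous_on_wt [continuous_intros]: "continuous_on A f \<Longrightarrow> continuous_on A (\<lambda>x. wt s (f x))"
  unfolding wt_def japanese_def by (intro continuous_intros) (auto simp: add_nonneg_eq_0_iff)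

lemma perp_nth [simp]: "perp x $ 1 = - (x $ 2)" "perp x $ 2 = x $ 1"
  by (simp_all add: perp_def)

lemma norm_vec2: "(norm (x::real^2))\<^sup>2 = (x $ 1)\<^sup>2 + (x $ 2)\<^sup>2"
  by (simp add: norm_eq_sqrt_inner inner_vec_def UNIV_2 power2_eq_square)

lemma norm_perp [simp]: "norm (perp x) = norm x"
  by (rule power2_eq_imp_eq) (simp_all add: norm_vec2)

lemma linear_perp: "linear perp"
  by (rule linearI) (simp_all add: vec_eq_iff forall_2)

text \<open>
  The parallelogram identity for a rectangle reads
  \<open>\<bar>K + x\<bar>\<^sup>2 + \<bar>K + y\<bar>\<^sup>2 = \<bar>K\<bar>\<^sup>2 + \<bar>K + x + y\<bar>\<^sup>2\<close>, so \<open>K\<close> cannot be much farther out than both neighbours.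
\<close>

lemma rectangle_far_corner:
  assumes s: "0 \<le> s" and l: "y = l *\<^sub>R perp x"
  shows "wt s (K + x) \<le> 2 powr s * wt s K \<or> wt s (K + y) \<le> 2 powr s * wt s K"
proof -
  have "(norm (K + x))\<^sup>2 + (norm (K + y))\<^sup>2 = (norm K)\<^sup>2 + (norm (K + x + y))\<^sup>2"
    unfolding norm_vec2 l by (simp add: power2_eq_square algebra_simps)
  then have "(japanese K)\<^sup>2 \<le> (japanese (K + x))\<^sup>2 + (japanese (K + y))\<^sup>2"
    unfolding japanese_sq by (smt (verit) zero_le_power2)
  then have "japanese K \<le> 2 * japanese (K + x) \<or> japanese K \<le> 2 * japanese (K + y)"
  proof (rule contrapos_pp)
    assume "\<not> (japanese K \<le> 2 * japanese (K + x) \<or> japanese K \<le> 2 * japanese (K + y))"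
    then have lt: "2 * japanese (K + x) < japanese K" "2 * japanese (K + y) < japanese K" by auto
    have a: "4 * (japanese (K + x))\<^sup>2 < (japanese K)\<^sup>2"
      using power_strict_mono[OF lt(1), of 2] japanese_pos[of "K+x"] by simp
    have b: "4 * (japanese (K + y))\<^sup>2 < (japanese K)\<^sup>2"
      using power_strict_mono[OF lt(2), of 2] japanese_pos[of "K+y"] by simp
    show "\<not> (japanese K)\<^sup>2 \<le> (japanese (K + x))\<^sup>2 + (japanese (K + y))\<^sup>2"
      using a b zero_le_power2[of "japanese (K + x)"] zero_le_power2[of "japanese (K + y)"]
      by linarith
  qed
  then show ?thesis using wt_antimono[OF s, of K 2] by auto
qed

text \<open>
  The two alternatives say which corner adjacent to \<open>K\<close> is the far one. If it is \<open>K + x\<close>, the other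
  two corners differ by \<open>x\<close>, so their weights decay in \<open>x\<close>. If it is \<open>K + y\<close>, no decay in \<open>x\<close> is left
  (think of \<open>y = 0\<close>), and only the weights of the side from \<open>K + x\<close> to \<open>K + x + y\<close> remain.
\<close>

lemma rectangle_product:
  assumes s: "0 \<le> s" and l: "y = l *\<^sub>R perp x"
  shows "wt s (K + x) * wt s (K + x + y) * wt s (K + y) \<le> 4 powr s * wt s K * wt s x \<or>
    wt s (K + x) * wt s (K + x + y) * wt s (K + y) \<le> 2 powr s * wt s K * (wt s (K + x) * wt s (K + x + y))"
proof -
  have e4: "(4::real) powr s = 2 powr s * 2 powr s" by (simp flip: powr_mult)
  have h2: "(2::real) powr (s/2) \<le> 2 powr s" using s by (intro powr_mono) auto
  note pos = wt_pos[of s "K+x"] wt_pos[of s "K+x+y"] wt_pos[of s "K+y"] wt_pos[of s x] wt_pos[of s K]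
  from rectangle_far_corner[OF s l, of K] show ?thesis
  proof
    assume a: "wt s (K + x) \<le> 2 powr s * wt s K"
    have "wt s (K+x+y) * wt s (K+y) \<le> 2 powr (s/2) * wt s x"
      using wt_mult_le[OF s, of "K+x+y" "K+y"] by simp
    also have "\<dots> \<le> 2 powr s * wt s x" using h2 pos by (intro mult_right_mono) auto
    finally have "wt s (K + x) * (wt s (K + x + y) * wt s (K + y)) \<le> (2 powr s * wt s K) * (2 powr s * wt s x)"
      using pos by (intro mult_mono[OF a]) auto
    then show ?thesis by (simp add: e4 mult_ac)
  next
    assume "wt s (K + y) \<le> 2 powr s * wt s K"
    then have "(wt s (K+x) * wt s (K+x+y)) * wt s (K+y) \<le> (wt s (K+x) * wt s (K+x+y)) * (2 powr s * wt s K)"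
      using pos by (intro mult_left_mono) auto
    then show ?thesis by (simp add: mult_ac)
  qed
qed

text \<open>
  Integrability of the left-hand side in \<open>x\<close>, uniformly in \<open>K\<close>, even with the extra factor \<open>1 + \<bar>x\<bar>\<close> that
  a derivative in the slope \<open>l\<close> costs. In the second alternative above that factor is paid for by
  \<open>\<langle>x\<rangle> \<lesssim> \<langle>K + x\<rangle>\<langle>K\<rangle>\<close>; this is where one power of the weight is lost between hypothesis and conclusion.
\<close>

lemma rectangle_product_le:
  assumes \<sigma>: "\<sigma> > 2" and l: "y = l *\<^sub>R perp x"
  shows "(1 + norm x) * (wt (\<sigma>+1) (K + x) * wt (\<sigma>+1) (K + x + y) * wt (\<sigma>+1) (K + y))
     \<le> 4 * 4 powr (\<sigma>+1) * wt \<sigma> K * (wt \<sigma> x + wt \<sigma> (K + x))"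
proof -
  let ?s = "\<sigma> + 1"
  let ?T = "wt ?s (K + x) * wt ?s (K + x + y) * wt ?s (K + y)"
  have s: "0 \<le> ?s" using \<sigma> by simp
  have nx: "1 + norm x \<le> 2 * japanese x"
    using japanese_ge_1[of x] norm_le_japanese[of x] by linarith
  note pos = wt_pos[of ?s "K+x"] wt_pos[of ?s "K+x+y"] wt_pos[of ?s "K+y"] wt_pos[of \<sigma> K]
    wt_pos[of \<sigma> x] wt_pos[of \<sigma> "K+x"] wt_pos[of ?s x] wt_pos[of ?s K] japanese_pos[of x] japanese_pos[of K]
    japanese_pos[of "K+x"]
  have sK: "wt ?s K \<le> wt \<sigma> K" by (rule wt_exp_mono) simp
  have jw: "japanese z * wt ?s z = wt \<sigma> z" for z :: "real^2"
    using japanese_pos[of z] by (simp add: wt_add wt_one)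
  have T0: "0 \<le> ?T" using pos by simp
  from rectangle_product[OF s l, of K] show ?thesis
  proof
    assume a: "?T \<le> 4 powr ?s * wt ?s K * wt ?s x"
    have "(1 + norm x) * ?T \<le> (2 * japanese x) * (4 powr ?s * wt \<sigma> K * wt ?s x)"
    proof (rule mult_mono[OF nx order_trans[OF a]])
      show "4 powr ?s * wt ?s K * wt ?s x \<le> 4 powr ?s * wt \<sigma> K * wt ?s x"
        using sK pos by (intro mult_right_mono mult_left_mono) auto
    qed (use T0 pos in auto)
    also have "\<dots> = 2 * 4 powr ?s * wt \<sigma> K * (japanese x * wt ?s x)" by simp
    also have "\<dots> \<le> 4 * 4 powr ?s * wt \<sigma> K * (wt \<sigma> x + wt \<sigma> (K + x))"
      unfolding jw by (rule mult_mono) (use pos in auto)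
    finally show ?thesis .
  next
    assume a: "?T \<le> 2 powr ?s * wt ?s K * (wt ?s (K+x) * wt ?s (K+x+y))"
    have "japanese x \<le> sqrt 2 * japanese (K + x) * japanese K"
      using japanese_add_le[of "K+x" "-K"] by (simp add: japanese_uminus)
    also have "\<dots> \<le> 2 * japanese (K + x) * japanese K"
      using pos sqrt2_less_2 by (intro mult_right_mono) auto
    finally have b: "1 + norm x \<le> 4 * (japanese (K + x) * japanese K)" using nx by simp
    have "wt ?s (K+x) * wt ?s (K+x+y) \<le> wt ?s (K+x) * 1"
      using wt_le_1[OF s, of "K+x+y"] pos by (intro mult_left_mono) auto
    then have "?T \<le> 2 powr ?s * wt ?s K * wt ?s (K+x)"
      using order_trans[OF a mult_left_mono[of _ _ "2 powr ?s * wt ?s K"]] pos by simp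
    also have "\<dots> \<le> 4 powr ?s * wt ?s K * wt ?s (K+x)"
      using s pos by (intro mult_right_mono powr_mono2) auto
    finally have c: "?T \<le> 4 powr ?s * wt ?s K * wt ?s (K+x)" .
    have "(1 + norm x) * ?T \<le> (4 * (japanese (K + x) * japanese K)) * (4 powr ?s * wt ?s K * wt ?s (K+x))"
      by (rule mult_mono[OF b c]) (use T0 pos in auto)
    also have "\<dots> = 4 * 4 powr ?s * (japanese K * wt ?s K) * (japanese (K+x) * wt ?s (K+x))" by simp
    also have "\<dots> \<le> 4 * 4 powr ?s * wt \<sigma> K * (wt \<sigma> x + wt \<sigma> (K + x))"
      unfolding jw by (rule mult_mono) (use pos in auto)
    finally show ?thesis .
  qed
qed

text \<open>
  A version for sums over sparse lattices. There a lattice point with \<open>K + x \<approx> 0\<close> may exist for about as many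
  mesh sizes as \<open>\<bar>K\<bar>\<close> permits, and the bound must remain summable over these. It keeps a factor \<open>\<langle>K\<rangle>\<^sup>-\<^sup>1\<close> and splits the weight \<open>\<langle>K + x\<rangle>\<^sup>-\<^sup>\<sigma>\<^sup>-\<^sup>1\<close> into an exponent \<open>1 + \<sigma>/2 > 2\<close>,
  summable over a planar lattice, and an exponent \<open>\<sigma>/2 > 1\<close> that becomes decay in the short side \<open>y\<close>,
  summable over the slopes.
\<close>

lemma rectangle_product_le_tail:
  assumes \<sigma>: "\<sigma> > 2" and l: "y = l *\<^sub>R perp x"
  shows "wt (\<sigma>+1) (K + x) * wt (\<sigma>+1) (K + x + y) * wt (\<sigma>+1) (K + y)
     \<le> 4 powr (\<sigma>+1) * wt \<sigma> K * (wt (\<sigma>+1) x + wt (1 + \<sigma>/2) (K + x) * wt (\<sigma>/2) y / japanese K)"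
    (is "?T \<le> ?c * wt \<sigma> K * (wt (\<sigma>+1) x + ?R)")
proof -
  note pos = wt_pos[of "\<sigma>+1" x] wt_pos[of \<sigma> K] wt_pos[of "\<sigma>+1" K] japanese_pos[of K]
    wt_pos[of "1+\<sigma>/2" "K+x"] wt_pos[of "\<sigma>/2" y] wt_pos[of "\<sigma>/2" "K+x"] wt_pos[of "\<sigma>/2" "K+x+y"]
  have sK: "wt (\<sigma>+1) K \<le> wt \<sigma> K" by (rule wt_exp_mono) simp
  let ?d = "2 powr (\<sigma> + 1) :: real"
  have R0: "0 \<le> ?R" using pos by simp
  have s: "0 \<le> \<sigma> + 1" using \<sigma> by simp
  from rectangle_product[OF s l, of K] show ?thesis
  proof
    assume "?T \<le> ?c * wt (\<sigma>+1) K * wt (\<sigma>+1) x"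
    also have "\<dots> \<le> ?c * wt \<sigma> K * (wt (\<sigma>+1) x + ?R)"
      using sK pos R0 by (intro mult_mono) auto
    finally show ?thesis .
  next
    assume a: "?T \<le> ?d * wt (\<sigma>+1) K * (wt (\<sigma>+1) (K+x) * wt (\<sigma>+1) (K+x+y))"
    have "wt (\<sigma>+1) (K+x) = wt (1+\<sigma>/2) (K+x) * wt (\<sigma>/2) (K+x)" by (simp flip: wt_add)
    moreover have "wt (\<sigma>+1) (K+x+y) \<le> wt (\<sigma>/2) (K+x+y)" using \<sigma> by (intro wt_exp_mono) auto
    ultimately have "wt (\<sigma>+1) (K+x) * wt (\<sigma>+1) (K+x+y) \<le> wt (1+\<sigma>/2) (K+x) * (wt (\<sigma>/2) (K+x+y) * wt (\<sigma>/2) (K+x))"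
      using pos by (simp add: mult.assoc mult.commute mult.left_commute)
    also have "\<dots> \<le> wt (1+\<sigma>/2) (K+x) * (2 powr (\<sigma>/2/2) * wt (\<sigma>/2) y)"
      using wt_mult_le[of "\<sigma>/2" "K+x+y" "K+x"] pos \<sigma> by (intro mult_left_mono) auto
    finally have b: "wt (\<sigma>+1) (K+x) * wt (\<sigma>+1) (K+x+y) \<le> 2 powr (\<sigma>/2/2) * (wt (1+\<sigma>/2) (K+x) * wt (\<sigma>/2) y)"
      by (simp add: mult_ac)
    have "?T \<le> ?d * wt (\<sigma>+1) K * (2 powr (\<sigma>/2/2) * (wt (1+\<sigma>/2) (K+x) * wt (\<sigma>/2) y))"
      by (rule order_trans[OF a mult_left_mono[OF b]]) (use pos in simp)
    also have "wt (\<sigma>+1) K = wt \<sigma> K / japanese K" by (simp add: wt_add wt_one)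
    also have "?d * (wt \<sigma> K / japanese K) * (2 powr (\<sigma>/2/2) * (wt (1+\<sigma>/2) (K+x) * wt (\<sigma>/2) y))
       = (2 powr (\<sigma>/2/2) * ?d) * wt \<sigma> K * ?R" by simp
    also have "\<dots> \<le> ?c * wt \<sigma> K * (wt (\<sigma>+1) x + ?R)"
    proof (rule mult_mono[OF mult_right_mono])
      have "2 powr (\<sigma>/2/2) * ?d \<le> ?d * ?d" using \<sigma> by (intro mult_right_mono powr_mono) auto
      then show "2 powr (\<sigma>/2/2) * ?d \<le> ?c" by (simp flip: powr_mult)
    qed (use pos R0 in auto)
    finally show ?thesis .
  qed
qed

section \<open>The integrand of the trilinear operator\<close>

definition integrand :: "(real^2 \<Rightarrow> complex) \<Rightarrow> real^2 \<Rightarrow> real^2 \<Rightarrow> real \<Rightarrow> complex" where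
  "integrand h K x l = h (K + x) * cnj (h (K + x + l *\<^sub>R perp x)) * h (K + l *\<^sub>R perp x)"

text \<open>
  For \<open>\<rho> \<le> 1\<close> the difference telescopes, and the weights at the two corners of each pair are comparable. For
  \<open>\<rho> > 1\<close> they need not be, but then the sum of the two products is already a bound. Both cases are
  needed, since varying the slope by \<open>\<epsilon>\<close> moves corners by \<open>\<epsilon> \<bar>x\<bar>\<close>, which is unbounded.
\<close>

lemma triple_product_diff_le:
  fixes h :: "real^2 \<Rightarrow> complex"
  assumes s: "0 \<le> s" and B: "0 \<le> B"
    and bd: "\<And>x. norm (h x) \<le> B * wt s x"
    and lip: "\<And>x y. norm (x - y) \<le> 1 \<Longrightarrow> norm (h x - h y) \<le> 4 powr s * B * norm (x - y) * wt s x"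
    and \<rho>: "norm (a - a') \<le> \<rho>" "norm (b - b') \<le> \<rho>" "norm (c - c') \<le> \<rho>"
  shows "norm (h a * cnj (h b) * h c - h a' * cnj (h b') * h c')
    \<le> 3 * 16 powr s * B^3 * \<rho> * (wt s a * wt s b * wt s c + wt s a' * wt s b' * wt s c')"
proof (cases "\<rho> \<le> 1")
  case True
  have \<rho>0: "0 \<le> \<rho>" using \<rho>(1) norm_ge_zero order_trans by blast
  have e: "(1::real) \<le> 2 powr s" "(1::real) \<le> 4 powr s" using s by (simp_all add: ge_one_powr_ge_zero)
  note pos = wt_pos[of s a] wt_pos[of s b] wt_pos[of s c]
  define W where "W = 4 powr s * (4 powr s * B^3 * \<rho>) * (wt s a * wt s b * wt s c)"
  have d: "norm (h x - h y) \<le> 4 powr s * B * \<rho> * wt s x" if "norm (x - y) \<le> \<rho>" for x y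
  proof -
    have "norm (h x - h y) \<le> 4 powr s * B * norm (x - y) * wt s x"
      using that True by (intro lip) auto
    also have "\<dots> \<le> 4 powr s * B * \<rho> * wt s x"
      using that B wt_pos[of s x] by (intro mult_right_mono mult_left_mono) auto
    finally show ?thesis .
  qed
  have w: "norm (h y) \<le> 2 powr s * B * wt s x" if "norm (x - y) \<le> \<rho>" for x y
  proof -
    have "norm (h y) \<le> B * wt s y" by (rule bd)
    also have "\<dots> \<le> B * (2 powr s * wt s x)"
      using that True by (intro mult_left_mono wt_near s B) auto
    finally show ?thesis by (simp add: mult_ac)
  qed
  have w': "norm (h x) \<le> 2 powr s * B * wt s x" for x
    using w[of x x] \<rho>0 by simp
  have e4: "(4::real) powr s = 2 powr s * 2 powr s" by (simp flip: powr_mult)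
  have e16: "(16::real) powr s = 4 powr s * 4 powr s" by (simp flip: powr_mult)
  have t1: "norm ((h a - h a') * cnj (h b) * h c) \<le> W"
    unfolding norm_mult complex_mod_cnj
  proof (rule order_trans[OF mult_mono[OF mult_mono[OF d[OF \<rho>(1)] w'[of b]] w'[of c]]])
    show "4 powr s * B * \<rho> * wt s a * (2 powr s * B * wt s b) * (2 powr s * B * wt s c) \<le> W"
      by (simp add: W_def e4 power3_eq_cube)
  qed (use B pos \<rho>0 in auto)
  have t2: "norm (h a' * cnj (h b - h b') * h c) \<le> W"
    unfolding norm_mult complex_mod_cnj
  proof (rule order_trans[OF mult_mono[OF mult_mono[OF w[OF \<rho>(1)] d[OF \<rho>(2)]] w'[of c]]])
    show "2 powr s * B * wt s a * (4 powr s * B * \<rho> * wt s b) * (2 powr s * B * wt s c) \<le> W"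
      by (simp add: W_def e4 power3_eq_cube)
  qed (use B pos \<rho>0 in auto)
  have t3: "norm (h a' * cnj (h b') * (h c - h c')) \<le> W"
    unfolding norm_mult complex_mod_cnj
  proof (rule order_trans[OF mult_mono[OF mult_mono[OF w[OF \<rho>(1)] w[OF \<rho>(2)]] d[OF \<rho>(3)]]])
    show "2 powr s * B * wt s a * (2 powr s * B * wt s b) * (4 powr s * B * \<rho> * wt s c) \<le> W"
      by (simp add: W_def e4 power3_eq_cube)
  qed (use B pos \<rho>0 in auto)
  have "h a * cnj (h b) * h c - h a' * cnj (h b') * h c' =
      (h a - h a') * cnj (h b) * h c + h a' * cnj (h b - h b') * h c + h a' * cnj (h b') * (h c - h c')"
    by (simp add: algebra_simps)
  then have "norm (h a * cnj (h b) * h c - h a' * cnj (h b') * h c') \<le> W + W + W"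
    using norm_triangle_le[OF add_mono[OF norm_triangle_le[OF add_mono[OF t1 t2]] t3]] by simp
  also have "W + W + W = 3 * 16 powr s * B^3 * \<rho> * (wt s a * wt s b * wt s c + 0)"
    by (simp add: W_def e16)
  also have "\<dots> \<le> 3 * 16 powr s * B^3 * \<rho> * (wt s a * wt s b * wt s c + wt s a' * wt s b' * wt s c')"
    using B \<rho>0 wt_pos[of s a'] wt_pos[of s b'] wt_pos[of s c']
    by (intro mult_left_mono add_left_mono) auto
  finally show ?thesis .
next
  case False
  have e: "(1::real) \<le> 16 powr s" using s by (simp add: ge_one_powr_ge_zero)
  have b3: "norm (h a * cnj (h b) * h c) \<le> B^3 * (wt s a * wt s b * wt s c)" for a b c
    unfolding norm_mult complex_mod_cnj
  proof (rule order_trans[OF mult_mono[OF mult_mono[OF bd bd] bd]])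
    show "B * wt s a * (B * wt s b) * (B * wt s c) \<le> B^3 * (wt s a * wt s b * wt s c)"
      by (simp add: power3_eq_cube)
  qed (use B wt_pos[of s a] wt_pos[of s b] in auto)
  have "norm (h a * cnj (h b) * h c - h a' * cnj (h b') * h c') \<le>
     B^3 * (wt s a * wt s b * wt s c) + B^3 * (wt s a' * wt s b' * wt s c')"
    by (rule norm_triangle_le_diff[OF add_mono[OF b3 b3]])
  also have "\<dots> = 1 * 1 * B^3 * 1 * (wt s a * wt s b * wt s c + wt s a' * wt s b' * wt s c')"
    by (simp add: algebra_simps)
  also have "\<dots> \<le> 3 * 16 powr s * B^3 * \<rho> * (wt s a * wt s b * wt s c + wt s a' * wt s b' * wt s c')"
    using e B False wt_pos[of s a'] wt_pos[of s b'] wt_pos[of s c'] wt_pos[of s a] wt_pos[of s b] wt_pos[of s c]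
    by (intro mult_mono add_nonneg_nonneg mult_nonneg_nonneg) auto
  finally show ?thesis .
qed

text \<open>
  An integrable majorant for \<open>integrand h K\<close>. Its two bumps, at \<open>0\<close> and at \<open>- K\<close>, come from the two
  alternatives in \<open>rectangle_product\<close>.
\<close>

definition Phi :: "real \<Rightarrow> real^2 \<Rightarrow> real^2 \<Rightarrow> real" where
  "Phi \<sigma> K x = wt \<sigma> x + wt \<sigma> (K + x)"

lemma Phi_pos: "0 < Phi \<sigma> K x"
  by (simp add: Phi_def add_pos_pos wt_pos)

text \<open>
  The constants \<open>C_int\<close>, \<open>C_lat\<close>, \<open>C_plane\<close> and so on are written out, rather than hidden behind
  existential quantifiers, to make it visible that the final one depends on \<open>\<sigma>\<close> only. Their values are
  of no importance.
\<close>

definition C_int :: "real \<Rightarrow> real" where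
  "C_int \<sigma> = 24 * 64 powr (\<sigma>+1)"

text \<open>
  The four facts about the integrand on which the asymptotics of its sums rest: size, Lipschitz
  dependence on the position and on the slope, and a finer bound for sparse lattices.
\<close>

lemma integrand_bounds:
  fixes h :: "real^2 \<Rightarrow> complex" and \<sigma> B :: real and K :: "real^2"
  defines "s \<equiv> \<sigma> + 1"
  assumes \<sigma>: "\<sigma> > 2" and B: "0 \<le> B"
    and bd: "\<And>x. norm (h x) \<le> B * wt s x"
    and lip: "\<And>x y. norm (x - y) \<le> 1 \<Longrightarrow> norm (h x - h y) \<le> 4 powr s * B * norm (x - y) * wt s x"
  defines "A \<equiv> C_int \<sigma> * B^3 * wt \<sigma> K"
  shows "norm (integrand h K x l) \<le> A * Phi \<sigma> K x"
    and "\<bar>l\<bar> \<le> 1 \<Longrightarrow> norm (integrand h K x l - integrand h K y l) \<le> A * norm (x - y) * (Phi \<sigma> K x + Phi \<sigma> K y)"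
    and "norm (integrand h K x l - integrand h K x m) \<le> A * \<bar>l - m\<bar> * Phi \<sigma> K x"
    and "norm (integrand h K x l) \<le> A * (wt s x + wt (1 + \<sigma>/2) (K + x) * wt (\<sigma>/2) (l *\<^sub>R perp x) / japanese K)"
proof -
  have s: "0 \<le> s" using \<sigma> by (simp add: s_def)
  define T where "T x l = wt s (K + x) * wt s (K + x + l *\<^sub>R perp x) * wt s (K + l *\<^sub>R perp x)" for x l
  have Tpos: "0 < T x l" for x l by (simp add: T_def wt_pos)
  have b3: "norm (integrand h K x l) \<le> B^3 * T x l" for x l
    unfolding norm_mult complex_mod_cnj integrand_def T_def
  proof (rule order_trans[OF mult_mono[OF mult_mono[OF bd bd] bd]])
    show "B * wt s (K + x) * (B * wt s (K + x + l *\<^sub>R perp x)) * (B * wt s (K + l *\<^sub>R perp x)) \<le>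
      B ^ 3 * (wt s (K + x) * wt s (K + x + l *\<^sub>R perp x) * wt s (K + l *\<^sub>R perp x))"
      by (simp add: power3_eq_cube)
  qed (use B wt_pos[of s "K+x"] wt_pos[of s "K+x+l *\<^sub>R perp x"] in auto)
  define D where "D = 4 * 4 powr s * wt \<sigma> K"
  have D0: "0 \<le> D" using wt_pos[of \<sigma> K] by (simp add: D_def)
  have TM: "(1 + norm x) * T x l \<le> D * Phi \<sigma> K x" for x l
    using rectangle_product_le[OF \<sigma>, of "l *\<^sub>R perp x" l x K] by (simp add: T_def s_def Phi_def D_def)
  have T1: "T x l \<le> D * Phi \<sigma> K x" for x l
    using order_trans[OF mult_right_mono[of 1 "1 + norm x" "T x l"] TM[of x l]] Tpos[of x l] by simp
  have T2: "norm x * T x l \<le> D * Phi \<sigma> K x" for x l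
    using order_trans[OF mult_right_mono[of "norm x" "1 + norm x" "T x l"] TM[of x l]] Tpos[of x l] by simp
  have e: "(1::real) \<le> 16 powr s" using s by (simp add: ge_one_powr_ge_zero)
  have e64: "(64::real) powr s = 4 powr s * 16 powr s" by (simp flip: powr_mult)
  have A: "A = 6 * 16 powr s * B^3 * D" by (simp add: A_def C_int_def D_def e64 flip: s_def)
  have Dle: "B^3 * D \<le> A"
    using mult_mono[of 1 "6 * 16 powr s" "B^3 * D" "B^3 * D"] e B D0 unfolding A by (simp add: mult.assoc)
  show "norm (integrand h K x l) \<le> A * Phi \<sigma> K x"
  proof -
    have "norm (integrand h K x l) \<le> B^3 * (D * Phi \<sigma> K x)"
      using b3 T1 B by (meson mult_left_mono order_trans zero_le_power)
    also have "\<dots> \<le> A * Phi \<sigma> K x"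
      using mult_right_mono[OF Dle, of "Phi \<sigma> K x"] Phi_pos[of \<sigma> K x] by simp
    finally show ?thesis .
  qed
  show "norm (integrand h K x l - integrand h K y l) \<le> A * norm (x - y) * (Phi \<sigma> K x + Phi \<sigma> K y)" if l: "\<bar>l\<bar> \<le> 1"
  proof -
    have pd: "perp x - perp y = perp (x - y)" using linear_diff[OF linear_perp] by simp
    have n1: "norm (l *\<^sub>R perp x - l *\<^sub>R perp y) \<le> norm (x - y)"
      using mult_right_mono[OF l norm_ge_zero[of "x - y"]] by (simp add: pd flip: scaleR_diff_right)
    have n2: "norm ((K + x + l *\<^sub>R perp x) - (K + y + l *\<^sub>R perp y)) \<le> 2 * norm (x - y)"
    proof -
      have e: "(K + x + l *\<^sub>R perp x) - (K + y + l *\<^sub>R perp y) = (x - y) + (l *\<^sub>R perp x - l *\<^sub>R perp y)" by simp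
      show ?thesis unfolding e using norm_triangle_ineq[of "x - y" "l *\<^sub>R perp x - l *\<^sub>R perp y"] n1 by linarith
    qed
    have "norm (integrand h K x l - integrand h K y l) \<le> 3 * 16 powr s * B^3 * (2 * norm (x - y)) * (T x l + T y l)"
      unfolding integrand_def T_def
      by (rule triple_product_diff_le[OF s B bd lip]) (use n1 n2 norm_ge_zero[of "x - y"] in \<open>auto intro: order_trans[OF n1]\<close>)
    also have "\<dots> \<le> 3 * 16 powr s * B^3 * (2 * norm (x - y)) * (D * Phi \<sigma> K x + D * Phi \<sigma> K y)"
      using T1 B by (intro mult_left_mono add_mono) auto
    also have "\<dots> = A * norm (x - y) * (Phi \<sigma> K x + Phi \<sigma> K y)" by (simp add: A algebra_simps)
    finally show ?thesis .
  qed
  show "norm (integrand h K x l - integrand h K x m) \<le> A * \<bar>l - m\<bar> * Phi \<sigma> K x"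
  proof -
    have n1: "norm (l *\<^sub>R perp x - m *\<^sub>R perp x) = \<bar>l - m\<bar> * norm x"
      by (simp flip: scaleR_diff_left)
    have "norm (integrand h K x l - integrand h K x m) \<le> 3 * 16 powr s * B^3 * (\<bar>l - m\<bar> * norm x) * (T x l + T x m)"
      unfolding integrand_def T_def
      by (rule triple_product_diff_le[OF s B bd lip]) (use n1 in auto)
    also have "\<dots> = 3 * 16 powr s * B^3 * \<bar>l - m\<bar> * (norm x * T x l + norm x * T x m)"
      by (simp add: algebra_simps)
    also have "\<dots> \<le> 3 * 16 powr s * B^3 * \<bar>l - m\<bar> * (D * Phi \<sigma> K x + D * Phi \<sigma> K x)"
      using T2 B by (intro mult_left_mono add_mono) auto
    also have "\<dots> = A * \<bar>l - m\<bar> * Phi \<sigma> K x" by (simp add: A algebra_simps)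
    finally show ?thesis .
  qed
  show "norm (integrand h K x l) \<le> A * (wt s x + wt (1 + \<sigma>/2) (K + x) * wt (\<sigma>/2) (l *\<^sub>R perp x) / japanese K)"
  proof -
    define R where "R = wt s x + wt (1 + \<sigma>/2) (K + x) * wt (\<sigma>/2) (l *\<^sub>R perp x) / japanese K"
    have R0: "0 \<le> R" unfolding R_def
      using wt_pos[of s x] wt_pos[of "1+\<sigma>/2" "K+x"] wt_pos[of "\<sigma>/2" "l *\<^sub>R perp x"] japanese_pos[of K]
      by (intro add_nonneg_nonneg divide_nonneg_nonneg mult_nonneg_nonneg) auto
    have "T x l \<le> 4 powr s * wt \<sigma> K * R"
      using rectangle_product_le_tail[OF \<sigma>, of "l *\<^sub>R perp x" l x K] by (simp add: T_def s_def R_def)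
    also have "\<dots> \<le> D * R" unfolding D_def using R0 wt_pos[of \<sigma> K] by (intro mult_right_mono) auto
    finally have "B^3 * T x l \<le> B^3 * (D * R)" using B by (intro mult_left_mono) auto
    also have "\<dots> \<le> A * R" using mult_right_mono[OF Dle R0] by simp
    finally show ?thesis using b3[of x l] unfolding R_def by linarith
  qed
qed

lemma integrand_continuous:
  assumes "continuous_on UNIV h"
  shows "continuous_on UNIV (\<lambda>x. integrand h K x l)"
proof -
  have "bounded_linear perp" using linear_perp by (simp add: linear_conv_bounded_linear)
  then have "continuous_on UNIV (\<lambda>x. perp (x :: real^2))" by (rule linear_continuous_on)
  then show ?thesis
    unfolding integrand_def by (intro continuous_intros continuous_on_compose2[OF assms]) auto
qed

section \<open>Lattice sums and Riemann sums\<close>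

lemma powr_step:
  assumes "a > 1" "x > (0::real)"
  shows "(x + 1) powr (-a) \<le> (x powr (1 - a) - (x + 1) powr (1 - a)) / (a - 1)"
proof -
  have "\<exists>z. x < z \<and> z < x + 1 \<and> (x + 1) powr (1 - a) - x powr (1 - a) = (x + 1 - x) * ((1 - a) * z powr (- a))"
  proof (rule MVT2)
    fix z assume "x \<le> z" "z \<le> x + 1"
    then show "((\<lambda>z. z powr (1 - a)) has_real_derivative (1 - a) * z powr (- a)) (at z)"
      using assms has_real_derivative_powr[of z "1 - a"] by simp
  qed auto
  then obtain z where z: "x < z" "z < x + 1" "(x + 1) powr (1 - a) - x powr (1 - a) = (1 - a) * z powr (- a)"
    by auto
  have "(x + 1) powr (- a) \<le> z powr (- a)"
    using z assms by (intro powr_mono2') auto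
  also have "z powr (- a) = (x powr (1 - a) - (x + 1) powr (1 - a)) / (a - 1)"
    using z(3) assms by (simp add: field_simps)
  finally show ?thesis .
qed

text \<open>
  The decay \<open>(Y/m)\<^sup>a\<close>, active only beyond the scale \<open>Y\<close>.
\<close>

definition cap :: "real \<Rightarrow> real \<Rightarrow> nat \<Rightarrow> real" where
  "cap a Y m = min 1 ((Y / real m) powr a)"

lemma cap_nonneg: "0 \<le> cap a Y m" by (simp add: cap_def)

text \<open>
  The sum is at most a constant times the scale \<open>Y\<close>, for small \<open>Y\<close> as well as for large \<open>Y\<close>. Up to the
  factor \<open>2\<^sup>a\<close> the terms are \<open>(Y / (Y + m))\<^sup>a\<close>, and these telescope by \<open>powr_step\<close>.
\<close>

lemma cap_sum:
  assumes a: "a > 1" and Y: "Y > 0" and F: "finite F" "0 \<notin> F"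
  shows "(\<Sum>m\<in>F. cap a Y m) \<le> 2 powr a / (a - 1) * Y"
proof -
  have main: "(\<Sum>m\<in>{1..N}. cap a Y m) \<le> 2 powr a / (a - 1) * Y" for N
  proof -
    have tm: "cap a Y m \<le> (2 * Y) powr a / (a - 1) * ((Y + real (m - 1)) powr (1 - a) - (Y + real m) powr (1 - a))"
      if "m \<in> {1..N}" for m
    proof -
      have m: "m \<ge> 1" using that by simp
      have "cap a Y m \<le> (2 * Y / (Y + real m)) powr a"
      proof (cases "real m \<le> Y")
        case True
        have "1 \<le> (2 * Y / (Y + real m))" using True Y m by (simp add: field_simps)
        then have "1 \<le> (2 * Y / (Y + real m)) powr a" using a by (simp add: ge_one_powr_ge_zero)
        then show ?thesis by (simp add: cap_def)
      next
        case False
        then have "Y / real m \<le> 2 * Y / (Y + real m)" using Y m by (simp add: field_simps)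
        then have "(Y / real m) powr a \<le> (2 * Y / (Y + real m)) powr a" using a Y by (intro powr_mono2) auto
        then show ?thesis by (simp add: cap_def)
      qed
      also have "\<dots> = (2 * Y) powr a * (Y + real m) powr (-a)"
        using Y by (simp add: powr_divide powr_minus field_simps)
      also have "\<dots> \<le> (2 * Y) powr a * (((Y + real (m - 1)) powr (1 - a) - (Y + real m) powr (1 - a)) / (a - 1))"
        using powr_step[OF a, of "Y + real (m - 1)"] Y m by (intro mult_left_mono) (auto simp: of_nat_diff)
      finally show ?thesis by simp
    qed
    have "(\<Sum>m\<in>{1..N}. cap a Y m) \<le>
      (\<Sum>m\<in>{1..N}. (2 * Y) powr a / (a - 1) * ((Y + real (m - 1)) powr (1 - a) - (Y + real m) powr (1 - a)))"
      by (rule sum_mono) (rule tm)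
    also have "\<dots> = (2 * Y) powr a / (a - 1) * (\<Sum>m\<in>{1..N}. (Y + real (m - 1)) powr (1 - a) - (Y + real m) powr (1 - a))"
      by (simp only: sum_distrib_left)
    also have "(\<Sum>m\<in>{1..N}. (Y + real (m - 1)) powr (1 - a) - (Y + real m) powr (1 - a)) = Y powr (1 - a) - (Y + real N) powr (1 - a)"
      by (induction N) auto
    also have "(2 * Y) powr a / (a - 1) * (Y powr (1 - a) - (Y + real N) powr (1 - a)) \<le> (2 * Y) powr a / (a - 1) * Y powr (1 - a)"
      using a by (intro mult_left_mono) auto
    also have "\<dots> = 2 powr a / (a - 1) * Y"
      using Y a by (simp add: powr_mult powr_diff)
    finally show ?thesis .
  qed
  have "F \<subseteq> {1..Max F}" using F by (auto simp: Suc_le_eq) (metis gr0I)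
  then have "(\<Sum>m\<in>F. cap a Y m) \<le> (\<Sum>m\<in>{1..Max F}. cap a Y m)"
    by (intro sum_mono2) (auto simp: cap_nonneg)
  with main show ?thesis by (meson order_trans)
qed

lemma wt_le_norm: "a \<ge> 0 \<Longrightarrow> 0 < r \<Longrightarrow> r \<le> norm x \<Longrightarrow> wt a x \<le> r powr (- a)"
  unfolding wt_def using norm_le_japanese[of x] by (intro powr_mono2') auto

lemma sum_abs_le:
  fixes \<psi> :: "nat \<Rightarrow> real"
  assumes T: "finite T" and \<psi>: "\<And>n. 0 \<le> \<psi> n" and S: "\<And>i. i \<in> S \<Longrightarrow> nat \<bar>i\<bar> \<in> T"
  shows "(\<Sum>i\<in>S. \<psi> (nat \<bar>i\<bar>)) \<le> 2 * (\<Sum>n\<in>T. \<psi> n)"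
proof -
  have "S \<subseteq> int ` T \<union> (\<lambda>n. - int n) ` T"
  proof
    fix i assume "i \<in> S"
    then have "nat \<bar>i\<bar> \<in> T" by (rule S)
    moreover have "i = int (nat \<bar>i\<bar>) \<or> i = - int (nat \<bar>i\<bar>)" by linarith
    ultimately show "i \<in> int ` T \<union> (\<lambda>n. - int n) ` T" by blast
  qed
  then have "(\<Sum>i\<in>S. \<psi> (nat \<bar>i\<bar>)) \<le> (\<Sum>i\<in>int ` T \<union> (\<lambda>n. - int n) ` T. \<psi> (nat \<bar>i\<bar>))"
    using T by (intro sum_mono2) (auto simp: \<psi>)
  also have "\<dots> \<le> (\<Sum>i\<in>int ` T. \<psi> (nat \<bar>i\<bar>)) + (\<Sum>i\<in>(\<lambda>n. - int n) ` T. \<psi> (nat \<bar>i\<bar>))"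
    using T by (subst sum.union_inter[symmetric]) (auto simp: sum_nonneg \<psi>)
  also have "\<dots> = 2 * (\<Sum>n\<in>T. \<psi> n)"
    by (simp add: sum.reindex inj_on_def)
  finally show ?thesis .
qed

text \<open>
  After a shift by an integer multiple of the mesh one may assume \<open>0 \<le> u \<le> \<delta>\<close>. The terms with index \<open>-1\<close>,
  \<open>0\<close>, \<open>1\<close> are at most \<open>1\<close>, the others are covered by \<open>cap_sum\<close> with scale \<open>1/\<delta>\<close>.
\<close>

lemma wt_sum_1d:
  assumes a: "a > 1" and \<delta>: "\<delta> > 0" and F: "finite F"
  shows "(\<Sum>m\<in>F. wt a (u + \<delta> * real_of_int m)) \<le> (4 + 2 * (2 powr a / (a - 1))) * (1 + 1 / \<delta>)"
proof -
  define k where "k = \<lfloor>u / \<delta>\<rfloor>"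
  define r where "r = u - \<delta> * k"
  have r: "0 \<le> r" "r \<le> \<delta>"
  proof -
    have "of_int k \<le> u / \<delta>" "u / \<delta> \<le> of_int k + 1" unfolding k_def by linarith+
    then show "0 \<le> r" "r \<le> \<delta>" using \<delta> by (auto simp: r_def field_simps)
  qed
  define G where "G = (\<lambda>m. m + k) ` F"
  have G: "finite G" using F by (simp add: G_def)
  define \<psi> where "\<psi> n = (if n \<le> 1 then 1 else cap a (1 / \<delta>) (n - 1))" for n :: nat
  have \<psi>0: "0 \<le> \<psi> n" for n by (simp add: \<psi>_def cap_nonneg)
  have bd: "wt a (r + \<delta> * real_of_int i) \<le> \<psi> (nat \<bar>i\<bar>)" for i
  proof (cases "nat \<bar>i\<bar> \<le> 1")
    case True
    then show ?thesis using wt_le_1[of a "r + \<delta> * real_of_int i"] a by (simp add: \<psi>_def)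
  next
    case False
    have i: "2 \<le> \<bar>i\<bar>" using False by simp
    have n1: "real (nat \<bar>i\<bar> - 1) = \<bar>real_of_int i\<bar> - 1" using i by (simp add: of_nat_diff)
    have ab: "\<delta> * \<bar>real_of_int i\<bar> = \<bar>\<delta> * real_of_int i\<bar>" using \<delta> by (simp add: abs_mult)
    have "\<delta> * (\<bar>real_of_int i\<bar> - 1) \<le> \<bar>r + \<delta> * real_of_int i\<bar>"
      using r unfolding right_diff_distrib ab by linarith
    moreover have "0 < \<delta> * (\<bar>real_of_int i\<bar> - 1)" using \<delta> i by (intro mult_pos_pos) linarith+
    ultimately have "wt a (r + \<delta> * real_of_int i) \<le> (\<delta> * (\<bar>real_of_int i\<bar> - 1)) powr (- a)"
      using a by (intro wt_le_norm) auto
    also have "\<dots> = (1 / \<delta> / real (nat \<bar>i\<bar> - 1)) powr a"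
      using \<delta> i unfolding n1 by (simp add: powr_minus powr_divide powr_mult field_simps)
    finally show ?thesis using False wt_le_1[of a "r + \<delta> * real_of_int i"] a by (simp add: \<psi>_def cap_def)
  qed
  have "(\<Sum>m\<in>F. wt a (u + \<delta> * real_of_int m)) = (\<Sum>i\<in>G. wt a (r + \<delta> * real_of_int i))"
    unfolding G_def by (subst sum.reindex) (auto simp: inj_on_def r_def algebra_simps)
  also have "\<dots> \<le> (\<Sum>i\<in>G. \<psi> (nat \<bar>i\<bar>))" by (rule sum_mono) (rule bd)
  also have "\<dots> \<le> 2 * (\<Sum>n\<in>(\<lambda>i. nat \<bar>i\<bar>) ` G. \<psi> n)"
    using G by (intro sum_abs_le \<psi>0) auto
  also have "(\<Sum>n\<in>(\<lambda>i. nat \<bar>i\<bar>) ` G. \<psi> n) \<le> 2 + 2 powr a / (a - 1) * (1 / \<delta>)"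
  proof -
    obtain N where "\<forall>n\<in>(\<lambda>i. nat \<bar>i\<bar>) ` G. n \<le> N"
      using G finite_nat_set_iff_bounded_le by blast
    then have "(\<lambda>i. nat \<bar>i\<bar>) ` G \<subseteq> {0,1} \<union> {2..N+2}" by force
    then have "(\<Sum>n\<in>(\<lambda>i. nat \<bar>i\<bar>) ` G. \<psi> n) \<le> (\<Sum>n\<in>{0,1} \<union> {2..N+2}. \<psi> n)"
      by (intro sum_mono2) (auto simp: \<psi>0)
    also have "\<dots> = 2 + (\<Sum>n\<in>{2..N+2}. \<psi> n)"
      by (subst sum.union_disjoint) (auto simp: \<psi>_def)
    also have "(\<Sum>n\<in>{2..N+2}. \<psi> n) = (\<Sum>n\<in>{1..N+1}. cap a (1/\<delta>) n)"
      by (rule sum.reindex_bij_witness[of _ Suc "\<lambda>n. n - 1"]) (auto simp: \<psi>_def)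
    also have "\<dots> \<le> 2 powr a / (a - 1) * (1 / \<delta>)"
      using a \<delta> by (intro cap_sum) auto
    finally show ?thesis by simp
  qed
  also have "2 * (2 + c * (1 / \<delta>)) \<le> (4 + 2 * c) * (1 + 1 / \<delta>)" if "0 \<le> c" for c
    using that \<delta> by (simp add: distrib_left distrib_right add_divide_distrib)
  finally show ?thesis using a by simp
qed

definition pt :: "int \<times> int \<Rightarrow> real^2" where
  "pt M = vector [real_of_int (fst M), real_of_int (snd M)]"

lemma pt_nth [simp]: "pt M $ 1 = real_of_int (fst M)" "pt M $ 2 = real_of_int (snd M)"
  by (simp_all add: pt_def)

text \<open>
  Half of the exponent for each coordinate, so that planar sums factor into sums over the line.
\<close>

lemma wt_prod: "0 \<le> a \<Longrightarrow> wt a (v::real^2) \<le> wt (a/2) (v $ 1) * wt (a/2) (v $ 2)"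
proof -
  assume a: "0 \<le> a"
  have "(japanese (v $ 1) * japanese (v $ 2))\<^sup>2 \<le> ((japanese v)\<^sup>2)\<^sup>2"
    unfolding power_mult_distrib japanese_sq norm_vec2
  proof -
    have "(1 + p) * (1 + q) \<le> (1 + (p + q))\<^sup>2" if "0 \<le> p" "0 \<le> q" for p q :: real
      using that by (simp add: power2_eq_square algebra_simps)
    from this[of "(v $ 1)\<^sup>2" "(v $ 2)\<^sup>2"]
    show "(1 + (norm (v $ 1))\<^sup>2) * (1 + (norm (v $ 2))\<^sup>2) \<le> (1 + ((v $ 1)\<^sup>2 + (v $ 2)\<^sup>2))\<^sup>2" by simp
  qed
  then have le: "japanese (v $ 1) * japanese (v $ 2) \<le> (japanese v)\<^sup>2"
    by (rule power2_le_imp_le) simp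
  have "(japanese (v $ 1) * japanese (v $ 2)) powr (a/2) \<le> ((japanese v)\<^sup>2) powr (a/2)"
    using a le japanese_pos[of "v $ 1"] japanese_pos[of "v $ 2"] by (intro powr_mono2) auto
  also have "\<dots> = japanese v powr a"
    using japanese_pos[of v] by (simp add: powr_powr flip: powr_numeral)
  finally show ?thesis
    using japanese_pos[of "v $ 1"] japanese_pos[of "v $ 2"] japanese_pos[of v]
    by (simp add: wt_def powr_minus powr_mult field_simps)
qed

definition C_lat :: "real \<Rightarrow> real" where
  "C_lat a = (4 + 2 * (2 powr (a/2) / (a/2 - 1)))\<^sup>2"

lemma C_lat_nonneg: "0 \<le> C_lat a" by (simp add: C_lat_def)

text \<open>
  Uniform in the translation \<open>u\<close>, which will be \<open>0\<close> or \<open>K\<close>.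
\<close>

lemma wt_sum_2d:
  assumes a: "a > 2" and \<delta>: "\<delta> > 0" and F: "finite F"
  shows "(\<Sum>M\<in>F. wt a (u + \<delta> *\<^sub>R pt M)) \<le> C_lat a * (1 + 1 / \<delta>)\<^sup>2"
proof -
  have "(\<Sum>M\<in>F. wt a (u + \<delta> *\<^sub>R pt M)) \<le> (\<Sum>M\<in>fst ` F \<times> snd ` F. wt a (u + \<delta> *\<^sub>R pt M))"
    using F subset_fst_snd[of F] by (intro sum_mono2) (auto simp: wt_pos less_imp_le)
  also have "\<dots> \<le> (\<Sum>M\<in>fst ` F \<times> snd ` F. wt (a/2) (u $ 1 + \<delta> * real_of_int (fst M)) * wt (a/2) (u $ 2 + \<delta> * real_of_int (snd M)))"
    using a by (intro sum_mono order_trans[OF wt_prod]) auto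
  also have "\<dots> = (\<Sum>m\<in>fst ` F. wt (a/2) (u $ 1 + \<delta> * real_of_int m)) * (\<Sum>m\<in>snd ` F. wt (a/2) (u $ 2 + \<delta> * real_of_int m))"
    by (simp add: sum_product sum.cartesian_product case_prod_unfold)
  also have "\<dots> \<le> ((4 + 2 * (2 powr (a/2) / (a/2 - 1))) * (1 + 1 / \<delta>)) * ((4 + 2 * (2 powr (a/2) / (a/2 - 1))) * (1 + 1 / \<delta>))"
    using a \<delta> F by (intro mult_mono wt_sum_1d sum_nonneg mult_nonneg_nonneg add_nonneg_nonneg) (auto simp: wt_pos less_imp_le)
  finally show ?thesis by (simp add: C_lat_def power2_eq_square mult_ac)
qed

text \<open>
  The cell of the mesh \<open>\<delta> \<int>\<^sup>2\<close> that contains \<open>x\<close>, named by its lower left corner.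
\<close>

definition cell_index :: "real \<Rightarrow> real^2 \<Rightarrow> int \<times> int" where
  "cell_index \<delta> x = (\<lfloor>x $ 1 / \<delta>\<rfloor>, \<lfloor>x $ 2 / \<delta>\<rfloor>)"

lemma vimage_cell_index: "\<delta> > 0 \<Longrightarrow> cell_index \<delta> -` {M} =
   {x. \<delta> * of_int (fst M) \<le> x $ 1 \<and> x $ 1 < \<delta> * (of_int (fst M) + 1) \<and>
       \<delta> * of_int (snd M) \<le> x $ 2 \<and> x $ 2 < \<delta> * (of_int (snd M) + 1)}"
  by (cases M) (auto simp: cell_index_def floor_eq_iff field_simps)

lemma measurable_cell_index [measurable]: "\<delta> > 0 \<Longrightarrow> cell_index \<delta> \<in> borel \<rightarrow>\<^sub>M count_space UNIV"
proof -
  assume \<delta>: "\<delta> > 0"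
  have "cell_index \<delta> -` {M} \<in> sets borel" for M
    unfolding vimage_cell_index[OF \<delta>] by measurable
  then show ?thesis by (simp add: measurable_count_space_eq2_countable)
qed

lemma emeasure_cell: "\<delta> > 0 \<Longrightarrow> emeasure lborel (cell_index \<delta> -` {M}) = ennreal (\<delta>\<^sup>2)"
proof -
  assume \<delta>: "\<delta> > 0"
  define l where "l = \<delta> *\<^sub>R pt M"
  define u where "u = (l + vector [\<delta>, \<delta>] :: real^2)"
  have prod: "(\<Prod>b\<in>Basis. (u - l) \<bullet> b) = \<delta>\<^sup>2" "\<forall>b\<in>Basis. l \<bullet> b \<le> u \<bullet> b"
    using \<delta> by (auto simp: u_def Basis_vec_def UNIV_2 inner_axis power2_eq_square inner_add_left axis_eq_axis)
  have sub: "box l u \<subseteq> cell_index \<delta> -` {M}" "cell_index \<delta> -` {M} \<subseteq> cbox l u"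
    unfolding vimage_cell_index[OF \<delta>] by (auto simp: mem_box_cart u_def l_def forall_2 algebra_simps less_imp_le)
  have cm: "cell_index \<delta> -` {M} \<in> sets lborel"
    using measurable_sets[OF measurable_cell_index[OF \<delta>], of "{M}"] by simp
  show ?thesis
  proof (rule antisym)
    show "emeasure lborel (cell_index \<delta> -` {M}) \<le> ennreal (\<delta>\<^sup>2)"
      using emeasure_mono[OF sub(2), of lborel] prod by (simp add: emeasure_lborel_cbox_eq)
    show "ennreal (\<delta>\<^sup>2) \<le> emeasure lborel (cell_index \<delta> -` {M})"
      using emeasure_mono[OF sub(1) cm] prod by (simp add: emeasure_lborel_box_eq)
  qed
qed

text \<open>
  Under \<open>cell_index\<close> Lebesgue measure becomes \<open>\<delta>\<^sup>2\<close> times counting measure. So a Riemann sum is itself an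
  integral over the plane, namely of the function frozen at the corner of each cell.
\<close>

lemma distr_cell_index:
  assumes \<delta>: "\<delta> > 0"
  shows "distr lborel (count_space UNIV) (cell_index \<delta>) = density (count_space UNIV) (\<lambda>_. ennreal (\<delta>\<^sup>2))"
proof (rule measure_eqI_countable[of _ UNIV])
  fix M
  have "emeasure (distr lborel (count_space UNIV) (cell_index \<delta>)) {M} = emeasure lborel (cell_index \<delta> -` {M})"
    using \<delta> by (subst emeasure_distr) auto
  also have "\<dots> = emeasure (density (count_space UNIV) (\<lambda>_. ennreal (\<delta>\<^sup>2))) {M}"
    by (simp add: emeasure_cell[OF \<delta>] emeasure_density nn_integral_count_space_indicator[symmetric] one_ennreal_def[symmetric])
  finally show "emeasure (distr lborel (count_space UNIV) (cell_index \<delta>)) {M} = emeasure (density (count_space UNIV) (\<lambda>_. ennreal (\<delta>\<^sup>2))) {M}" .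
qed auto

lemma integrable_cell_iff:
  fixes f :: "int \<times> int \<Rightarrow> 'b::{banach,second_countable_topology}"
  assumes \<delta>: "\<delta> > 0"
  shows "integrable lborel (\<lambda>x. f (cell_index \<delta> x)) \<longleftrightarrow> integrable (count_space UNIV) f"
proof -
  have "integrable lborel (\<lambda>x. f (cell_index \<delta> x)) \<longleftrightarrow> integrable (distr lborel (count_space UNIV) (cell_index \<delta>)) f"
    using \<delta> by (subst integrable_distr_eq) auto
  also have "\<dots> \<longleftrightarrow> integrable (count_space UNIV) (\<lambda>M. \<delta>\<^sup>2 *\<^sub>R f M)"
    unfolding distr_cell_index[OF \<delta>] by (subst integrable_density) auto
  also have "\<dots> \<longleftrightarrow> integrable (count_space UNIV) f"
    using \<delta> integrable_scaleR_right[of "1/\<delta>\<^sup>2" "count_space UNIV" "\<lambda>M. \<delta>\<^sup>2 *\<^sub>R f M"]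
      integrable_scaleR_right[of "\<delta>\<^sup>2" "count_space UNIV" f] by auto
  finally show ?thesis .
qed

lemma integral_cell:
  fixes f :: "int \<times> int \<Rightarrow> 'b::{banach,second_countable_topology}"
  assumes \<delta>: "\<delta> > 0"
  shows "(LINT x|lborel. f (cell_index \<delta> x)) = \<delta>\<^sup>2 *\<^sub>R (LINT M|count_space UNIV. f M)"
proof -
  have "(LINT x|lborel. f (cell_index \<delta> x)) = integral\<^sup>L (distr lborel (count_space UNIV) (cell_index \<delta>)) f"
    using \<delta> by (subst integral_distr) auto
  also have "\<dots> = \<delta>\<^sup>2 *\<^sub>R (LINT M|count_space UNIV. f M)"
    unfolding distr_cell_index[OF \<delta>] using \<delta> by (subst integral_density) auto
  finally show ?thesis .
qed

lemma integrable_count_space_bounded: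
  fixes f :: "'a \<Rightarrow> real"
  assumes "\<And>x. 0 \<le> f x" "\<And>F. finite F \<Longrightarrow> sum f F \<le> C"
  shows "integrable (count_space UNIV) f" "(LINT x|count_space UNIV. f x) \<le> C"
proof -
  have s: "f summable_on UNIV"
    using assms by (intro nonneg_bdd_above_summable_on bdd_aboveI2[of _ _ C]) auto
  have "(\<lambda>x. norm (f x)) = f" by (auto simp: assms(1))
  with s have "(\<lambda>x. norm (f x)) summable_on UNIV" by simp
  then have a: "Infinite_Set_Sum.abs_summable_on f UNIV" by (rule abs_summable_equivalent[THEN iffD1])
  then show "integrable (count_space UNIV) f" by (simp add: Infinite_Set_Sum.abs_summable_on_def)
  have "infsum f UNIV \<le> C" using s assms by (intro infsum_le_finite_sums) auto
  then show "(LINT x|count_space UNIV. f x) \<le> C" using infsetsum_infsum[OF a] by (simp add: infsetsum_def)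
qed

lemma cell_dist:
  assumes "\<delta> > 0" shows "norm (x - \<delta> *\<^sub>R pt (cell_index \<delta> x)) \<le> 2 * \<delta>"
proof -
  have 1: "\<bar>t - \<delta> * of_int \<lfloor>t / \<delta>\<rfloor>\<bar> \<le> \<delta>" for t
  proof -
    have "of_int \<lfloor>t / \<delta>\<rfloor> \<le> t / \<delta>" "t / \<delta> \<le> of_int \<lfloor>t / \<delta>\<rfloor> + 1" by linarith+
    then have "\<delta> * of_int \<lfloor>t / \<delta>\<rfloor> \<le> t" "t \<le> \<delta> * of_int \<lfloor>t / \<delta>\<rfloor> + \<delta>"
      using mult_left_mono[of "of_int \<lfloor>t / \<delta>\<rfloor>" "t / \<delta>" \<delta>] mult_left_mono[of "t / \<delta>" "of_int \<lfloor>t / \<delta>\<rfloor> + 1" \<delta>] assms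
      by (auto simp: distrib_left)
    then show ?thesis by linarith
  qed
  have "norm (x - \<delta> *\<^sub>R pt (cell_index \<delta> x)) \<le> (\<Sum>i\<in>UNIV. \<bar>(x - \<delta> *\<^sub>R pt (cell_index \<delta> x)) $ i\<bar>)"
    by (rule norm_le_l1_cart)
  also have "\<dots> \<le> \<delta> + \<delta>" unfolding UNIV_2 using 1[of "x $ 1"] 1[of "x $ 2"] by (simp add: cell_index_def)
  finally show ?thesis by simp
qed

lemma borel_measurable_wt [measurable]: "(\<lambda>x::real^2. wt a (u + x)) \<in> borel_measurable borel"
  by (intro borel_measurable_continuous_onI continuous_intros)

definition C_plane :: "real \<Rightarrow> real" where
  "C_plane a = 2 powr a * (9 / 4 * C_lat a)"

text \<open>
  Comparison with a lattice sum of mesh \<open>1/2\<close>, for which points of the same cell have distance at most \<open>1\<close>.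
\<close>

lemma wt_integral:
  assumes a: "a > 2"
  shows "integrable lborel (\<lambda>x::real^2. wt a (u + x))" "(LINT x|lborel. wt a (u + x :: real^2)) \<le> C_plane a"
proof -
  let ?f = "\<lambda>M. wt a (u + (1/2) *\<^sub>R pt M)"
  have fin: "sum ?f F \<le> C_lat a * 9" if "finite F" for F
    using wt_sum_2d[OF a _ that, of "1/2" u] by simp
  note c = integrable_count_space_bounded[of ?f, OF less_imp_le[OF wt_pos] fin]
  have i: "integrable lborel (\<lambda>x. 2 powr a * ?f (cell_index (1/2) x))"
    using c(1) integrable_cell_iff[of "1/2" ?f] by simp
  have le: "wt a (u + x) \<le> 2 powr a * ?f (cell_index (1/2) x)" for x
    using wt_near[of a "u + (1/2) *\<^sub>R pt (cell_index (1/2) x)" "u + x"] cell_dist[of "1/2" x] a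
    by (simp add: norm_minus_commute)
  show i': "integrable lborel (\<lambda>x::real^2. wt a (u + x))"
    by (rule Bochner_Integration.integrable_bound[OF i]) (use le in \<open>auto simp: wt_pos less_imp_le\<close>)
  have "(LINT x|lborel. wt a (u + x :: real^2)) \<le> (LINT x|lborel. 2 powr a * ?f (cell_index (1/2) x))"
    by (rule integral_mono[OF i' i le])
  also have "\<dots> = 2 powr a * ((1/2)\<^sup>2 * (LINT M|count_space UNIV. ?f M))"
    using integral_cell[of "1/2" ?f] by simp
  also have "\<dots> \<le> 2 powr a * ((1/2)\<^sup>2 * (C_lat a * 9))" using c(2) by (intro mult_left_mono) auto
  finally show "(LINT x|lborel. wt a (u + x :: real^2)) \<le> C_plane a" by (simp add: C_plane_def power2_eq_square)
qed

lemma Phi_integral: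
  assumes a: "\<sigma> > 2"
  shows "integrable lborel (Phi \<sigma> K)" "(LINT x|lborel. Phi \<sigma> K x) \<le> 2 * C_plane \<sigma>"
  using wt_integral[OF a, of 0] wt_integral[OF a, of K] by (auto simp: Phi_def[abs_def])

lemma Phi_sum:
  assumes a: "\<sigma> > 2" and \<delta>: "\<delta> > 0" and F: "finite F"
  shows "(\<Sum>M\<in>F. Phi \<sigma> K (\<delta> *\<^sub>R pt M)) \<le> 2 * C_lat \<sigma> * (1 + 1 / \<delta>)\<^sup>2"
  using wt_sum_2d[OF a \<delta> F, of 0] wt_sum_2d[OF a \<delta> F, of K] by (simp add: Phi_def sum.distrib)

definition C_riemann :: "real \<Rightarrow> real" where
  "C_riemann \<sigma> = 4 * C_plane \<sigma> + 16 * C_lat \<sigma>"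

lemma C_riemann_nonneg: "0 \<le> C_riemann \<sigma>" by (simp add: C_riemann_def C_plane_def C_lat_nonneg)

text \<open>
  The difference is the integral of \<open>f(x) - f(y(x))\<close>, where \<open>y(x)\<close> is the corner of the cell of \<open>x\<close>. The
  Lipschitz bound involves the majorant at both points: its value at \<open>x\<close> is integrated, its value at
  \<open>y(x)\<close> is summed over the lattice.
\<close>

lemma riemann_sum:
  fixes f :: "real^2 \<Rightarrow> complex"
  assumes \<sigma>: "\<sigma> > 2" and \<delta>: "0 < \<delta>" "\<delta> \<le> 1" and A: "0 \<le> A"
    and cont: "continuous_on UNIV f"
    and bd: "\<And>x. norm (f x) \<le> A * Phi \<sigma> K x"
    and lip: "\<And>x y. norm (f x - f y) \<le> A * norm (x - y) * (Phi \<sigma> K x + Phi \<sigma> K y)"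
  shows "norm ((LINT x|lborel. f x) - \<delta>\<^sup>2 *\<^sub>R (\<Sum>\<^sub>\<infinity>M. f (\<delta> *\<^sub>R pt M))) \<le> C_riemann \<sigma> * A * \<delta>"
proof -
  define y where "y x = \<delta> *\<^sub>R pt (cell_index \<delta> x)" for x
  have fm [measurable]: "f \<in> borel_measurable borel" using cont by (rule borel_measurable_continuous_onI)
  have if': "integrable lborel f"
    by (rule Bochner_Integration.integrable_bound[of _ "\<lambda>x. A * Phi \<sigma> K x"])
      (use Phi_integral[OF \<sigma>] bd A Phi_pos in \<open>auto simp: abs_mult less_imp_le\<close>)
  note S = integrable_count_space_bounded[of "\<lambda>M. Phi \<sigma> K (\<delta> *\<^sub>R pt M)", OF less_imp_le[OF Phi_pos] Phi_sum[OF \<sigma> \<delta>(1)]]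
  have iPy: "integrable lborel (\<lambda>x. Phi \<sigma> K (y x))"
    unfolding y_def using S(1) integrable_cell_iff[OF \<delta>(1), of "\<lambda>M. Phi \<sigma> K (\<delta> *\<^sub>R pt M)"] by simp
  have ic: "integrable (count_space UNIV) (\<lambda>M. f (\<delta> *\<^sub>R pt M))"
    by (rule Bochner_Integration.integrable_bound[of _ "\<lambda>M. A * Phi \<sigma> K (\<delta> *\<^sub>R pt M)"])
      (use S(1) bd A Phi_pos in \<open>auto simp: abs_mult less_imp_le\<close>)
  then have inf: "(LINT M|count_space UNIV. f (\<delta> *\<^sub>R pt M)) = (\<Sum>\<^sub>\<infinity>M. f (\<delta> *\<^sub>R pt M))"
    using infsetsum_infsum[of "\<lambda>M. f (\<delta> *\<^sub>R pt M)" UNIV]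
    by (simp add: infsetsum_def Infinite_Set_Sum.abs_summable_on_def)
  have iy: "integrable lborel (\<lambda>x. f (y x))"
    unfolding y_def using ic integrable_cell_iff[OF \<delta>(1), of "\<lambda>M. f (\<delta> *\<^sub>R pt M)"] by simp
  have eq: "(LINT x|lborel. f (y x)) = \<delta>\<^sup>2 *\<^sub>R (\<Sum>\<^sub>\<infinity>M. f (\<delta> *\<^sub>R pt M))"
    unfolding y_def integral_cell[OF \<delta>(1), of "\<lambda>M. f (\<delta> *\<^sub>R pt M)"] inf ..
  have eqP: "(LINT x|lborel. Phi \<sigma> K (y x)) = \<delta>\<^sup>2 * (LINT M|count_space UNIV. Phi \<sigma> K (\<delta> *\<^sub>R pt M))"
    unfolding y_def integral_cell[OF \<delta>(1), of "\<lambda>M. Phi \<sigma> K (\<delta> *\<^sub>R pt M)"] by simp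
  have le: "norm (f x - f (y x)) \<le> A * (2 * \<delta>) * (Phi \<sigma> K x + Phi \<sigma> K (y x))" for x
    using order_trans[OF lip mult_right_mono[OF mult_left_mono[OF cell_dist[OF \<delta>(1), of x] A]]]
      Phi_pos[of \<sigma> K x] Phi_pos[of \<sigma> K "y x"] by (simp add: y_def)
  have "norm ((LINT x|lborel. f x) - (LINT x|lborel. f (y x))) = norm (LINT x|lborel. f x - f (y x))"
    using if' iy by simp
  also have "\<dots> \<le> (LINT x|lborel. A * (2 * \<delta>) * (Phi \<sigma> K x + Phi \<sigma> K (y x)))"
    by (rule Bochner_Integration.integral_norm_bound_integral) (use if' iy Phi_integral(1)[OF \<sigma>, of K] iPy le in auto)
  also have "\<dots> = A * (2 * \<delta>) * ((LINT x|lborel. Phi \<sigma> K x) + (LINT x|lborel. Phi \<sigma> K (y x)))"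
    using Phi_integral(1)[OF \<sigma>, of K] iPy by simp
  also have "\<dots> \<le> A * (2 * \<delta>) * (2 * C_plane \<sigma> + 8 * C_lat \<sigma>)"
  proof (intro mult_left_mono add_mono)
    have "\<delta>\<^sup>2 * (1 + 1 / \<delta>)\<^sup>2 = (\<delta> + 1)\<^sup>2" using \<delta> by (simp add: field_simps flip: power_mult_distrib)
    also have "\<dots> \<le> 2\<^sup>2" using \<delta> by (intro power_mono) auto
    finally have d4: "\<delta>\<^sup>2 * (1 + 1 / \<delta>)\<^sup>2 \<le> 4" by simp
    have "(LINT x|lborel. Phi \<sigma> K (y x)) \<le> \<delta>\<^sup>2 * (2 * C_lat \<sigma> * (1 + 1 / \<delta>)\<^sup>2)"
      unfolding eqP by (intro mult_left_mono S(2)) auto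
    also have "\<dots> = 2 * C_lat \<sigma> * (\<delta>\<^sup>2 * (1 + 1 / \<delta>)\<^sup>2)" by simp
    also have "\<dots> \<le> 2 * C_lat \<sigma> * 4" using d4 C_lat_nonneg by (intro mult_left_mono) auto
    finally show "(LINT x|lborel. Phi \<sigma> K (y x)) \<le> 8 * C_lat \<sigma>" by simp
  qed (use Phi_integral(2)[OF \<sigma>] A \<delta> in auto)
  finally show ?thesis unfolding eq by (simp add: C_riemann_def algebra_simps)
qed

section \<open>Averages over Farey fractions\<close>

text \<open>
  Numerators of the reduced fractions with denominator \<open>q\<close> in \<open>[-1, 1)\<close>.
\<close>

definition reduced :: "nat \<Rightarrow> int set" where
  "reduced q = {p \<in> {- int q..<int q}. coprime p (int q)}"

lemma finite_reduced [simp]: "finite (reduced q)"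
  by (rule finite_subset[of _ "{- int q..<int q}"]) (auto simp: reduced_def)

lemma card_reduced: "card (reduced q) \<le> 2 * q"
proof -
  have "card (reduced q) \<le> card {- int q..<int q}"
    by (rule card_mono) (auto simp: reduced_def)
  then show ?thesis by simp
qed

lemma reduced_abs: "p \<in> reduced q \<Longrightarrow> \<bar>real_of_int p / real q\<bar> \<le> 1"
  by (auto simp: reduced_def abs_le_iff divide_le_eq field_simps)

text \<open>
  Every fraction with denominator \<open>m\<close> has exactly one reduced form.
\<close>

lemma sum_fractions_reduced:
  fixes f :: "real \<Rightarrow> 'a::comm_monoid_add"
  assumes m: "m > 0"
  shows "(\<Sum>p\<in>{- int m..<int m}. f (of_int p / of_nat m)) =
    (\<Sum>q | q dvd m. \<Sum>p\<in>reduced q. f (of_int p / of_nat q))"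
proof -
  have fin: "finite {q. q dvd m}" using m by simp
  have "(\<Sum>q | q dvd m. \<Sum>p\<in>reduced q. f (of_int p / of_nat q)) =
      (\<Sum>(q,p)\<in>(SIGMA q:{q. q dvd m}. reduced q). f (of_int p / of_nat q))"
    using fin by (subst sum.Sigma) auto
  also have "\<dots> = (\<Sum>p\<in>{- int m..<int m}. f (of_int p / of_nat m))"
  proof (rule sum.reindex_bij_witness[of _ "\<lambda>p. (nat (int m div gcd p (int m)), p div gcd p (int m))" "\<lambda>(q,p). p * int (m div q)"])
    fix x assume "x \<in> (SIGMA q:{q. q dvd m}. reduced q)"
    then obtain q p where x: "x = (q,p)" "q dvd m" "p \<in> reduced q" by auto
    obtain k where k: "m = q * k" using x(2) by auto
    have q0: "q > 0" "k > 0" using m k by auto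
    have g: "gcd (p * int k) (int q * int k) = int k"
      using x(3) by (auto simp: gcd_mult_right reduced_def coprime_iff_gcd_eq_1 gcd.commute)
    show "(\<lambda>(q,p). p * int (m div q)) x \<in> {- int m..<int m}"
      using x k q0 mult_right_mono[of "- int q" p "int k"] by (auto simp: reduced_def)
    show "(nat (int m div gcd ((\<lambda>(q,p). p * int (m div q)) x) (int m)),
            ((\<lambda>(q,p). p * int (m div q)) x) div gcd ((\<lambda>(q,p). p * int (m div q)) x) (int m)) = x"
      using x k q0 g by simp
    show "f (of_int ((\<lambda>(q,p). p * int (m div q)) x) / of_nat m) = (case x of (q, p) \<Rightarrow> f (of_int p / of_nat q))"
      using x k q0 by simp
  next
    fix p assume p: "p \<in> {- int m..<int m}"
    define g where "g = gcd p (int m)"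
    have g0: "g > 0" using m by (simp add: g_def)
    define k where "k = int m div g"
    define r where "r = p div g"
    have k: "int m = g * k" and r: "p = g * r" by (simp_all add: g_def k_def r_def)
    have k0: "k > 0" using k g0 m by (metis of_nat_0_less_iff zero_less_mult_pos)
    have cop: "coprime r k" unfolding r_def k_def g_def using m by (intro div_gcd_coprime) simp
    have mk: "m div nat k = nat g"
      using k g0 k0 by (metis nat_int nat_mult_distrib less_imp_le nonzero_mult_div_cancel_right zero_less_nat_eq less_numeral_extra(3))
    have dv: "nat k dvd m" using k g0 k0 by (metis dvd_triv_right nat_dvd_iff nat_int nat_mult_distrib less_imp_le)
    have rb: "- k \<le> r" "r < k"
      using p g0 unfolding k r by (auto simp: mult_less_cancel_left_pos) (metis minus_mult_right mult_le_cancel_left_pos)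
    show "(nat (int m div gcd p (int m)), p div gcd p (int m)) \<in> (SIGMA q:{q. q dvd m}. reduced q)"
      unfolding g_def[symmetric] using k r g0 k0 cop dv rb by (auto simp: reduced_def)
    show "(\<lambda>(q,p). p * int (m div q)) (nat (int m div gcd p (int m)), p div gcd p (int m)) = p"
      unfolding g_def[symmetric] using k r g0 mk by simp
  qed
  finally show ?thesis ..
qed

text \<open>
  Substitute \<open>m = d q\<close>.
\<close>

lemma sum_div_Sigma:
  fixes a :: "nat \<Rightarrow> complex"
  shows "(\<Sum>m\<in>{1..n}. (\<Sum>q | q dvd m. a q) / (of_nat m)\<^sup>2) =
    (\<Sum>d\<in>{1..n}. (\<Sum>q\<in>{1..n div d}. a q / (of_nat q)\<^sup>2) / (of_nat d)\<^sup>2)"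
proof -
  have fin: "finite {q. q dvd m}" if "m \<in> {1..n}" for m :: nat using that by simp
  have "(\<Sum>m\<in>{1..n}. (\<Sum>q | q dvd m. a q) / (of_nat m)\<^sup>2) = (\<Sum>m\<in>{1..n}. \<Sum>q | q dvd m. a q / (of_nat m)\<^sup>2)"
    by (simp add: sum_divide_distrib)
  also have "\<dots> = (\<Sum>(m,q)\<in>(SIGMA m:{1..n}. {q. q dvd m}). a q / (of_nat m)\<^sup>2)"
    using fin by (subst sum.Sigma) auto
  also have "\<dots> = (\<Sum>(d,q)\<in>(SIGMA d:{1..n}. {1..n div d}). a q / (of_nat q)\<^sup>2 / (of_nat d)\<^sup>2)"
  proof (rule sum.reindex_bij_witness[of _ "\<lambda>(d,q). (d * q, q)" "\<lambda>(m,q). (m div q, q)"])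
    fix x assume "x \<in> (SIGMA m:{1..n}. {q. q dvd m})"
    then obtain d q where x: "x = (q * d, q)" "1 \<le> q * d" "q * d \<le> n" by auto
    then have d: "d \<ge> 1" "q \<ge> 1" by (auto simp: Suc_le_eq)
    have dn: "d \<le> n" using x d by (metis le_trans mult_le_mono1 mult_1)
    have qn: "q \<le> n div d" using x d by (simp add: less_eq_div_iff_mult_less_eq)
    show "(case x of (m, q) \<Rightarrow> (m div q, q)) \<in> (SIGMA d:{1..n}. {1..n div d})" using x d dn qn by simp
    show "(case case x of (m, q) \<Rightarrow> (m div q, q) of (d, q) \<Rightarrow> (d * q, q)) = x" using x d by simp
    show "(case case x of (m, q) \<Rightarrow> (m div q, q) of (d, q) \<Rightarrow> a q / (of_nat q)\<^sup>2 / (of_nat d)\<^sup>2) = (case x of (m, q) \<Rightarrow> a q / (of_nat m)\<^sup>2)"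
      using x d by (simp add: power_mult_distrib)
  next
    fix x assume "x \<in> (SIGMA d:{1..n}. {1..n div d})"
    then obtain d q where x: "x = (d, q)" "1 \<le> d" "d \<le> n" "1 \<le> q" "q \<le> n div d" by auto
    have "d * q \<le> n" using x by (simp add: less_eq_div_iff_mult_less_eq mult.commute)
    then show "(case x of (d, q) \<Rightarrow> (d * q, q)) \<in> (SIGMA m:{1..n}. {q. q dvd m})"
      "(case case x of (d, q) \<Rightarrow> (d * q, q) of (m, q) \<Rightarrow> (m div q, q)) = x" using x by (auto simp: Suc_le_eq)
  qed
  also have "\<dots> = (\<Sum>d\<in>{1..n}. \<Sum>q\<in>{1..n div d}. a q / (of_nat q)\<^sup>2 / (of_nat d)\<^sup>2)"
    by (subst sum.Sigma) auto
  finally show ?thesis by (simp add: sum_divide_distrib)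
qed

lemma riemann_1d:
  fixes I :: "real \<Rightarrow> complex"
  assumes A: "0 \<le> A" and lip: "\<And>l m. \<bar>l\<bar> \<le> 1 \<Longrightarrow> \<bar>m\<bar> \<le> 1 \<Longrightarrow> norm (I l - I m) \<le> A * \<bar>l - m\<bar>"
    and m: "m > 0"
  shows "norm ((\<Sum>p\<in>{- int m..<int m}. I (of_int p / of_nat m)) - of_nat m * integral {-1..1} I) \<le> 2 * A"
proof -
  have cont: "continuous_on {-1..1} I"
  proof (rule lipschitz_on_continuous_on[of A])
    show "A-lipschitz_on {-1..1} I"
      using A lip by (intro lipschitz_onI) (auto simp: dist_norm)
  qed
  define c where "c j = -1 + real j / real m" for j :: nat
  have cS: "c (Suc j) = c j + 1 / m" for j by (simp add: c_def add_divide_distrib)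
  have c1: "-1 \<le> c j" "c j \<le> c (Suc j)" for j by (auto simp: c_def divide_right_mono)
  have c2: "c j \<le> 1" if "j \<le> 2 * m" for j
    using that m by (simp add: c_def divide_le_eq)
  have step: "norm (integral {c j..c (Suc j)} I - (1/m) *\<^sub>R I (c j)) \<le> A / m\<^sup>2" if j: "j < 2 * m" for j
  proof -
    have sub: "{c j..c (Suc j)} \<subseteq> {-1..1}" using c1[of j] c2[of "Suc j"] j by auto
    have ii: "I integrable_on {c j..c (Suc j)}"
      by (rule integrable_continuous_interval) (rule continuous_on_subset[OF cont sub])
    have "integral {c j..c (Suc j)} I - (1/m) *\<^sub>R I (c j) = integral {c j..c (Suc j)} (\<lambda>l. I l - I (c j))"
      using ii c1[of j] by (subst integral_diff) (auto simp: cS)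
    also have "norm \<dots> \<le> (A / m) * (c (Suc j) - c j)"
    proof (rule integral_bound[OF c1(2)])
      show "continuous_on {c j..c (Suc j)} (\<lambda>l. I l - I (c j))"
        by (intro continuous_intros continuous_on_subset[OF cont sub])
      fix t assume t: "t \<in> {c j..c (Suc j)}"
      have "norm (I t - I (c j)) \<le> A * \<bar>t - c j\<bar>"
        using t sub c1[of j] c2[of j] j by (intro lip) auto
      also have "\<dots> \<le> A * (1 / m)" using t A by (intro mult_left_mono) (auto simp: cS)
      finally show "norm (I t - I (c j)) \<le> A / m" by simp
    qed
    finally show ?thesis by (simp add: cS power2_eq_square)
  qed
  have tel: "integral {-1..c n} I = (\<Sum>j<n. integral {c j..c (Suc j)} I)" if "n \<le> 2 * m" for n
    using that
  proof (induction n)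
    case 0 then show ?case by (simp add: c_def)
  next
    case (Suc n)
    have "integral {-1..c n} I + integral {c n..c (Suc n)} I = integral {-1..c (Suc n)} I"
      using c1[of n] c2[OF Suc.prems]
      by (intro Henstock_Kurzweil_Integration.integral_combine integrable_continuous_interval continuous_on_subset[OF cont]) auto
    then show ?case using Suc by simp
  qed
  have c2m: "c (2 * m) = 1" using m by (simp add: c_def)
  have b: "(\<Sum>p\<in>{- int m..<int m}. I (of_int p / of_nat m)) = (\<Sum>j<2*m. I (c j))"
    by (rule sum.reindex_bij_witness[of _ "\<lambda>j. int j - int m" "\<lambda>p. nat (p + int m)"])
      (use m in \<open>auto simp: c_def field_simps\<close>)
  have "(\<Sum>j<2*m. I (c j)) - of_nat m * integral {-1..1} I = (\<Sum>j<2*m. of_nat m * ((1/m) *\<^sub>R I (c j) - integral {c j..c (Suc j)} I))"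
    using tel[of "2*m"] m unfolding c2m
    by (simp add: sum_subtractf sum_distrib_left right_diff_distrib scaleR_conv_of_real)
  also have "norm \<dots> \<le> (\<Sum>j<2*m. A / m)"
  proof (rule sum_norm_le)
    fix j assume "j \<in> {..<2*m}"
    then have "norm (of_nat m * ((1/m) *\<^sub>R I (c j) - integral {c j..c (Suc j)} I)) \<le> m * (A / m\<^sup>2)"
      unfolding norm_mult norm_of_nat norm_minus_commute[of "(1/m) *\<^sub>R I (c j)"]
      using step[of j] by (intro mult_left_mono) auto
    then show "norm (of_nat m * ((1/m) *\<^sub>R I (c j) - integral {c j..c (Suc j)} I)) \<le> A / m"
      using m by (simp add: power2_eq_square)
  qed
  also have "\<dots> = 2 * A" using m by simp
  finally show ?thesis unfolding b .
qed

text \<open>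
  The left-hand side is \<open>log d + O(1)\<close>; the bound only has to grow slowly enough to be summable
  against \<open>d\<^sup>-\<^sup>2\<close>.
\<close>

lemma harm_diff_le:
  assumes "1 \<le> d" "d \<le> n"
  shows "harm n - harm (n div d) \<le> (3 * sqrt d :: real)"
proof -
  define k where "k = n div d"
  have k: "1 \<le> k" "k \<le> n" using assms by (auto simp: k_def less_eq_div_iff_mult_less_eq)
  have "n < d * (k + 1)" using assms unfolding k_def by (metis Suc_eq_plus1 dividend_less_times_div gr0I le_zero_eq mult_Suc_right not_one_le_zero add.commute)
  also have "\<dots> \<le> d * (2 * k)" using k by (intro mult_left_mono) auto
  finally have nk: "real n \<le> 2 * real d * real k"
    by (metis less_imp_le mult.assoc mult.left_commute of_nat_le_iff of_nat_mult of_nat_numeral)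
  have "harm n - harm k \<le> ln (real n) - ln (real k)"
    using euler_mascheroni_sequence_decreasing[of k n] k by simp
  also have "\<dots> = ln (real n / real k)" using k assms by (simp add: ln_div)
  also have "\<dots> \<le> ln (2 * real d)" using nk k assms by (subst ln_le_cancel_iff) (auto simp: divide_le_eq)
  also have "\<dots> = 2 * ln (sqrt (2 * real d))" using assms by (simp add: ln_sqrt)
  also have "\<dots> \<le> 2 * (sqrt (2 * real d) - 1)" using assms by (intro mult_left_mono ln_le_minus_one) auto
  also have "\<dots> \<le> 2 * (3/2 * sqrt d)"
  proof -
    have "sqrt 2 \<le> 3/2" by (rule real_le_lsqrt) (auto simp: power2_eq_square)
    then have "sqrt 2 * sqrt d \<le> 3/2 * sqrt d" by (intro mult_right_mono) auto
    then show ?thesis by (simp add: real_sqrt_mult)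
  qed
  finally show ?thesis by (simp add: k_def)
qed

lemma zeta2_partial_sum:
  assumes "n \<ge> 1"
  shows "(\<Sum>d\<in>{1..n}. 1 / (real d)\<^sup>2) \<le> pi\<^sup>2 / 6" "pi\<^sup>2 / 6 \<le> (\<Sum>d\<in>{1..n}. 1 / (real d)\<^sup>2) + 1 / n"
proof -
  let ?S = "\<lambda>k. \<Sum>d\<in>{1..k}. 1 / (real d)\<^sup>2"
  have S: "?S \<longlonglongrightarrow> pi\<^sup>2 / 6"
  proof -
    have "(\<lambda>k. \<Sum>d<k. 1 / (real d + 1)\<^sup>2) \<longlonglongrightarrow> pi\<^sup>2 / 6"
      using inverse_squares_sums by (simp add: sums_def add.commute)
    moreover have "(\<Sum>d<k. 1 / (real d + 1)\<^sup>2) = ?S k" for k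
      by (induction k) (auto simp: add.commute)
    ultimately show ?thesis by simp
  qed
  have 1: "?S k \<le> ?S n + 1/n - 1/k \<and> ?S n \<le> ?S k" if "n \<le> k" for k
    using that
  proof (induction k rule: dec_induct)
    case base show ?case by simp
  next
    case (step k)
    have k: "k \<ge> 1" using step assms by simp
    have "1 / (real (Suc k))\<^sup>2 \<le> 1 / (real k * real (Suc k))"
      using k by (intro divide_left_mono) (auto simp: power2_eq_square)
    also have "\<dots> = 1 / real k - 1 / real (Suc k)" using k by (simp add: field_simps)
    finally have le: "1 / (real (Suc k))\<^sup>2 \<le> 1 / real k - 1 / real (Suc k)" .
    have eqs: "?S (Suc k) = ?S k + 1 / (real (Suc k))\<^sup>2" by simp
    have nn: "0 \<le> 1 / (real (Suc k))\<^sup>2" by simp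
    show ?case unfolding eqs using step.IH le nn by linarith
  qed
  show "?S n \<le> pi\<^sup>2/6"
    by (rule LIMSEQ_le_const[OF S]) (use 1 in blast)
  show "pi\<^sup>2/6 \<le> ?S n + 1/n"
  proof (rule LIMSEQ_le_const2[OF S], intro exI allI impI)
    fix k assume "n \<le> k"
    moreover have "0 \<le> 1 / real k" by simp
    ultimately show "?S k \<le> ?S n + 1/n" using 1[of k] by linarith
  qed
qed

definition C_farey :: real where
  "C_farey = 8 + 6 * (2 powr (3/2) / (3/2 - 1))"

text \<open>
  Let \<open>S k\<close> be the sum over reduced fractions with denominators up to \<open>k\<close>, and \<open>b m\<close> the sum over all
  fractions with denominator \<open>m\<close>. By \<open>sum_fractions_reduced\<close> and \<open>sum_div_Sigma\<close>,
  \<open>\<Sum>\<^sub>m b(m) / m\<^sup>2 = \<Sum>\<^sub>d S(n div d) / d\<^sup>2\<close>. Replacing \<open>S(n div d)\<close> by \<open>S n\<close>, the partial sum of \<open>\<zeta>(2)\<close> by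
  \<open>\<zeta>(2)\<close>, \<open>b m\<close> by \<open>m\<close> times the integral, and the harmonic number by the logarithm costs a bounded
  amount each time.
\<close>

lemma farey_average:
  fixes I :: "real \<Rightarrow> complex"
  assumes A: "0 \<le> A" and bd: "\<And>l. \<bar>l\<bar> \<le> 1 \<Longrightarrow> norm (I l) \<le> A"
    and lip: "\<And>l m. \<bar>l\<bar> \<le> 1 \<Longrightarrow> \<bar>m\<bar> \<le> 1 \<Longrightarrow> norm (I l - I m) \<le> A * \<bar>l - m\<bar>"
    and n: "n \<ge> 1"
  defines "a \<equiv> \<lambda>q::nat. \<Sum>p\<in>reduced q. I (of_int p / of_nat q)"
  shows "norm (of_real (pi\<^sup>2 / 6) * (\<Sum>q\<in>{1..n}. a q / (of_nat q)\<^sup>2) - of_real (ln n) * integral {-1..1} I) \<le> C_farey * A"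
proof -
  define J where "J = integral {-1..1} I"
  define S where "S k = (\<Sum>q\<in>{1..k}. a q / (of_nat q)\<^sup>2)" for k
  define b where "b m = (\<Sum>p\<in>{- int m..<int m}. I (of_int p / of_nat m))" for m
  define z where "z = (\<Sum>d\<in>{1..n}. 1 / (real d)\<^sup>2)"
  have z2: "z \<le> 2"
    using zeta2_partial_sum(1)[OF n] zeta2_partial_sum(2)[of 1] by (simp add: z_def)
  have J: "norm J \<le> 2 * A"
  proof -
    have "continuous_on {-1..1} I"
    proof (rule lipschitz_on_continuous_on[of A])
      show "A-lipschitz_on {-1..1} I" using A lip by (intro lipschitz_onI) (auto simp: dist_norm)
    qed
    then have "norm J \<le> A * (1 - (-1))" unfolding J_def
      by (intro integral_bound) (auto intro!: bd)
    then show ?thesis by simp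
  qed
  have aq: "norm (a q / (of_nat q)\<^sup>2) \<le> 2 * A * inverse (real q)" if "q \<ge> 1" for q
  proof -
    have "norm (a q) \<le> (\<Sum>p\<in>reduced q. A)"
      unfolding a_def by (rule sum_norm_le) (rule bd, rule reduced_abs)
    also have "\<dots> = real (card (reduced q)) * A" by simp
    also have "\<dots> \<le> (2 * real q) * A"
    proof (rule mult_right_mono[OF _ A])
      show "real (card (reduced q)) \<le> 2 * real q" using card_reduced[of q] by linarith
    qed
    finally have "norm (a q) / (real q)\<^sup>2 \<le> (2 * real q) * A / (real q)\<^sup>2" by (rule divide_right_mono) simp
    also have "(2 * real q) * A / (real q)\<^sup>2 = 2 * A * inverse (real q)"
      using that by (simp add: power2_eq_square field_simps)
    finally show ?thesis by (simp add: norm_divide norm_power)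
  qed
  have diff: "norm (S m - S k) \<le> 2 * A * (harm m - harm k)" if "k \<le> m" for k m
    using that
  proof (induction m rule: dec_induct)
    case base show ?case by simp
  next
    case (step m)
    have "S (Suc m) - S k = (S m - S k) + a (Suc m) / (of_nat (Suc m))\<^sup>2" by (simp add: S_def)
    then have "norm (S (Suc m) - S k) \<le> norm (S m - S k) + norm (a (Suc m) / (of_nat (Suc m))\<^sup>2)"
      by (metis norm_triangle_ineq)
    also have "\<dots> \<le> 2 * A * (harm m - harm k) + 2 * A * inverse (real (Suc m))"
      by (intro add_mono step.IH aq) simp
    also have "\<dots> = 2 * A * (harm (Suc m) - harm k)" by (simp add: harm_Suc algebra_simps)
    finally show ?case .
  qed
  have hn: "harm n \<le> real n" using n
  proof -
    have "harm n \<le> (\<Sum>k\<in>{1..n}. 1 :: real)" unfolding harm_def by (intro sum_mono) (auto simp: inverse_le_1_iff)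
    then show ?thesis by simp
  qed
  have Sn: "norm (S n) \<le> 2 * A * n"
    using diff[of 0 n] hn A mult_left_mono[OF hn, of "2 * A"] by (simp add: S_def harm_def)
  \<comment> \<open>Against the tail \<open>1/n\<close> of the series for \<open>\<zeta>(2)\<close> the crude bound \<open>2 * A * n\<close> for \<open>S n\<close> is enough.\<close>
  have e1: "norm (of_real (pi\<^sup>2/6 - z) * S n) \<le> 2 * A"
  proof -
    have "norm (of_real (pi\<^sup>2/6 - z) * S n) \<le> (1/n) * (2 * A * n)"
      unfolding norm_mult norm_of_real z_def using zeta2_partial_sum[OF n] Sn n by (intro mult_mono) auto
    then show ?thesis using n by simp
  qed
  have e2: "norm (\<Sum>d\<in>{1..n}. (S n - S (n div d)) / (of_nat d)\<^sup>2) \<le> 6 * (2 powr (3/2) / (3/2 - 1)) * A"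
  proof -
    have "norm (\<Sum>d\<in>{1..n}. (S n - S (n div d)) / (of_nat d)\<^sup>2) \<le> (\<Sum>d\<in>{1..n}. 6 * A * cap (3/2) 1 d)"
    proof (rule sum_norm_le)
      fix d assume d: "d \<in> {1..n}"
      have "norm (S n - S (n div d)) \<le> 2 * A * (harm n - harm (n div d))" by (rule diff) simp
      also have "\<dots> \<le> 2 * A * (3 * sqrt d)" using A d harm_diff_le[of d n] by (intro mult_left_mono) auto
      finally have "norm ((S n - S (n div d)) / (of_nat d)\<^sup>2) \<le> 6 * A * (sqrt d / (real d)\<^sup>2)"
        using d by (simp add: norm_divide norm_power divide_right_mono)
      also have "sqrt d / (real d)\<^sup>2 = (1 / real d) powr (3/2)"
        using d by (simp add: powr_divide powr_half_sqrt[symmetric] powr_diff[symmetric] flip: powr_numeral powr_minus_divide)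
      also have "\<dots> = cap (3/2) 1 d" using d powr_mono2[of "3/2" "1/real d" 1] by (simp add: cap_def min_def)
      finally show "norm ((S n - S (n div d)) / (of_nat d)\<^sup>2) \<le> 6 * A * cap (3/2) 1 d" .
    qed
    also have "\<dots> = 6 * A * (\<Sum>d\<in>{1..n}. cap (3/2) 1 d)" by (simp add: sum_distrib_left)
    also have "\<dots> \<le> 6 * A * (2 powr (3/2) / (3/2 - 1) * 1)" using A by (intro mult_left_mono cap_sum) auto
    finally show ?thesis by (simp add: mult_ac)
  qed
  have e3: "norm ((\<Sum>m\<in>{1..n}. b m / (of_nat m)\<^sup>2) - of_real (harm n) * J) \<le> 4 * A"
  proof -
    have "of_real (harm n) * J = (\<Sum>m\<in>{1..n}. of_nat m * J / (of_nat m)\<^sup>2)"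
      unfolding harm_def of_real_sum sum_distrib_right
    proof (rule sum.cong[OF refl])
      fix m assume "m \<in> {1..n}"
      then have "(of_nat m :: complex) \<noteq> 0" by simp
      then show "complex_of_real (inverse (of_nat m)) * J = of_nat m * J / (of_nat m)\<^sup>2"
        by (simp add: power2_eq_square divide_simps)
    qed
    then have "(\<Sum>m\<in>{1..n}. b m / (of_nat m)\<^sup>2) - of_real (harm n) * J = (\<Sum>m\<in>{1..n}. (b m - of_nat m * J) / (of_nat m)\<^sup>2)"
      by (simp only: diff_divide_distrib sum_subtractf)
    also have "norm \<dots> \<le> (\<Sum>m\<in>{1..n}. 2 * A * (1 / (real m)\<^sup>2))"
    proof (rule sum_norm_le)
      fix m assume "m \<in> {1..n}"
      then show "norm ((b m - of_nat m * J) / (of_nat m)\<^sup>2) \<le> 2 * A * (1 / (real m)\<^sup>2)"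
        using riemann_1d[OF A lip, of m] by (simp add: b_def J_def norm_divide norm_power divide_right_mono)
    qed
    also have "\<dots> = 2 * A * z" by (simp add: z_def sum_distrib_left)
    also have "\<dots> \<le> 2 * A * 2" using A z2 by (intro mult_left_mono) auto
    finally show ?thesis by simp
  qed
  have e4: "norm (of_real (harm n - ln n) * J) \<le> 2 * A"
  proof -
    have "\<bar>harm n - ln n\<bar> \<le> 1"
      using euler_mascheroni_sequence_nonneg[of n] euler_mascheroni_sequence_decreasing[of 1 n] n by (simp add: harm_def)
    then have "norm (of_real (harm n - ln n) * J) \<le> 1 * (2 * A)"
      unfolding norm_mult norm_of_real using J A by (intro mult_mono) auto
    then show ?thesis by simp
  qed
  have "(\<Sum>m\<in>{1..n}. b m / (of_nat m)\<^sup>2) = (\<Sum>m\<in>{1..n}. (\<Sum>q | q dvd m. a q) / (of_nat m)\<^sup>2)"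
    using sum_fractions_reduced[of _ I] by (intro sum.cong) (auto simp: b_def a_def)
  also have "\<dots> = (\<Sum>d\<in>{1..n}. S (n div d) / (of_nat d)\<^sup>2)"
    unfolding S_def by (rule sum_div_Sigma)
  finally have eq: "(\<Sum>m\<in>{1..n}. b m / (of_nat m)\<^sup>2) = (\<Sum>d\<in>{1..n}. S (n div d) / (of_nat d)\<^sup>2)" .
  have "of_real z * S n = (\<Sum>d\<in>{1..n}. S n / (of_nat d)\<^sup>2)"
    by (simp add: z_def sum_distrib_right)
  then have eq2: "(\<Sum>d\<in>{1..n}. (S n - S (n div d)) / (of_nat d)\<^sup>2) = of_real z * S n - (\<Sum>m\<in>{1..n}. b m / (of_nat m)\<^sup>2)"
    unfolding eq by (simp add: diff_divide_distrib sum_subtractf)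
  have "of_real (pi\<^sup>2 / 6) * S n - of_real (ln n) * J = of_real (pi\<^sup>2/6 - z) * S n
      + (\<Sum>d\<in>{1..n}. (S n - S (n div d)) / (of_nat d)\<^sup>2)
      + ((\<Sum>m\<in>{1..n}. b m / (of_nat m)\<^sup>2) - of_real (harm n) * J) + of_real (harm n - ln n) * J"
    unfolding eq2 by (simp add: algebra_simps)
  also have "norm \<dots> \<le> 2 * A + 6 * (2 powr (3/2) / (3/2 - 1)) * A + 4 * A + 2 * A"
    by (intro norm_triangle_le add_mono e1 e2 e3 e4)
  also have "\<dots> = C_farey * A" by (simp add: C_farey_def distrib_right)
  finally show ?thesis by (simp add: S_def J_def)
qed

section \<open>Asymptotics of the sum over rectangles\<close>

definition C_cap :: "real \<Rightarrow> real" where "C_cap a = 2 powr a / (a - 1)"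

lemma C_cap_nonneg: "a > 1 \<Longrightarrow> 0 \<le> C_cap a" by (simp add: C_cap_def)

lemma abs_summable_bounded:
  fixes f :: "'a \<Rightarrow> 'b::banach"
  assumes "\<And>F. finite F \<Longrightarrow> F \<subseteq> S \<Longrightarrow> (\<Sum>x\<in>F. norm (f x)) \<le> C"
  shows "(\<lambda>x. norm (f x)) summable_on S" "f summable_on S" "norm (infsum f S) \<le> C"
proof -
  show 1: "(\<lambda>x. norm (f x)) summable_on S"
    using assms by (intro nonneg_bdd_above_summable_on bdd_aboveI2[of _ _ C]) auto
  then show "f summable_on S" by (rule abs_summable_summable)
  have "norm (infsum f S) \<le> infsum (\<lambda>x. norm (f x)) S" by (rule norm_infsum_bound[OF 1])
  also have "\<dots> \<le> C" using 1 assms by (rule infsum_le_finite_sums)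
  finally show "norm (infsum f S) \<le> C" .
qed

lemma norm_pt_ge_1: "M \<noteq> (0,0) \<Longrightarrow> 1 \<le> norm (pt M)"
proof -
  assume "M \<noteq> (0,0)"
  then have "fst M \<noteq> 0 \<or> snd M \<noteq> 0" by (cases M) auto
  then have "1 \<le> \<bar>pt M $ 1\<bar> \<or> 1 \<le> \<bar>pt M $ 2\<bar>" by auto
  then show ?thesis using component_le_norm_cart[of "pt M" 1] component_le_norm_cart[of "pt M" 2] by linarith
qed

text \<open>
  A nonzero point of a sparse lattice is as far from the origin as its index, up to scaling.
\<close>

lemma wt_scaled_pt:
  assumes "M \<noteq> (0,0)" "r > 0" "a \<ge> 0"
  shows "wt a (r *\<^sub>R pt M) \<le> 2 powr a * (1 / r) powr a * wt a (pt M)"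
proof -
  have n1: "1 \<le> norm (pt M)" using assms by (intro norm_pt_ge_1)
  have "(japanese (pt M))\<^sup>2 \<le> (2 * norm (pt M))\<^sup>2"
    using power_mono[OF n1, of 2] by (simp add: japanese_sq power_mult_distrib)
  then have "japanese (pt M) \<le> 2 * norm (pt M)" by (rule power2_le_imp_le) simp
  also have "\<dots> = 2 * (1/r) * norm (r *\<^sub>R pt M)" using assms by simp
  also have "\<dots> \<le> 2 * (1/r) * japanese (r *\<^sub>R pt M)" using assms by (intro mult_left_mono norm_le_japanese) auto
  finally have "wt a (r *\<^sub>R pt M) \<le> (2 * (1/r)) powr a * wt a (pt M)"
    using assms by (intro wt_antimono) auto
  then show ?thesis using assms by (simp add: powr_mult powr_divide)
qed

lemma wt_pt_sum:
  assumes a: "a > 2" and F: "finite F"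
  shows "(\<Sum>M\<in>F. wt a (pt M)) \<le> 4 * C_lat a"
  using wt_sum_2d[OF a zero_less_one F, of 0] by simp

text \<open>
  The second entry of the minimum is what \<open>\<langle>r M\<rangle> \<lesssim> \<langle>K\<rangle>\<langle>K + r M\<rangle>\<close> gives; it is the better one for \<open>r > 3\<langle>K\<rangle>\<close>,
  when only \<open>M = 0\<close> could come close to \<open>- K\<close>.
\<close>

lemma shifted_sum_cap:
  assumes a: "a > 2" and F: "finite F" "(0,0) \<notin> F" and r: "r \<ge> 1"
  shows "(\<Sum>M\<in>F. wt a (K + r *\<^sub>R pt M)) \<le> 4 * C_lat a * min 1 ((3 * japanese K / r) powr a)"
proof -
  have 1: "(\<Sum>M\<in>F. wt a (K + r *\<^sub>R pt M)) \<le> 4 * C_lat a"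
  proof -
    have "(1 + 1 / r)\<^sup>2 \<le> 2\<^sup>2" using r by (intro power_mono) auto
    then have "C_lat a * (1 + 1 / r)\<^sup>2 \<le> C_lat a * 4" using C_lat_nonneg by (intro mult_left_mono) auto
    then show ?thesis using wt_sum_2d[OF a _ F(1), of r K] r by simp
  qed
  have tm: "wt a (K + r *\<^sub>R pt M) \<le> (3 * japanese K / r) powr a * wt a (pt M)" if "M \<in> F" for M
  proof -
    have M: "M \<noteq> (0,0)" using that F by metis
    have "japanese (r *\<^sub>R pt M) \<le> (sqrt 2 * japanese K) * japanese (K + r *\<^sub>R pt M)"
      using japanese_add_le[of "-K" "K + r *\<^sub>R pt M"] by (simp add: japanese_uminus)
    then have "wt a (K + r *\<^sub>R pt M) \<le> (sqrt 2 * japanese K) powr a * wt a (r *\<^sub>R pt M)"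
      using a japanese_pos[of K] by (intro wt_antimono) auto
    also have "\<dots> \<le> (sqrt 2 * japanese K) powr a * (2 powr a * (1 / r) powr a * wt a (pt M))"
      using M r a by (intro mult_left_mono wt_scaled_pt) auto
    also have "\<dots> = (sqrt 2 * japanese K * 2 * (1 / r)) powr a * wt a (pt M)"
      using japanese_pos[of K] r by (simp add: powr_mult powr_divide mult_ac)
    also have "\<dots> \<le> (3 * japanese K / r) powr a * wt a (pt M)"
    proof (intro mult_right_mono powr_mono2)
      have "sqrt 2 \<le> 3/2" by (rule real_le_lsqrt) (auto simp: power2_eq_square)
      then have "(sqrt 2 * 2) * (japanese K * (1/r)) \<le> 3 * (japanese K * (1/r))"
        using japanese_pos[of K] r by (intro mult_right_mono) auto
      then show "sqrt 2 * japanese K * 2 * (1 / r) \<le> 3 * japanese K / r" by (simp add: mult_ac)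
    qed (use a r japanese_pos[of K] wt_pos[of a "pt M"] in auto)
    finally show ?thesis .
  qed
  have "(\<Sum>M\<in>F. wt a (K + r *\<^sub>R pt M)) \<le> (\<Sum>M\<in>F. (3 * japanese K / r) powr a * wt a (pt M))"
    by (rule sum_mono) (rule tm)
  also have "\<dots> = (3 * japanese K / r) powr a * (\<Sum>M\<in>F. wt a (pt M))" by (simp add: sum_distrib_left)
  also have "\<dots> \<le> (3 * japanese K / r) powr a * (4 * C_lat a)"
    using wt_pt_sum[OF a F(1)] by (intro mult_left_mono) auto
  finally have 2: "(\<Sum>M\<in>F. wt a (K + r *\<^sub>R pt M)) \<le> 4 * C_lat a * (3 * japanese K / r) powr a" by (simp add: mult_ac)
  from 1 2 show ?thesis by (simp add: min_def)
qed

text \<open>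
  For \<open>q \<ge> 2\<close> the numerator \<open>0\<close> does not occur, and \<open>cap_sum\<close> applies to both signs.
\<close>

lemma reduced_cap_sum:
  assumes t: "t > 1" and L: "L > 0" and q: "q \<ge> 2"
  shows "(\<Sum>p\<in>reduced q. cap t L (nat \<bar>p\<bar>)) \<le> 2 * C_cap t * L"
proof -
  have "nat \<bar>p\<bar> \<in> {1..q}" if "p \<in> reduced q" for p
  proof -
    have "p \<noteq> 0" using that q by (auto simp: reduced_def)
    then show ?thesis using that by (auto simp: reduced_def)
  qed
  then have "(\<Sum>p\<in>reduced q. cap t L (nat \<bar>p\<bar>)) \<le> 2 * (\<Sum>n\<in>{1..q}. cap t L n)"
    by (intro sum_abs_le cap_nonneg) auto
  also have "\<dots> \<le> 2 * (2 powr t / (t - 1) * L)" using t L by (intro mult_left_mono cap_sum) auto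
  finally show ?thesis by (simp add: C_cap_def)
qed

definition C_tail :: "real \<Rightarrow> real" where
  "C_tail \<sigma> = 8 * 2 powr (\<sigma>+1) * C_lat (\<sigma>+1) * C_cap \<sigma> + 24 * C_cap (\<sigma>/2) * C_lat (1 + \<sigma>/2) * C_cap (1 + \<sigma>/2)"

text \<open>
  The first term of the pointwise bound contributes \<open>2q (L/q)\<^sup>\<sigma>\<^sup>+\<^sup>1\<close> per denominator, summable over \<open>q > L\<close>. In
  the second one the numerators give a factor \<open>L\<close>, the vectors \<open>M\<close> a bounded factor which is small once
  \<open>q > 3\<langle>K\<rangle>L\<close>, so that effectively \<open>\<langle>K\<rangle>L\<close> denominators count; their number is compensated by the factor
  \<open>1/\<langle>K\<rangle>\<close>. As \<open>L > 1\<close>, all denominators in question are at least \<open>2\<close>, hence all numerators are nonzero.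
\<close>

lemma rectangle_sum_tail:
  fixes P :: "real^2 \<Rightarrow> real \<Rightarrow> complex"
  assumes \<sigma>: "\<sigma> > 2" and A: "0 \<le> A" and L: "L > 1"
    and tl: "\<And>x l. norm (P x l) \<le> A * (wt (\<sigma>+1) x + wt (1 + \<sigma>/2) (K + x) * wt (\<sigma>/2) (l *\<^sub>R perp x) / japanese K)"
    and F: "finite F" "F \<subseteq> (SIGMA qp:(SIGMA q:{q. real q > L}. reduced q). - {(0,0)})"
  shows "(\<Sum>((q,p),M)\<in>F. norm (P ((real q / L) *\<^sub>R pt M) (of_int p / real q))) \<le> C_tail \<sigma> * A * L\<^sup>2"
proof -
  define s a t where "s = \<sigma> + 1" and "a = 1 + \<sigma>/2" and "t = \<sigma>/2"
  have ex: "s > 2" "a > 2" "t > 1" "s \<ge> 0" "a > 1" using \<sigma> by (auto simp: s_def a_def t_def)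
  define Q where "Q = fst ` fst ` F"
  define Ms where "Ms = snd ` F"
  have fin: "finite Q" "finite Ms" using F by (auto simp: Q_def Ms_def)
  have Q: "real q > L" "q \<ge> 2" if "q \<in> Q" for q
  proof -
    show "real q > L" using that F by (auto simp: Q_def)
    then show "q \<ge> 2" using L by linarith
  qed
  have Ms: "(0,0) \<notin> Ms" using F by (auto simp: Ms_def)
  have sub: "F \<subseteq> (SIGMA qp:(SIGMA q:Q. reduced q). Ms)"
    using F(2) by (force simp: Q_def Ms_def)
  define g where "g = (\<lambda>q p M. A * (((L / real q) * cap \<sigma> L q * 2 powr s) * wt s (pt M) +
      (cap t L (nat \<bar>p\<bar>) / japanese K) * wt a (K + (real q / L) *\<^sub>R pt M)))"
  have g0: "0 \<le> g q p M" for q p M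
    unfolding g_def using A L japanese_pos[of K] wt_pos[of s "pt M"] wt_pos[of a "K + (real q / L) *\<^sub>R pt M"]
    by (intro mult_nonneg_nonneg add_nonneg_nonneg divide_nonneg_nonneg cap_nonneg) auto
  have bd: "norm (P ((real q / L) *\<^sub>R pt M) (of_int p / real q)) \<le> g q p M"
    if q: "q \<in> Q" and p: "p \<in> reduced q" and M: "M \<in> Ms" for q p M
  proof -
    have M0: "M \<noteq> (0,0)" using M Ms by metis
    have qL: "real q > L" "q \<ge> 2" using Q[OF q] by auto
    have p0: "p \<noteq> 0" using p qL by (auto simp: reduced_def)
    have r: "real q / L > 0" using qL L by simp
    have w1: "wt s ((real q / L) *\<^sub>R pt M) \<le> ((L / real q) * cap \<sigma> L q * 2 powr s) * wt s (pt M)"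
    proof -
      have "(L / real q) powr \<sigma> \<le> 1 powr \<sigma>" using qL L \<sigma> by (intro powr_mono2) auto
      then have c: "cap \<sigma> L q = (L / real q) powr \<sigma>" by (simp add: cap_def)
      have "(1 / (real q / L)) powr s = (L / real q) * cap \<sigma> L q"
        using qL L by (simp add: s_def powr_add c)
      then show ?thesis using wt_scaled_pt[OF M0 r ex(4)] by (simp add: mult_ac)
    qed
    have y: "(of_int p / real q) *\<^sub>R perp ((real q / L) *\<^sub>R pt M) = (of_int p / L) *\<^sub>R perp (pt M)"
      using qL by (simp add: linear_cmul[OF linear_perp])
    have w2: "wt t ((of_int p / real q) *\<^sub>R perp ((real q / L) *\<^sub>R pt M)) \<le> cap t L (nat \<bar>p\<bar>)"
      unfolding cap_def
    proof (intro min.boundedI)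
      have "real_of_int \<bar>p\<bar> / L * 1 \<le> real_of_int \<bar>p\<bar> / L * norm (pt M)"
        using norm_pt_ge_1[OF M0] L by (intro mult_left_mono) auto
      then have "wt t ((of_int p / real q) *\<^sub>R perp ((real q / L) *\<^sub>R pt M)) \<le> (real_of_int \<bar>p\<bar> / L) powr (- t)"
        unfolding y using p0 L ex by (intro wt_le_norm) auto
      also have "\<dots> = (L / real (nat \<bar>p\<bar>)) powr t" using p0 L by (simp add: powr_minus powr_divide)
      finally show "wt t ((of_int p / real q) *\<^sub>R perp ((real q / L) *\<^sub>R pt M)) \<le> (L / real (nat \<bar>p\<bar>)) powr t" .
    qed (use ex in \<open>intro wt_le_1, simp\<close>)
    have "wt a (K + (real q / L) *\<^sub>R pt M) * wt t ((of_int p / real q) *\<^sub>R perp ((real q / L) *\<^sub>R pt M)) / japanese K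
       \<le> wt a (K + (real q / L) *\<^sub>R pt M) * cap t L (nat \<bar>p\<bar>) / japanese K"
      using w2 japanese_pos[of K] by (intro divide_right_mono mult_left_mono) (auto simp: wt_pos less_imp_le)
    then show ?thesis unfolding g_def
      using tl[of "(real q / L) *\<^sub>R pt M" "of_int p / real q"] w1 A
      by (intro order_trans[OF tl] mult_left_mono add_mono) (auto simp: s_def a_def t_def mult_ac)
  qed
  have "(\<Sum>((q,p),M)\<in>F. norm (P ((real q / L) *\<^sub>R pt M) (of_int p / real q))) \<le> (\<Sum>((q,p),M)\<in>F. g q p M)"
    by (rule sum_mono) (use bd sub in auto)
  also have "\<dots> \<le> (\<Sum>((q,p),M)\<in>(SIGMA qp:(SIGMA q:Q. reduced q). Ms). g q p M)"
    by (rule sum_mono2) (use sub fin g0 in auto)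
  also have "\<dots> = (\<Sum>(q,p)\<in>(SIGMA q:Q. reduced q). \<Sum>M\<in>Ms. g q p M)"
    by (simp add: case_prod_unfold sum.cartesian_product)
  also have "\<dots> = (\<Sum>q\<in>Q. \<Sum>p\<in>reduced q. \<Sum>M\<in>Ms. g q p M)"
    using fin by (subst sum.Sigma) auto
  also have "\<dots> \<le> (\<Sum>q\<in>Q. A * (8 * L * 2 powr s * C_lat s * cap \<sigma> L q + 8 * C_cap t * C_lat a * L / japanese K * cap a (3 * japanese K * L) q))"
  proof (rule sum_mono)
    fix q assume q: "q \<in> Q"
    have r1: "real q / L \<ge> 1" using Q[OF q] L by simp
    let ?X = "(L / real q) * cap \<sigma> L q * 2 powr s * (4 * C_lat s)"
    let ?Y = "4 * C_lat a * cap a (3 * japanese K * L) q / japanese K"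
    have X0: "0 \<le> ?X" "0 \<le> ?Y" using L C_lat_nonneg cap_nonneg japanese_pos[of K] by auto
    have "(\<Sum>M\<in>Ms. g q p M) \<le> A * (?X + cap t L (nat \<bar>p\<bar>) * ?Y)" for p
    proof -
      have c: "min 1 ((3 * japanese K / (real q / L)) powr a) = cap a (3 * japanese K * L) q" by (simp add: cap_def)
      have "(\<Sum>M\<in>Ms. g q p M) = A * (((L / real q) * cap \<sigma> L q * 2 powr s) * (\<Sum>M\<in>Ms. wt s (pt M)) +
        (cap t L (nat \<bar>p\<bar>) / japanese K) * (\<Sum>M\<in>Ms. wt a (K + (real q / L) *\<^sub>R pt M)))"
        by (simp only: g_def sum_distrib_left[symmetric] sum.distrib)
      also have "\<dots> \<le> A * (((L / real q) * cap \<sigma> L q * 2 powr s) * (4 * C_lat s) +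
        (cap t L (nat \<bar>p\<bar>) / japanese K) * (4 * C_lat a * cap a (3 * japanese K * L) q))"
        using A L fin ex Ms r1 japanese_pos[of K] unfolding c[symmetric]
        by (intro mult_left_mono add_mono wt_pt_sum shifted_sum_cap) (auto simp: cap_nonneg)
      finally show ?thesis by (simp add: mult_ac)
    qed
    then have "(\<Sum>p\<in>reduced q. \<Sum>M\<in>Ms. g q p M) \<le> (\<Sum>p\<in>reduced q. A * (?X + cap t L (nat \<bar>p\<bar>) * ?Y))"
      by (rule sum_mono)
    also have "\<dots> = A * (real (card (reduced q)) * ?X + (\<Sum>p\<in>reduced q. cap t L (nat \<bar>p\<bar>)) * ?Y)"
      by (simp only: sum_distrib_left[symmetric] sum.distrib sum_constant sum_distrib_right[symmetric]) simp
    also have "\<dots> \<le> A * ((2 * real q) * ?X + (2 * C_cap t * L) * ?Y)"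
    proof -
      have 1: "real (card (reduced q)) \<le> 2 * real q" using card_reduced[of q] by linarith
      have 2: "(\<Sum>p\<in>reduced q. cap t L (nat \<bar>p\<bar>)) \<le> 2 * C_cap t * L"
        using Q[OF q] L ex by (intro reduced_cap_sum) auto
      show ?thesis by (rule mult_left_mono[OF add_mono[OF mult_right_mono[OF 1 X0(1)] mult_right_mono[OF 2 X0(2)]] A])
    qed
    also have "\<dots> = A * (8 * L * 2 powr s * C_lat s * cap \<sigma> L q + 8 * C_cap t * C_lat a * L / japanese K * cap a (3 * japanese K * L) q)"
      using Q[OF q] by (simp add: mult_ac)
    finally show "(\<Sum>p\<in>reduced q. \<Sum>M\<in>Ms. g q p M) \<le> \<dots>" .
  qed
  also have "\<dots> = A * (8 * L * 2 powr s * C_lat s * (\<Sum>q\<in>Q. cap \<sigma> L q) + 8 * C_cap t * C_lat a * L / japanese K * (\<Sum>q\<in>Q. cap a (3 * japanese K * L) q))"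
    by (simp only: sum.distrib sum_distrib_left[symmetric])
  also have "\<dots> \<le> A * (8 * L * 2 powr s * C_lat s * (C_cap \<sigma> * L) + 8 * C_cap t * C_lat a * L / japanese K * (C_cap a * (3 * japanese K * L)))"
  proof (intro mult_left_mono add_mono A)
    have Q0: "0 \<notin> Q" using Q(2) by fastforce
    show "(\<Sum>q\<in>Q. cap \<sigma> L q) \<le> C_cap \<sigma> * L" unfolding C_cap_def using \<sigma> L fin Q0 by (intro cap_sum) auto
    show "(\<Sum>q\<in>Q. cap a (3 * japanese K * L) q) \<le> C_cap a * (3 * japanese K * L)"
      unfolding C_cap_def using ex L fin Q0 japanese_pos[of K] by (intro cap_sum) auto
  qed (use L C_lat_nonneg C_cap_nonneg ex japanese_pos[of K] in auto)
  also have "\<dots> = C_tail \<sigma> * A * L\<^sup>2"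
    using japanese_pos[of K] by (simp add: C_tail_def s_def a_def t_def power2_eq_square field_simps)
  finally show ?thesis .
qed

text \<open>
  \<open>((q,p),M)\<close> stands for the rectangle at \<open>K\<close> with sides \<open>q M / L\<close> and \<open>p M\<^sup>\<bottom> / L\<close>.
\<close>

definition rect_index :: "((nat \<times> int) \<times> (int \<times> int)) set" where
  "rect_index = (SIGMA qp:(SIGMA q:{1..}. reduced q). - {(0,0)})"

definition C_core :: "real \<Rightarrow> real" where
  "C_core \<sigma> = 2 * (2 * C_riemann \<sigma> + 4 + C_tail \<sigma>) + C_farey * (2 * C_plane \<sigma>) + 4 * C_plane \<sigma>"

text \<open>
  Split at \<open>q = L\<close>. For \<open>q \<le> L\<close> the sums over \<open>M \<noteq> 0\<close> are Riemann sums up to the missing term \<open>M = 0\<close>; the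
  tail is \<open>rectangle_sum_tail\<close>; the weighted sum of the integrals is \<open>farey_average\<close>. The logarithms of \<open>L\<close>
  and of its integer part \<open>n\<close> differ by at most \<open>log 2\<close>.
\<close>

lemma rectangle_sum_asymptotics:
  fixes P :: "real^2 \<Rightarrow> real \<Rightarrow> complex"
  assumes \<sigma>: "\<sigma> > 2" and A: "0 \<le> A" and L: "L > 1"
    and cont: "\<And>l. continuous_on UNIV (\<lambda>x. P x l)"
    and bd: "\<And>x l. norm (P x l) \<le> A * Phi \<sigma> K x"
    and lipx: "\<And>x y l. \<bar>l\<bar> \<le> 1 \<Longrightarrow> norm (P x l - P y l) \<le> A * norm (x - y) * (Phi \<sigma> K x + Phi \<sigma> K y)"
    and lipl: "\<And>x l m. norm (P x l - P x m) \<le> A * \<bar>l - m\<bar> * Phi \<sigma> K x"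
    and tl: "\<And>x l. norm (P x l) \<le> A * (wt (\<sigma>+1) x + wt (1 + \<sigma>/2) (K + x) * wt (\<sigma>/2) (l *\<^sub>R perp x) / japanese K)"
  defines "f \<equiv> \<lambda>((q,p),M). P ((real q / L) *\<^sub>R pt M) (of_int p / real q)"
    and "I \<equiv> \<lambda>l. LINT x|lborel. P x l"
  shows "(\<lambda>z. norm (f z)) summable_on rect_index"
    and "continuous_on {-1..1} I"
    and "norm (of_real (pi\<^sup>2/6 / L\<^sup>2) * infsum f rect_index - of_real (ln L) * integral {-1..1} I) \<le> C_core \<sigma> * A"
proof -
  define n where "n = nat \<lfloor>L\<rfloor>"
  have n: "1 \<le> n" "real n \<le> L" "L < real n + 1" using L unfolding n_def by linarith+
  have nq: "real q \<le> L \<longleftrightarrow> q \<le> n" for q using n by linarith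
  define Hd where "Hd = (SIGMA q:{1..n}. reduced q)"
  have fHd: "finite Hd" by (auto simp: Hd_def)
  let ?H = "Sigma Hd (\<lambda>_. - {(0,0)})"
  define T where "T = (SIGMA qp:(SIGMA q:{q. real q > L}. reduced q). - {(0::int,0::int)})"
  have split: "rect_index = ?H \<union> T" "?H \<inter> T = {}"
  proof -
    have "real q > L \<longleftrightarrow> n < q" for q using n by linarith
    then have "T = (SIGMA qp:(SIGMA q:{q. n < q}. reduced q). - {(0::int,0::int)})" by (simp add: T_def)
    moreover have "{1..} = {1..n} \<union> {q. n < q}" "{1..n} \<inter> {q. n < q} = {}" using n(1) by auto
    ultimately show "rect_index = ?H \<union> T" "?H \<inter> T = {}"
      unfolding rect_index_def Hd_def by blast+
  qed
  have Cn: "0 \<le> C_riemann \<sigma>" "0 \<le> C_plane \<sigma>" by (simp_all add: C_riemann_nonneg C_plane_def C_lat_nonneg)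
  have Tb: "(\<Sum>z\<in>F. norm (f z)) \<le> C_tail \<sigma> * A * L\<^sup>2" if "finite F" "F \<subseteq> T" for F
    using rectangle_sum_tail[OF \<sigma> A L tl that(1)] that(2) by (simp add: f_def T_def case_prod_unfold)
  note tail = abs_summable_bounded[of T f, OF Tb]
  have Hb: "(\<Sum>z\<in>F. norm (f z)) \<le> (\<Sum>(q,p)\<in>Hd. A * (2 * C_lat \<sigma> * (1 + 1 / (real q / L))\<^sup>2))"
    if F: "finite F" "F \<subseteq> ?H" for F
  proof -
    have "(\<Sum>z\<in>F. norm (f z)) \<le> (\<Sum>z\<in>Hd \<times> snd ` F. norm (f z))"
      by (rule sum_mono2) (use F fHd in \<open>force+\<close>)
    also have "\<dots> = (\<Sum>qp\<in>Hd. \<Sum>M\<in>snd ` F. norm (f (qp, M)))"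
      by (simp add: case_prod_unfold sum.cartesian_product)
    also have "\<dots> \<le> (\<Sum>(q,p)\<in>Hd. A * (2 * C_lat \<sigma> * (1 + 1 / (real q / L))\<^sup>2))"
    proof (rule sum_mono, clarify)
      fix q p assume "(q,p) \<in> Hd"
      then have r: "real q / L > 0" using L by (auto simp: Hd_def)
      have "(\<Sum>M\<in>snd ` F. norm (f ((q,p), M))) \<le> (\<Sum>M\<in>snd ` F. A * Phi \<sigma> K ((real q / L) *\<^sub>R pt M))"
        unfolding f_def by (intro sum_mono) (use bd in simp)
      also have "\<dots> = A * (\<Sum>M\<in>snd ` F. Phi \<sigma> K ((real q / L) *\<^sub>R pt M))" by (simp add: sum_distrib_left)
      also have "\<dots> \<le> A * (2 * C_lat \<sigma> * (1 + 1 / (real q / L))\<^sup>2)"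
        using F by (intro mult_left_mono A Phi_sum \<sigma> r) auto
      finally show "(\<Sum>M\<in>snd ` F. norm (f ((q,p), M))) \<le> \<dots>" .
    qed
    finally show ?thesis .
  qed
  note head = abs_summable_bounded[of "?H" f, OF Hb]
  show "(\<lambda>z. norm (f z)) summable_on rect_index"
    unfolding split(1) by (rule summable_on_Un_disjoint[OF head(1) tail(1) split(2)])
  have E: "infsum f rect_index = infsum f ?H + infsum f T"
    unfolding split(1) by (rule infsum_Un_disjoint[OF head(2) tail(2) split(2)])
  have H: "infsum f ?H = (\<Sum>(q,p)\<in>Hd. infsum (\<lambda>M. f ((q,p),M)) (- {(0,0)}))"
    using infsum_Sigma_banach[OF head(2)] fHd by (simp add: case_prod_unfold)
  have Pm: "(\<lambda>x. P x l) \<in> borel_measurable borel" for l using cont by (rule borel_measurable_continuous_onI)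
  have Pi: "integrable lborel (\<lambda>x. P x l)" for l
    by (rule Bochner_Integration.integrable_bound[of _ "\<lambda>x. A * Phi \<sigma> K x"])
      (use Phi_integral[OF \<sigma>] bd A Phi_pos Pm in \<open>auto simp: abs_mult less_imp_le\<close>)
  have Ib: "norm (I l) \<le> A * (2 * C_plane \<sigma>)" for l
  proof -
    have "norm (I l) \<le> (LINT x|lborel. A * Phi \<sigma> K x)" unfolding I_def
      by (rule Bochner_Integration.integral_norm_bound_integral) (use Pi bd Phi_integral(1)[OF \<sigma>] in auto)
    also have "\<dots> \<le> A * (2 * C_plane \<sigma>)" using Phi_integral[OF \<sigma>, of K] A by (simp add: mult_left_mono)
    finally show ?thesis .
  qed
  have Il: "norm (I l - I m) \<le> A * (2 * C_plane \<sigma>) * \<bar>l - m\<bar>" for l m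
  proof -
    have "I l - I m = (LINT x|lborel. P x l - P x m)" using Pi by (simp add: I_def)
    also have "norm \<dots> \<le> (LINT x|lborel. A * \<bar>l - m\<bar> * Phi \<sigma> K x)"
      by (rule Bochner_Integration.integral_norm_bound_integral) (use Pi lipl Phi_integral(1)[OF \<sigma>] in auto)
    also have "\<dots> \<le> A * \<bar>l - m\<bar> * (2 * C_plane \<sigma>)" using Phi_integral[OF \<sigma>, of K] A by (simp add: mult_left_mono)
    finally show ?thesis by (simp add: mult_ac)
  qed
  show Ic: "continuous_on {-1..1} I"
    by (rule lipschitz_on_continuous_on[of "A * (2 * C_plane \<sigma>)"])
      (use Il A Cn in \<open>auto intro!: lipschitz_onI simp: dist_norm\<close>)
  \<comment> \<open>The term \<open>2 * A\<close> is the missing point \<open>M = 0\<close> of the lattice. It is harmless: over all \<open>p\<close> and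
    \<open>q \<le> L\<close> it adds up to a multiple of \<open>A * L\<^sup>2\<close>.\<close>
  have h1: "norm (infsum (\<lambda>M. f ((q,p),M)) (- {(0,0)}) - (L / real q)\<^sup>2 *\<^sub>R I (of_int p / real q)) \<le> C_riemann \<sigma> * A * (L / real q) + 2 * A"
    if qp: "(q,p) \<in> Hd" for q p
  proof -
    define \<delta> where "\<delta> = real q / L"
    define l where "l = of_int p / real q"
    have q: "1 \<le> q" "q \<le> n" "p \<in> reduced q" using qp by (auto simp: Hd_def)
    have \<delta>: "0 < \<delta>" "\<delta> \<le> 1" using q L nq[of q] by (auto simp: \<delta>_def)
    have l: "\<bar>l\<bar> \<le> 1" using reduced_abs[OF q(3)] by (simp add: l_def)
    define S where "S = (\<Sum>\<^sub>\<infinity>M. P (\<delta> *\<^sub>R pt M) l)"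
    have sb: "(\<Sum>M\<in>F. norm (P (\<delta> *\<^sub>R pt M) l)) \<le> A * (2 * C_lat \<sigma> * (1 + 1 / \<delta>)\<^sup>2)" if "finite F" for F
    proof -
      have "(\<Sum>M\<in>F. norm (P (\<delta> *\<^sub>R pt M) l)) \<le> A * (\<Sum>M\<in>F. Phi \<sigma> K (\<delta> *\<^sub>R pt M))"
        unfolding sum_distrib_left by (intro sum_mono bd)
      also have "\<dots> \<le> A * (2 * C_lat \<sigma> * (1 + 1 / \<delta>)\<^sup>2)" by (intro mult_left_mono A Phi_sum \<sigma> \<delta> that)
      finally show ?thesis .
    qed
    have sS: "(\<lambda>M. P (\<delta> *\<^sub>R pt M) l) summable_on X" for X
      by (rule abs_summable_bounded(2)[OF sb])
    have "S = infsum (\<lambda>M. P (\<delta> *\<^sub>R pt M) l) ({(0,0)} \<union> - {(0,0)})" by (simp add: S_def)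
    also have "\<dots> = P 0 l + infsum (\<lambda>M. P (\<delta> *\<^sub>R pt M) l) (- {(0,0)})"
    proof -
      have "pt (0,0) = 0" by (simp add: vec_eq_iff forall_2)
      then show ?thesis by (subst infsum_Un_disjoint) (auto simp: sS)
    qed
    finally have e: "infsum (\<lambda>M. f ((q,p),M)) (- {(0,0)}) = S - P 0 l" by (simp add: f_def \<delta>_def l_def)
    have "norm (I l - \<delta>\<^sup>2 *\<^sub>R S) \<le> C_riemann \<sigma> * A * \<delta>"
      unfolding I_def S_def by (rule riemann_sum[OF \<sigma> \<delta> A cont bd lipx[OF l]])
    then have "(1/\<delta>)\<^sup>2 * norm (I l - \<delta>\<^sup>2 *\<^sub>R S) \<le> (1/\<delta>)\<^sup>2 * (C_riemann \<sigma> * A * \<delta>)" by (rule mult_left_mono) simp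
    also have "(1/\<delta>)\<^sup>2 * (C_riemann \<sigma> * A * \<delta>) = C_riemann \<sigma> * A * (1/\<delta>)" using \<delta> by (simp add: power2_eq_square)
    also have "(1/\<delta>)\<^sup>2 * norm (I l - \<delta>\<^sup>2 *\<^sub>R S) = norm ((1/\<delta>)\<^sup>2 *\<^sub>R (I l - \<delta>\<^sup>2 *\<^sub>R S))" by simp
    also have "(1/\<delta>)\<^sup>2 *\<^sub>R (I l - \<delta>\<^sup>2 *\<^sub>R S) = (1/\<delta>)\<^sup>2 *\<^sub>R I l - S" using \<delta> by (simp add: scaleR_diff_right power2_eq_square)
    finally have 1: "norm (S - (1/\<delta>)\<^sup>2 *\<^sub>R I l) \<le> C_riemann \<sigma> * A * (1/\<delta>)" by (simp add: norm_minus_commute)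
    have "Phi \<sigma> K 0 \<le> 2" using wt_le_1[of \<sigma> "0::real^2"] wt_le_1[of \<sigma> K] \<sigma> by (simp add: Phi_def)
    then have "A * Phi \<sigma> K 0 \<le> A * 2" by (rule mult_left_mono[OF _ A])
    then have 2: "norm (P 0 l) \<le> 2 * A" using bd[of 0 l] by simp
    have "norm ((S - P 0 l) - (1/\<delta>)\<^sup>2 *\<^sub>R I l) \<le> norm (S - (1/\<delta>)\<^sup>2 *\<^sub>R I l) + norm (P 0 l)"
      using norm_triangle_ineq4[of "S - (1/\<delta>)\<^sup>2 *\<^sub>R I l" "P 0 l"] by (simp add: algebra_simps)
    then show ?thesis unfolding e using 1 2 by (simp add: \<delta>_def l_def)
  qed
  define a where "a q = (\<Sum>p\<in>reduced q. I (of_int p / of_nat q))" for q :: nat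
  define Sn where "Sn = (\<Sum>q\<in>{1..n}. a q / (of_nat q)\<^sup>2)"
  have HS: "(\<Sum>(q,p)\<in>Hd. (L / real q)\<^sup>2 *\<^sub>R I (of_int p / real q)) = of_real (L\<^sup>2) * Sn"
  proof -
    have "(\<Sum>(q,p)\<in>Hd. (L / real q)\<^sup>2 *\<^sub>R I (of_int p / real q)) = (\<Sum>q\<in>{1..n}. \<Sum>p\<in>reduced q. (L / real q)\<^sup>2 *\<^sub>R I (of_int p / real q))"
      unfolding Hd_def by (subst sum.Sigma) auto
    also have "\<dots> = of_real (L\<^sup>2) * Sn"
      unfolding Sn_def a_def sum_distrib_left sum_divide_distrib
      by (intro sum.cong refl) (simp add: scaleR_conv_of_real power_divide)
    finally show ?thesis .
  qed
  have h2: "norm (infsum f ?H - of_real (L\<^sup>2) * Sn) \<le> (2 * C_riemann \<sigma> + 4) * A * L\<^sup>2"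
  proof -
    have "infsum f ?H - of_real (L\<^sup>2) * Sn =
      (\<Sum>(q,p)\<in>Hd. infsum (\<lambda>M. f ((q,p),M)) (- {(0,0)}) - (L / real q)\<^sup>2 *\<^sub>R I (of_int p / real q))"
      unfolding H HS[symmetric] by (simp add: case_prod_unfold sum_subtractf)
    also have "norm \<dots> \<le> (\<Sum>(q,p)\<in>Hd. C_riemann \<sigma> * A * (L / real q) + 2 * A)"
    proof (rule sum_norm_le)
      fix z assume "z \<in> Hd"
      then show "norm (case z of (q,p) \<Rightarrow> infsum (\<lambda>M. f ((q,p),M)) (- {(0,0)}) - (L / real q)\<^sup>2 *\<^sub>R I (of_int p / real q))
         \<le> (case z of (q,p) \<Rightarrow> C_riemann \<sigma> * A * (L / real q) + 2 * A)"
        using h1[of "fst z" "snd z"] by (simp add: case_prod_unfold)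
    qed
    also have "\<dots> = (\<Sum>q\<in>{1..n}. real (card (reduced q)) * (C_riemann \<sigma> * A * (L / real q) + 2 * A))"
      unfolding Hd_def by (subst sum.Sigma[symmetric]) auto
    also have "\<dots> \<le> (\<Sum>q\<in>{1..n}. (2 * C_riemann \<sigma> + 4) * A * L)"
    proof (rule sum_mono)
      fix q assume q: "q \<in> {1..n}"
      have "real (card (reduced q)) * (C_riemann \<sigma> * A * (L / real q) + 2 * A) \<le> (2 * real q) * (C_riemann \<sigma> * A * (L / real q) + 2 * A)"
      proof (rule mult_right_mono)
        show "real (card (reduced q)) \<le> 2 * real q" using card_reduced[of q] by linarith
      qed (use A L Cn in auto)
      also have "\<dots> = 2 * C_riemann \<sigma> * A * L + 4 * A * real q" using q by (simp add: field_simps)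
      also have "\<dots> \<le> 2 * C_riemann \<sigma> * A * L + 4 * A * L"
        using q nq[of q] A by (intro add_left_mono mult_left_mono) auto
      finally show "real (card (reduced q)) * (C_riemann \<sigma> * A * (L / real q) + 2 * A) \<le> (2 * C_riemann \<sigma> + 4) * A * L"
        by (simp add: algebra_simps)
    qed
    also have "\<dots> = real n * ((2 * C_riemann \<sigma> + 4) * A * L)" by simp
    also have "\<dots> \<le> L * ((2 * C_riemann \<sigma> + 4) * A * L)" using n A L Cn by (intro mult_right_mono) auto
    finally show ?thesis by (simp add: power2_eq_square mult_ac)
  qed
  define D where "D = (2 * C_riemann \<sigma> + 4 + C_tail \<sigma>) * A"
  have E2: "norm (infsum f rect_index - of_real (L\<^sup>2) * Sn) \<le> D * L\<^sup>2"
  proof -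
    have "infsum f rect_index - of_real (L\<^sup>2) * Sn = (infsum f ?H - of_real (L\<^sup>2) * Sn) + infsum f T"
      by (simp add: E)
    then have "norm (infsum f rect_index - of_real (L\<^sup>2) * Sn) \<le>
       norm (infsum f ?H - of_real (L\<^sup>2) * Sn) + norm (infsum f T)"
      by (metis norm_triangle_ineq)
    also have "\<dots> \<le> (2 * C_riemann \<sigma> + 4) * A * L\<^sup>2 + C_tail \<sigma> * A * L\<^sup>2" by (rule add_mono[OF h2 tail(3)])
    finally show ?thesis by (simp add: D_def distrib_right)
  qed
  let ?z = "pi\<^sup>2/6"
  have z: "?z \<le> 2" "0 \<le> ?z" using zeta2_partial_sum(2)[of 1] by auto
  have e1: "norm (of_real (?z / L\<^sup>2) * (infsum f rect_index - of_real (L\<^sup>2) * Sn)) \<le> 2 * D"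
  proof -
    have D0: "0 \<le> D * L\<^sup>2" using E2 norm_ge_zero order_trans by blast
    then have D0: "0 \<le> D" using L by (simp add: zero_le_mult_iff)
    have "norm (of_real (?z / L\<^sup>2) * (infsum f rect_index - of_real (L\<^sup>2) * Sn)) \<le> (?z / L\<^sup>2) * (D * L\<^sup>2)"
      unfolding norm_mult norm_of_real using E2 z by (intro mult_mono) auto
    also have "\<dots> = ?z * D" using L by simp
    also have "\<dots> \<le> 2 * D" using z D0 by (intro mult_right_mono) auto
    finally show ?thesis .
  qed
  have e2: "norm (of_real ?z * Sn - of_real (ln n) * integral {-1..1} I) \<le> C_farey * (A * (2 * C_plane \<sigma>))"
    unfolding Sn_def a_def by (rule farey_average) (use A Cn Ib Il n in auto)
  have e3: "norm (of_real (ln n - ln L) * integral {-1..1} I) \<le> 4 * C_plane \<sigma> * A"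
  proof -
    have "ln n \<le> ln L" using n L by (subst ln_le_cancel_iff) auto
    moreover have "ln L \<le> ln (2 * real n)"
    proof -
      have "1 \<le> real n" using n(1) by simp
      then have "L \<le> 2 * real n" using n(3) by linarith
      then show ?thesis using L by (subst ln_le_cancel_iff) auto
    qed
    moreover have "ln (2 * real n) = ln 2 + ln (real n)" using n by (subst ln_mult) auto
    moreover have "ln 2 \<le> (1::real)" using ln_le_minus_one[of 2] by simp
    ultimately have 1: "\<bar>ln n - ln L\<bar> \<le> 1" by linarith
    have 2: "norm (integral {-1..1} I) \<le> (A * (2 * C_plane \<sigma>)) * (1 - (-1))"
      by (rule integral_bound) (use Ic Ib in auto)
    have "norm (of_real (ln n - ln L) * integral {-1..1} I) \<le> 1 * ((A * (2 * C_plane \<sigma>)) * (1 - (-1)))"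
      unfolding norm_mult norm_of_real using 1 2 by (intro mult_mono) auto
    then show ?thesis by (simp add: mult_ac)
  qed
  have "of_real (?z / L\<^sup>2) * infsum f rect_index - of_real (ln L) * integral {-1..1} I =
     of_real (?z / L\<^sup>2) * (infsum f rect_index - of_real (L\<^sup>2) * Sn) + (of_real ?z * Sn - of_real (ln n) * integral {-1..1} I)
      + of_real (ln n - ln L) * integral {-1..1} I"
  proof -
    have zz: "of_real (?z / L\<^sup>2) * of_real (L\<^sup>2) = (of_real ?z :: complex)"
    proof -
      have "?z / L\<^sup>2 * L\<^sup>2 = ?z" using L by simp
      then show ?thesis by (metis of_real_mult)
    qed
    have alg: "c * E - u * J = c * (E - w * S) + (c * w * S - v * J) + (v - u) * J" for c E u J w S v :: complex
      by (simp add: algebra_simps)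
    show ?thesis unfolding of_real_diff zz[symmetric] by (rule alg)
  qed
  also have "norm \<dots> \<le> 2 * D + C_farey * (A * (2 * C_plane \<sigma>)) + 4 * C_plane \<sigma> * A"
    by (intro norm_triangle_le add_mono e1 e2 e3)
  also have "\<dots> = C_core \<sigma> * A" by (simp add: D_def C_core_def algebra_simps)
  finally show "norm (of_real (?z / L\<^sup>2) * infsum f rect_index - of_real (ln L) * integral {-1..1} I) \<le> C_core \<sigma> * A" .
qed

section \<open>Enumeration of the resonant set\<close>

definition orth_pairs :: "((int \<times> int) \<times> (int \<times> int)) set" where
  "orth_pairs = {(M, N). fst M * fst N + snd M * snd N = 0}"

definition rect_pair :: "(nat \<times> int) \<times> (int \<times> int) \<Rightarrow> (int \<times> int) \<times> (int \<times> int)" where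
  "rect_pair = (\<lambda>((q,p),(x,y)). ((int q * x, int q * y), (- p * y, p * x)))"

text \<open>
  The integer vectors orthogonal to a primitive vector are the multiples of its rotation.
\<close>

lemma orthogonal_to_primitive:
  fixes a b c d :: int
  assumes "coprime a b" "a * c + b * d = 0"
  obtains \<beta> where "c = - \<beta> * b" "d = \<beta> * a"
proof (cases "a = 0")
  case True
  then have b: "\<bar>b\<bar> = 1" using assms(1) by simp
  then have "b * b = 1" by (metis abs_mult_self_eq mult_1)
  moreover have "d = 0" using assms(2) True b by auto
  ultimately show ?thesis using that[of "- c * b"] True by (simp add: mult.assoc)
next
  case False
  have "a dvd b * d" using assms(2) by (metis add.commute dvd_add_right_iff dvd_0_right dvd_triv_left)
  then have "a dvd d" using assms(1) by (simp add: coprime_dvd_mult_right_iff)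
  then obtain \<beta> where "d = \<beta> * a" by (metis dvdE mult.commute)
  moreover have "a * c = a * (- \<beta> * b)" using assms(2) \<open>d = \<beta> * a\<close> by (simp add: algebra_simps eq_neg_iff_add_eq_0)
  then have "c = - \<beta> * b" using mult_left_cancel[OF False, of c "- \<beta> * b"] by blast
  ultimately show ?thesis using that[of \<beta>] by blast
qed

text \<open>
  Reducing the fraction \<open>\<beta>/g\<close> moves the common divisor into the vector \<open>M\<close>.
\<close>

lemma rect_pair_cone:
  fixes g \<beta> x y :: int
  assumes "g > 0" "(x,y) \<noteq> (0,0)" "- g \<le> \<beta>" "\<beta> < g"
  shows "((g * x, g * y), (- \<beta> * y, \<beta> * x)) \<in> rect_pair ` rect_index"
proof -
  define e where "e = gcd \<beta> g"
  define p where "p = \<beta> div e"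
  define k where "k = g div e"
  have e0: "e > 0" using assms by (simp add: e_def)
  have eq: "\<beta> = e * p" "g = e * k" by (simp_all add: p_def k_def e_def)
  have cop: "coprime p k" unfolding p_def k_def e_def using assms by (intro div_gcd_coprime) simp
  have k0: "k > 0" using eq assms e0 by (metis zero_less_mult_pos)
  have rng: "- k \<le> p" "p < k"
  proof -
    have 1: "e * (- k) \<le> e * p" and 2: "e * p < e * k" using assms eq by auto
    show "- k \<le> p" by (rule mult_left_le_imp_le[OF 1 e0])
    show "p < k" by (rule mult_left_less_imp_less[OF 2]) (use e0 in simp)
  qed
  have "((nat k, p), (e * x, e * y)) \<in> rect_index"
    using k0 rng cop assms(2) e0 by (auto simp: rect_index_def reduced_def)
  moreover have "rect_pair ((nat k, p), (e * x, e * y)) = ((g * x, g * y), (- \<beta> * y, \<beta> * x))"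
    using k0 by (simp add: rect_pair_def eq mult_ac)
  ultimately show ?thesis by (metis imageI)
qed

text \<open>
  With \<open>M = g (x,y)\<close>, \<open>(x,y)\<close> primitive, and \<open>N = \<beta> (x,y)\<^sup>\<bottom>\<close>, the pair is of the first kind for
  \<open>- g \<le> \<beta> < g\<close>. Otherwise \<open>\<beta> \<noteq> 0\<close>, and \<open>M\<close> is \<open>- g/\<beta>\<close> times the rotation of \<open>N\<close>. This slope lies in \<open>[-1, 0)\<close> for
  \<open>\<beta> \<ge> g\<close> and in \<open>(0, 1)\<close> for \<open>\<beta> < - g\<close>, so the pair is of the second kind. The half-open range of slopes is what
  puts squares into exactly one of the two kinds.
\<close>

lemma orth_pairs_eq: "orth_pairs = insert ((0,0),(0,0)) (rect_pair ` rect_index \<union> prod.swap ` rect_pair ` rect_index)"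
proof (intro equalityI subsetI)
  fix z assume z: "z \<in> orth_pairs"
  obtain a b c d where zz: "z = ((a,b),(c,d))" by (metis prod.collapse)
  have orth: "a * c + b * d = 0" using z by (simp add: zz orth_pairs_def)
  have key: "((a,b),(c,d)) \<in> rect_pair ` rect_index \<union> prod.swap ` rect_pair ` rect_index"
    if ab: "(a,b) \<noteq> (0,0)" and orth: "a * c + b * d = 0" for a b c d :: int
  proof -
    define g where "g = gcd a b"
    define x where "x = a div g"
    define y where "y = b div g"
    have g0: "g > 0" using ab by (auto simp: g_def)
    have eq: "a = g * x" "b = g * y" by (simp_all add: x_def y_def g_def)
    have cop: "coprime x y" unfolding x_def y_def g_def using ab by (intro div_gcd_coprime) auto
    have "g * (x * c + y * d) = 0" using orth by (simp add: eq algebra_simps)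
    then have "x * c + y * d = 0" using g0 by simp
    then obtain \<beta> where \<beta>: "c = - \<beta> * y" "d = \<beta> * x" using orthogonal_to_primitive[OF cop] by blast
    have xy: "(x,y) \<noteq> (0,0)" using ab eq by auto
    consider "- g \<le> \<beta>" "\<beta> < g" | "\<beta> \<ge> g" | "\<beta> < - g" by linarith
    then show ?thesis
    proof cases
      case 1
      then show ?thesis using rect_pair_cone[OF g0 xy 1] by (simp add: eq \<beta>)
    next
      case 2
      have "((\<beta> * (-y), \<beta> * x), (- (-g) * x, (-g) * (-y))) \<in> rect_pair ` rect_index"
        using 2 g0 xy by (intro rect_pair_cone) auto
      then have "prod.swap ((\<beta> * (-y), \<beta> * x), (- (-g) * x, (-g) * (-y))) \<in> prod.swap ` rect_pair ` rect_index" by (rule imageI)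
      then show ?thesis by (simp add: eq \<beta>)
    next
      case 3
      have "(((-\<beta>) * y, (-\<beta>) * (-x)), (- g * (-x), g * y)) \<in> rect_pair ` rect_index"
        using 3 g0 xy by (intro rect_pair_cone) auto
      then have "prod.swap (((-\<beta>) * y, (-\<beta>) * (-x)), (- g * (-x), g * y)) \<in> prod.swap ` rect_pair ` rect_index" by (rule imageI)
      then show ?thesis by (simp add: eq \<beta>)
    qed
  qed
  consider "(a,b) \<noteq> (0,0)" | "(c,d) \<noteq> (0,0)" | "(a,b) = (0,0)" "(c,d) = (0,0)" by blast
  then show "z \<in> insert ((0,0),(0,0)) (rect_pair ` rect_index \<union> prod.swap ` rect_pair ` rect_index)"
  proof cases
    case 1 then show ?thesis using key[OF 1 orth] by (simp add: zz)
  next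
    case 2
    have "((c,d),(a,b)) \<in> rect_pair ` rect_index \<union> prod.swap ` rect_pair ` rect_index"
      using orth by (intro key[OF 2]) (simp add: algebra_simps)
    then have "prod.swap ((c,d),(a,b)) \<in> prod.swap ` (rect_pair ` rect_index \<union> prod.swap ` rect_pair ` rect_index)" by (rule imageI)
    then show ?thesis by (auto simp: zz image_Un image_image)
  next
    case 3 then show ?thesis by (simp add: zz)
  qed
next
  fix z assume "z \<in> insert ((0,0),(0,0)) (rect_pair ` rect_index \<union> prod.swap ` rect_pair ` rect_index)"
  then show "z \<in> orth_pairs" by (auto simp: orth_pairs_def rect_pair_def)
qed

text \<open>
  The slope is determined by the pair, hence so are its numerator and denominator, and then \<open>M\<close>.
\<close>

lemma inj_on_rect_pair: "inj_on rect_pair rect_index"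
proof (rule inj_onI)
  fix z z' assume z: "z \<in> rect_index" "z' \<in> rect_index" "rect_pair z = rect_pair z'"
  obtain q p x y where zz: "z = ((q,p),(x,y))" by (metis prod.collapse)
  obtain q' p' u v where zz': "z' = ((q',p'),(u,v))" by (metis prod.collapse)
  have h: "q \<ge> 1" "coprime p (int q)" "(x,y) \<noteq> (0,0)" "q' \<ge> 1" "coprime p' (int q')" "(u,v) \<noteq> (0,0)"
    using z(1,2) by (auto simp: zz zz' rect_index_def reduced_def)
  have e: "int q * x = int q' * u" "int q * y = int q' * v" "p * y = p' * v" "p * x = p' * u"
    using z(3) by (auto simp: zz zz' rect_pair_def)
  have "(p' * int q - p * int q') * x = 0" "(p' * int q - p * int q') * y = 0"
  proof -
    have "p' * (int q * x) = p' * (int q' * u)" using e by simp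
    also have "\<dots> = int q' * (p * x)" using e by simp
    finally show "(p' * int q - p * int q') * x = 0" by (simp add: algebra_simps)
    have "p' * (int q * y) = p' * (int q' * v)" using e by simp
    also have "\<dots> = int q' * (p * y)" using e by simp
    finally show "(p' * int q - p * int q') * y = 0" by (simp add: algebra_simps)
  qed
  then have "p' * int q = p * int q'" using h(3) by auto
  then have "\<bar>p'\<bar> = \<bar>p\<bar> \<and> \<bar>int q\<bar> = \<bar>int q'\<bar>"
    using h coprime_crossproduct_int[of p' "int q'" p "int q"] abs_mult[of p' "int q"] abs_mult[of p "int q'"]
    by (simp add: coprime_commute)
  then have q: "q = q'" by simp
  moreover have "p = p'" using \<open>p' * int q = p * int q'\<close> q h by simp
  moreover have "x = u" "y = v" using e q h by auto
  ultimately show "z = z'" by (simp add: zz zz')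
qed

text \<open>
  A common pair would force \<open>q q' + p p' = 0\<close>, that is, slopes with product \<open>-1\<close>. In \<open>[-1, 1)\<close> the product of two
  slopes is \<open>-1\<close> only for \<open>-1\<close> and \<open>1\<close>, and \<open>1\<close> is excluded.
\<close>

lemma rect_pair_swap_disjoint: "rect_pair ` rect_index \<inter> prod.swap ` rect_pair ` rect_index = {}"
proof (rule ccontr)
  assume "rect_pair ` rect_index \<inter> prod.swap ` rect_pair ` rect_index \<noteq> {}"
  then obtain w where w: "w \<in> rect_pair ` rect_index" "w \<in> prod.swap ` rect_pair ` rect_index" by blast
  from w(1) obtain z where z1: "z \<in> rect_index" "w = rect_pair z" by blast
  from w(2) obtain z' where z2: "z' \<in> rect_index" "w = prod.swap (rect_pair z')" by blast
  note z = z1(1) z2(1) trans[OF z1(2)[symmetric] z2(2)]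
  obtain q p x y where zz: "z = ((q,p),(x,y))" by (metis prod.collapse)
  obtain q' p' u v where zz': "z' = ((q',p'),(u,v))" by (metis prod.collapse)
  have h: "q \<ge> 1" "- int q \<le> p" "p < int q" "(x,y) \<noteq> (0,0)" "q' \<ge> 1" "- int q' \<le> p'" "p' < int q'" "(u,v) \<noteq> (0,0)"
    using z(1,2) by (auto simp: zz zz' rect_index_def reduced_def)
  have e: "int q * x = - p' * v" "int q * y = p' * u" "- p * y = int q' * u" "p * x = int q' * v"
    using z(3) by (auto simp: zz zz' rect_pair_def)
  have "int q' * (int q * x) = - p' * (int q' * v)" using e(1) by simp
  also have "\<dots> = - p' * (p * x)" using e(4) by simp
  finally have 1: "(int q * int q' + p * p') * x = 0" by (simp add: algebra_simps)
  have "int q' * (int q * y) = p' * (int q' * u)" using e(2) by simp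
  also have "\<dots> = p' * (- p * y)" using e(3) by simp
  finally have 2: "(int q * int q' + p * p') * y = 0" by (simp add: algebra_simps)
  from 1 2 h(4) have 0: "int q * int q' + p * p' = 0" by auto
  have qq: "int q * int q' > 0" using h by simp
  consider "p * p' \<ge> 0" | "p > 0" "p' < 0" | "p < 0" "p' > 0"
    by (metis linorder_less_linear mult_nonneg_nonneg mult_nonpos_nonpos mult_zero_left mult_zero_right order_less_imp_le order_refl)
  then show False
  proof cases
    case 1 then show ?thesis using 0 qq by linarith
  next
    case 2
    have "p * (- p') < int q * int q'" using 2 h by (intro mult_less_le_imp_less) auto
    then show ?thesis using 0 by simp
  next
    case 3
    have "(- p) * p' < int q * int q'" using 3 h by (intro mult_le_less_imp_less) auto
    then show ?thesis using 0 by simp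
  qed
qed

definition rect_triple :: "real \<Rightarrow> real^2 \<Rightarrow> (int \<times> int) \<times> (int \<times> int) \<Rightarrow> (real^2) \<times> (real^2) \<times> (real^2)" where
  "rect_triple L K = (\<lambda>(M,N). (K + (1/L) *\<^sub>R pt M, K + (1/L) *\<^sub>R pt M + (1/L) *\<^sub>R pt N, K + (1/L) *\<^sub>R pt N))"

lemma pt_add: "pt (a + c, b + d) = pt (a,b) + pt (c,d)"
  by (simp add: vec_eq_iff forall_2)

lemma pt_diff: "pt (a - c, b - d) = pt (a,b) - pt (c,d)"
  by (simp add: vec_eq_iff forall_2)

lemma pt_inj: "pt M = pt N \<longleftrightarrow> M = N"
  by (auto simp: vec_eq_iff forall_2 prod_eq_iff)

lemma scaled_lattice_pt: "scaled_lattice L = (\<lambda>M. (1/L) *\<^sub>R pt M) ` UNIV"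
proof -
  have "{v. \<forall>i. v $ i \<in> \<int>} = range pt"
  proof (intro equalityI subsetI)
    fix v :: "real^2" assume "v \<in> {v. \<forall>i. v $ i \<in> \<int>}"
    then obtain a b where "v $ 1 = of_int a" "v $ 2 = of_int b" by (metis Ints_cases mem_Collect_eq)
    then have "v = pt (a,b)" by (simp add: vec_eq_iff forall_2)
    then show "v \<in> range pt" by simp
  qed (auto simp: forall_2)
  then show ?thesis by (simp add: scaled_lattice_def image_image)
qed

text \<open>
  The resonance condition on the norms is, by polarisation, orthogonality of the two sides at \<open>K\<close>.
\<close>

lemma bij_rect_triple:
  assumes L: "L > 0" and K: "K \<in> scaled_lattice L"
  shows "bij_betw (rect_triple L K) orth_pairs (resonant_set L K)"
proof (rule bij_betw_imageI)
  show "inj_on (rect_triple L K) orth_pairs"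
    using L by (auto intro!: inj_onI simp: rect_triple_def pt_inj)
  obtain M0 where M0: "K = (1/L) *\<^sub>R pt M0" using K by (auto simp: scaled_lattice_pt)
  have lat: "K + (1/L) *\<^sub>R pt M \<in> scaled_lattice L" for M
  proof -
    have "K + (1/L) *\<^sub>R pt M = (1/L) *\<^sub>R pt (fst M0 + fst M, snd M0 + snd M)"
      by (simp add: M0 pt_add scaleR_add_right)
    then show ?thesis by (auto simp: scaled_lattice_pt)
  qed
  have inner: "(norm (K + u))\<^sup>2 - (norm (K + u + v))\<^sup>2 + (norm (K + v))\<^sup>2 = (norm K)\<^sup>2 \<longleftrightarrow> u $ 1 * v $ 1 + u $ 2 * v $ 2 = 0" for u v :: "real^2"
  proof -
    define w where "w = u $ 1 * v $ 1 + u $ 2 * v $ 2"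
    have "(norm (K + u))\<^sup>2 - (norm (K + u + v))\<^sup>2 + (norm (K + v))\<^sup>2 = (norm K)\<^sup>2 - 2 * w"
      unfolding w_def
      unfolding norm_vec2 by (simp add: power2_eq_square algebra_simps)
    then show ?thesis unfolding w_def[symmetric] by simp
  qed
  have orth: "((1/L) *\<^sub>R pt M) $ 1 * ((1/L) *\<^sub>R pt N) $ 1 + ((1/L) *\<^sub>R pt M) $ 2 * ((1/L) *\<^sub>R pt N) $ 2 = 0 \<longleftrightarrow> (M,N) \<in> orth_pairs" for M N
  proof -
    have "((1/L) *\<^sub>R pt M) $ 1 * ((1/L) *\<^sub>R pt N) $ 1 + ((1/L) *\<^sub>R pt M) $ 2 * ((1/L) *\<^sub>R pt N) $ 2
       = real_of_int (fst M * fst N + snd M * snd N) / L\<^sup>2" using L by (simp add: power2_eq_square add_divide_distrib)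
    then show ?thesis using L by (simp add: orth_pairs_def del: of_int_add of_int_mult)
  qed
  show "rect_triple L K ` orth_pairs = resonant_set L K"
  proof (intro equalityI subsetI)
    fix w assume "w \<in> rect_triple L K ` orth_pairs"
    then obtain M N where w: "w = rect_triple L K (M,N)" "(M,N) \<in> orth_pairs" by auto
    have "K + (1/L) *\<^sub>R pt M + (1/L) *\<^sub>R pt N \<in> scaled_lattice L"
      using lat[of "(fst M + fst N, snd M + snd N)"] by (simp add: pt_add scaleR_add_right add.assoc)
    then show "w \<in> resonant_set L K"
      using w lat inner[of "(1/L) *\<^sub>R pt M" "(1/L) *\<^sub>R pt N"] orth[of M N] by (simp add: rect_triple_def resonant_set_def)
  next
    fix w assume w: "w \<in> resonant_set L K"
    obtain K1 K2 K3 where w3: "w = (K1,K2,K3)" by (metis prod.collapse)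
    obtain M1 M3 where M: "K1 = (1/L) *\<^sub>R pt M1" "K3 = (1/L) *\<^sub>R pt M3"
      using w by (auto simp: w3 resonant_set_def scaled_lattice_pt)
    define M where "M = (fst M1 - fst M0, snd M1 - snd M0)"
    define N where "N = (fst M3 - fst M0, snd M3 - snd M0)"
    have K1: "K1 = K + (1/L) *\<^sub>R pt M" by (simp add: M M_def M0 pt_diff scaleR_diff_right)
    have K3: "K3 = K + (1/L) *\<^sub>R pt N" by (simp add: M N_def M0 pt_diff scaleR_diff_right)
    have "K1 - K2 + K3 = K" using w by (simp add: w3 resonant_set_def)
    then have "K2 = K1 + K3 - K" by (simp add: algebra_simps)
    then have K2: "K2 = K + (1/L) *\<^sub>R pt M + (1/L) *\<^sub>R pt N" by (simp add: K1 K3)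
    have "(M,N) \<in> orth_pairs"
      using w inner[of "(1/L) *\<^sub>R pt M" "(1/L) *\<^sub>R pt N"] orth[of M N] by (simp add: w3 resonant_set_def K1 K2 K3)
    then show "w \<in> rect_triple L K ` orth_pairs"
      by (intro image_eqI[of _ _ "(M,N)"]) (simp_all add: w3 rect_triple_def K1 K2 K3)
  qed
qed

lemma resonant_sum:
  fixes h :: "real^2 \<Rightarrow> complex"
  assumes L: "L > 0" and K: "K \<in> scaled_lattice L"
  defines "f \<equiv> \<lambda>((q,p),M). integrand h K ((real q / L) *\<^sub>R pt M) (of_int p / real q)"
  assumes sm: "(\<lambda>z. norm (f z)) summable_on rect_index"
  shows "(\<Sum>\<^sub>\<infinity>(K1, K2, K3)\<in>resonant_set L K. h K1 * cnj (h K2) * h K3) = h K * cnj (h K) * h K + 2 * infsum f rect_index"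
proof -
  define H where "H = (\<lambda>(K1,K2,K3). h K1 * cnj (h K2) * h K3)"
  define G where "G = (\<lambda>MN. H (rect_triple L K MN))"
  have fs: "f summable_on rect_index" using sm by (rule abs_summable_summable)
  have Gf: "G (rect_pair z) = f z" if "z \<in> rect_index" for z
  proof -
    obtain q p x y where zz: "z = ((q,p),(x,y))" by (metis prod.collapse)
    have q: "q \<ge> 1" using that by (auto simp: zz rect_index_def)
    have 1: "(1/L) *\<^sub>R pt (int q * x, int q * y) = (real q / L) *\<^sub>R pt (x,y)"
      by (simp add: vec_eq_iff forall_2)
    have 2: "(1/L) *\<^sub>R pt (- p * y, p * x) = (of_int p / real q) *\<^sub>R perp ((real q / L) *\<^sub>R pt (x,y))"
      using q by (simp add: vec_eq_iff forall_2)
    show ?thesis unfolding G_def zz rect_pair_def rect_triple_def H_def f_def integrand_def prod.case 1 2 ..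
  qed
  have Gs: "G (prod.swap z) = G z" for z
    by (cases z) (simp add: G_def H_def rect_triple_def algebra_simps)
  have s1: "(G has_sum infsum f rect_index) (rect_pair ` rect_index)"
  proof -
    have "(f has_sum infsum f rect_index) rect_index" using fs by (rule has_sum_infsum)
    then have "((G \<circ> rect_pair) has_sum infsum f rect_index) rect_index"
      by (subst has_sum_cong[of _ _ f]) (auto simp: Gf)
    then show ?thesis by (subst has_sum_reindex[OF inj_on_rect_pair])
  qed
  have s2: "(G has_sum infsum f rect_index) (prod.swap ` rect_pair ` rect_index)"
  proof -
    have "((G \<circ> prod.swap) has_sum infsum f rect_index) (rect_pair ` rect_index)"
      using s1 by (subst has_sum_cong[of _ _ G]) (auto simp: Gs)
    then show ?thesis by (subst has_sum_reindex) (auto intro: inj_on_subset[OF inj_swap])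
  qed
  have s12: "(G has_sum (infsum f rect_index + infsum f rect_index)) (rect_pair ` rect_index \<union> prod.swap ` rect_pair ` rect_index)"
    by (rule has_sum_Un_disjoint[OF s1 s2 rect_pair_swap_disjoint])
  have nz: "((0,0),(0,0)) \<notin> rect_pair ` rect_index \<union> prod.swap ` rect_pair ` rect_index"
    by (auto simp: rect_pair_def rect_index_def prod_eq_iff)
  have s3: "(G has_sum (G ((0,0),(0,0)) + (infsum f rect_index + infsum f rect_index))) orth_pairs"
    unfolding orth_pairs_eq by (rule has_sum_insert[OF nz s12])
  have "pt (0,0) = 0" by (simp add: vec_eq_iff forall_2)
  then have G0: "G ((0,0),(0,0)) = h K * cnj (h K) * h K" by (simp add: G_def H_def rect_triple_def)
  have "infsum H (resonant_set L K) = infsum G orth_pairs"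
    unfolding G_def by (rule infsum_reindex_bij_betw[OF bij_rect_triple[OF L K], symmetric])
  also have "\<dots> = G ((0,0),(0,0)) + (infsum f rect_index + infsum f rect_index)" using s3 by (rule infsumI)
  finally show ?thesis unfolding G0 H_def by simp
qed

section \<open>Test functions\<close>

text \<open>
  A smooth function of one variable, given together with all its derivatives.
\<close>

definition smooth_seq :: "(nat \<Rightarrow> real \<Rightarrow> real) \<Rightarrow> bool" where
  "smooth_seq U \<longleftrightarrow> (\<forall>n t. (U n has_real_derivative U (Suc n) t) (at t))"

lemma smooth_seq_cont: "smooth_seq U \<Longrightarrow> continuous_on S (U n)"
  unfolding smooth_seq_def by (meson DERIV_isCont continuous_at_imp_continuous_on)

lemma smooth_seq_affine: "smooth_seq U \<Longrightarrow> smooth_seq (\<lambda>n t. c ^ n * U n (c * t + d))"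
  unfolding smooth_seq_def
proof (intro allI)
  fix n t assume U: "\<forall>n t. (U n has_real_derivative U (Suc n) t) (at t)"
  have "((\<lambda>t. U n (c * t + d)) has_real_derivative U (Suc n) (c * t + d) * c) (at t)"
    by (rule DERIV_chain2[OF U[rule_format]]) (auto intro!: derivative_eq_intros)
  from DERIV_cmult[OF this, of "c ^ n"]
  show "((\<lambda>t. c ^ n * U n (c * t + d)) has_real_derivative c ^ Suc n * U (Suc n) (c * t + d)) (at t)"
    by (simp add: mult_ac)
qed

text \<open>
  The Leibniz rule.
\<close>

lemma smooth_seq_mult:
  assumes "smooth_seq U" "smooth_seq V"
  shows "smooth_seq (\<lambda>n t. \<Sum>k\<le>n. real (n choose k) * U k t * V (n - k) t)"
  unfolding smooth_seq_def
proof (intro allI)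
  fix n t
  have U: "(U k has_real_derivative U (Suc k) t) (at t)" for k using assms(1) by (simp add: smooth_seq_def)
  have V: "(V k has_real_derivative V (Suc k) t) (at t)" for k using assms(2) by (simp add: smooth_seq_def)
  have "((\<lambda>t. \<Sum>k\<le>n. real (n choose k) * U k t * V (n - k) t) has_real_derivative
     (\<Sum>k\<le>n. real (n choose k) * U (Suc k) t * V (n - k) t + real (n choose k) * U k t * V (Suc (n - k)) t)) (at t)"
    by (intro DERIV_sum) (auto intro!: derivative_eq_intros U V)
  moreover have "(\<Sum>k\<le>n. real (n choose k) * U (Suc k) t * V (n - k) t + real (n choose k) * U k t * V (Suc (n - k)) t)
    = (\<Sum>k\<le>Suc n. real (Suc n choose k) * U k t * V (Suc n - k) t)"
  proof -
    have "(\<Sum>k\<le>Suc n. real (n choose k) * U k t * V (Suc n - k) t) = U 0 t * V (Suc n) t + (\<Sum>k\<le>n. real (n choose Suc k) * U (Suc k) t * V (n - k) t)"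
      by (subst sum.atMost_Suc_shift) simp
    moreover have "(\<Sum>k\<le>Suc n. real (n choose k) * U k t * V (Suc n - k) t) = (\<Sum>k\<le>n. real (n choose k) * U k t * V (Suc (n - k)) t)"
      by (simp add: Suc_diff_le)
    moreover have "(\<Sum>k\<le>Suc n. real (Suc n choose k) * U k t * V (Suc n - k) t) = U 0 t * V (Suc n) t +
      (\<Sum>k\<le>n. real (n choose k) * U (Suc k) t * V (n - k) t) + (\<Sum>k\<le>n. real (n choose Suc k) * U (Suc k) t * V (n - k) t)"
      by (subst sum.atMost_Suc_shift) (simp add: distrib_right sum.distrib)
    ultimately show ?thesis by (simp add: sum.distrib)
  qed
  ultimately show "((\<lambda>t. \<Sum>k\<le>n. real (n choose k) * U k t * V (n - k) t) has_real_derivative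
     (\<Sum>k\<le>Suc n. real (Suc n choose k) * U k t * V (Suc n - k) t)) (at t)" by simp
qed

text \<open>
  The \<open>n\<close>-th derivative of \<open>exp(-1/t)\<close> is a polynomial in \<open>1/t\<close> times \<open>exp(-1/t)\<close>. The recursion comes from
  \<open>d(1/t)/dt = - (1/t)\<^sup>2\<close>.
\<close>

fun flat_poly :: "nat \<Rightarrow> real poly" where
  "flat_poly 0 = 1"
| "flat_poly (Suc n) = monom 1 2 * (flat_poly n - pderiv (flat_poly n))"

definition flat :: "nat \<Rightarrow> real \<Rightarrow> real" where
  "flat n t = (if t > 0 then poly (flat_poly n) (1/t) * exp (- (1/t)) else 0)"

lemma poly_exp_tendsto_0: "((\<lambda>s::real. s ^ k * poly p s * exp (- s)) \<longlongrightarrow> 0) at_top"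
proof (induction p arbitrary: k)
  case 0
  then show ?case by simp
next
  case (pCons a p)
  have "((\<lambda>s::real. s ^ k * exp (- s)) \<longlongrightarrow> 0) at_top"
    using tendsto_power_div_exp_0[of k] by (simp add: exp_minus divide_inverse)
  from tendsto_add[OF tendsto_mult[OF tendsto_const[of a] this] pCons.IH[of "Suc k"]]
  show ?case by (simp add: algebra_simps)
qed

lemma smooth_seq_flat: "smooth_seq flat"
  unfolding smooth_seq_def
proof (intro allI)
  fix n :: nat and t :: real
  consider "t > 0" | "t < 0" | "t = 0" by linarith
  then show "(flat n has_real_derivative flat (Suc n) t) (at t)"
  proof cases
    case 1
    have "((\<lambda>t. poly (flat_poly n) (1/t) * exp (- (1/t))) has_real_derivative flat (Suc n) t) (at t)"
      using 1 by (auto intro!: derivative_eq_intros simp: flat_def poly_monom power2_eq_square field_simps)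
    then show ?thesis
      by (rule has_field_derivative_transform_within_open[of _ _ _ "{0<..}"]) (use 1 in \<open>auto simp: flat_def\<close>)
  next
    case 2
    have "((\<lambda>t. 0) has_real_derivative flat (Suc n) t) (at t)" using 2 by (simp add: flat_def)
    then show ?thesis
      by (rule has_field_derivative_transform_within_open[of _ _ _ "{..<0}"]) (use 2 in \<open>auto simp: flat_def\<close>)
  next
    case 3
    have R: "((\<lambda>h. flat n h / h) \<longlongrightarrow> 0) (at_right 0)"
    proof -
      have "((\<lambda>h. (1/h) ^ 1 * poly (flat_poly n) (1/h) * exp (- (1/h))) \<longlongrightarrow> 0) (at_right (0::real))"
        by (rule filterlim_compose[OF poly_exp_tendsto_0]) (simp add: filterlim_inverse_at_top_right flip: inverse_eq_divide)
      then show ?thesis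
        by (rule Lim_transform_eventually) (auto simp: eventually_at_right_field flat_def intro!: exI[of _ 1])
    qed
    have L: "((\<lambda>h. flat n h / h) \<longlongrightarrow> 0) (at_left 0)"
      by (rule Lim_transform_eventually[OF tendsto_const]) (auto simp: eventually_at_left_field flat_def intro!: exI[of _ "-1"])
    have "((\<lambda>h. flat n h / h) \<longlongrightarrow> 0) (at 0)" by (rule filterlim_split_at[OF L R])
    then show ?thesis using 3 by (simp add: DERIV_def flat_def)
  qed
qed

text \<open>
  The \<open>n\<close>-th derivative, by the Leibniz rule, of
  \<open>flat 0 ((m + 1) (t - \<alpha>)) * flat 0 ((m + 1) (\<beta> - t))\<close>. As \<open>exp(-1/t)\<close> tends to \<open>1\<close> at infinity, stretching
  it by \<open>m + 1\<close> already approximates a step, and the product of two such steps the indicator of the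
  interval from \<open>\<alpha>\<close> to \<open>\<beta>\<close>, with support inside the interval for every \<open>m\<close>.
\<close>

definition plateau :: "real \<Rightarrow> real \<Rightarrow> nat \<Rightarrow> nat \<Rightarrow> real \<Rightarrow> real" where
  "plateau \<alpha> \<beta> m n t = (\<Sum>k\<le>n. real (n choose k) *
     (real (Suc m) ^ k * flat k (real (Suc m) * t + - (real (Suc m) * \<alpha>))) *
     ((- real (Suc m)) ^ (n - k) * flat (n - k) (- real (Suc m) * t + real (Suc m) * \<beta>)))"

lemma smooth_seq_plateau: "smooth_seq (plateau \<alpha> \<beta> m)"
  using smooth_seq_mult[OF smooth_seq_affine[OF smooth_seq_flat] smooth_seq_affine[OF smooth_seq_flat],
     of "real (Suc m)" "- (real (Suc m) * \<alpha>)" "- real (Suc m)" "real (Suc m) * \<beta>"]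
  unfolding plateau_def[abs_def] .

lemma plateau_eq_0: "t \<le> \<alpha> \<or> \<beta> \<le> t \<Longrightarrow> plateau \<alpha> \<beta> m n t = 0"
proof -
  assume "t \<le> \<alpha> \<or> \<beta> \<le> t"
  then have "real (Suc m) * t + - (real (Suc m) * \<alpha>) \<le> 0 \<or> - real (Suc m) * t + real (Suc m) * \<beta> \<le> 0"
  proof
    assume "t \<le> \<alpha>" then show ?thesis using mult_left_mono[of t \<alpha> "real (Suc m)"] by (simp del: of_nat_Suc)
  next
    assume "\<beta> \<le> t" then show ?thesis using mult_left_mono[of \<beta> t "real (Suc m)"] by (simp del: of_nat_Suc)
  qed
  then show ?thesis unfolding plateau_def by (intro sum.neutral) (auto simp: flat_def)
qed

lemma plateau_0: "plateau \<alpha> \<beta> m 0 t = flat 0 (real (Suc m) * (t - \<alpha>)) * flat 0 (real (Suc m) * (\<beta> - t))"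
  by (simp add: plateau_def algebra_simps)

lemma flat_0_bounds: "0 \<le> flat 0 t" "flat 0 t \<le> 1"
  by (auto simp: flat_def)

lemma plateau_bounds: "0 \<le> plateau \<alpha> \<beta> m 0 t" "plateau \<alpha> \<beta> m 0 t \<le> 1"
  unfolding plateau_0 by (intro mult_nonneg_nonneg mult_le_one flat_0_bounds)+

lemma plateau_tendsto: "(\<lambda>m. plateau \<alpha> \<beta> m 0 t) \<longlonglongrightarrow> indicator {\<alpha><..<\<beta>} t"
proof (cases "t \<in> {\<alpha><..<\<beta>}")
  case True
  have lim: "(\<lambda>m. flat 0 (real (Suc m) * c)) \<longlonglongrightarrow> 1" if c: "c > 0" for c
  proof -
    have "(\<lambda>m. exp (- ((1/c) * inverse (real (Suc m))))) \<longlonglongrightarrow> exp (- ((1/c) * 0))"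
      by (intro tendsto_intros LIMSEQ_inverse_real_of_nat)
    moreover have "flat 0 (real (Suc m) * c) = exp (- ((1/c) * inverse (real (Suc m))))" for m
    proof -
      have "real (Suc m) * c > 0" using c by (intro mult_pos_pos) auto
      then show ?thesis by (simp add: flat_def divide_inverse mult_ac del: of_nat_Suc)
    qed
    ultimately show ?thesis by simp
  qed
  have "(\<lambda>m. plateau \<alpha> \<beta> m 0 t) \<longlonglongrightarrow> 1 * 1"
    unfolding plateau_0 by (intro tendsto_mult lim) (use True in auto)
  then show ?thesis using True by simp
next
  case False
  then have "t \<le> \<alpha> \<or> \<beta> \<le> t" by auto
  then show ?thesis using False by (simp add: plateau_eq_0)
qed

lemma bounded_compact_support:
  assumes "continuous_on UNIV (u :: real \<Rightarrow> real)" "\<And>t. t \<notin> {\<alpha>..\<beta>} \<Longrightarrow> u t = 0"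
  obtains M where "M \<ge> 0" "\<And>t. \<bar>u t\<bar> \<le> M"
proof -
  have "compact (u ` {\<alpha>..\<beta>})"
    by (intro compact_continuous_image continuous_on_subset[OF assms(1)]) auto
  then have "bounded (u ` {\<alpha>..\<beta>})" by (rule compact_imp_bounded)
  then obtain M where M: "M > 0" "\<And>t. t \<in> {\<alpha>..\<beta>} \<Longrightarrow> \<bar>u t\<bar> \<le> M" by (auto simp: bounded_pos)
  have "\<bar>u t\<bar> \<le> M" for t using M assms(2)[of t] by (cases "t \<in> {\<alpha>..\<beta>}") auto
  with M(1) show ?thesis using that[of M] by simp
qed

lemma has_derivative_tensor:
  assumes "smooth_seq U" "smooth_seq V"
  shows "((\<lambda>x::real^2. U i (x $ 1) * V j (x $ 2)) has_derivative
     (\<lambda>h. h $ 1 * (U (Suc i) (x $ 1) * V j (x $ 2)) + h $ 2 * (U i (x $ 1) * V (Suc j) (x $ 2)))) (at x)"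
proof -
  have c: "((\<lambda>x::real^2. x $ k) has_derivative (\<lambda>h. h $ k)) (at x)" for k :: 2
    by (rule bounded_linear_imp_has_derivative) (rule bounded_linear_vec_nth)
  have U: "((\<lambda>x::real^2. U i (x $ 1)) has_derivative (\<lambda>h. h $ 1 * U (Suc i) (x $ 1))) (at x)"
    by (rule DERIV_compose_FDERIV[OF _ c]) (use assms(1) in \<open>simp add: smooth_seq_def\<close>)
  have V: "((\<lambda>x::real^2. V j (x $ 2)) has_derivative (\<lambda>h. h $ 2 * V (Suc j) (x $ 2))) (at x)"
    by (rule DERIV_compose_FDERIV[OF _ c]) (use assms(2) in \<open>simp add: smooth_seq_def\<close>)
  show ?thesis by (rule has_derivative_eq_rhs[OF has_derivative_mult[OF U V]]) (auto simp: algebra_simps)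
qed

lemma smooth_seq_line_derivative:
  assumes "smooth_seq U"
  shows "((\<lambda>t. U i (z - t * c)) has_real_derivative - c * U (Suc i) (z - t * c)) (at t)"
proof -
  have "((\<lambda>t. U i (z - t * c)) has_real_derivative U (Suc i) (z - t * c) * (- c)) (at t)"
    by (rule DERIV_chain2[where f = "U i"]) (use assms in \<open>auto simp: smooth_seq_def intro!: derivative_eq_intros\<close>)
  then show ?thesis by (simp add: mult.commute)
qed

lemma test_function_tensor:
  fixes a b :: "real^2"
  assumes "smooth_seq U" "smooth_seq V"
    and U: "\<And>t. t \<notin> {a $ 1..b $ 1} \<Longrightarrow> U 0 t = 0" and V: "\<And>t. t \<notin> {a $ 2..b $ 2} \<Longrightarrow> V 0 t = 0"
  shows "test_function (\<lambda>x. U 0 (x $ 1) * V 0 (x $ 2))"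
  unfolding test_function_def
proof (intro conjI exI allI)
  show "compact (closure {x::real^2. U 0 (x $ 1) * V 0 (x $ 2) \<noteq> 0})"
  proof (rule compact_closure[THEN iffD2])
    have "{x::real^2. U 0 (x $ 1) * V 0 (x $ 2) \<noteq> 0} \<subseteq> cbox a b"
    proof
      fix x :: "real^2" assume "x \<in> {x::real^2. U 0 (x $ 1) * V 0 (x $ 2) \<noteq> 0}"
      then have "x $ 1 \<in> {a $ 1..b $ 1}" "x $ 2 \<in> {a $ 2..b $ 2}" using U[of "x $ 1"] V[of "x $ 2"] by auto
      then show "x \<in> cbox a b" by (simp add: mem_box_cart forall_2)
    qed
    then show "bounded {x::real^2. U 0 (x $ 1) * V 0 (x $ 2) \<noteq> 0}" by (rule bounded_subset[OF bounded_cbox])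
  qed
  show "((\<lambda>i j x. U i (x $ 1) * V j (x $ 2)) i j has_derivative
     (\<lambda>h. h $ 1 * (\<lambda>i j x. U i (x $ 1) * V j (x $ 2)) (Suc i) j x + h $ 2 * (\<lambda>i j x. U i (x $ 1) * V j (x $ 2)) i (Suc j) x)) (at x)" for i j and x :: "real^2"
    using has_derivative_tensor[OF assms(1,2)] by simp
qed simp

section \<open>Weak gradients\<close>

text \<open>
  \<open>\<Psi>\<close> is the derivative of \<open>\<Phi>\<close>, with a uniform quadratic remainder. Cutting the interval into \<open>N\<close> pieces
  gives the bound \<open>M + C/N\<close>.
\<close>

lemma telescoping_derivative_bound:
  fixes \<Phi> \<Psi> :: "real \<Rightarrow> complex"
  assumes q: "\<And>t r. 0 \<le> t \<Longrightarrow> 0 < r \<Longrightarrow> t + r \<le> 1 \<Longrightarrow> norm (\<Phi> (t + r) - \<Phi> t - of_real r * \<Psi> t) \<le> C * r\<^sup>2"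
    and M: "\<And>t. 0 \<le> t \<Longrightarrow> t \<le> 1 \<Longrightarrow> norm (\<Psi> t) \<le> M"
  shows "norm (\<Phi> 1 - \<Phi> 0) \<le> M"
proof -
  have 1: "norm (\<Phi> 1 - \<Phi> 0) \<le> M + C * inverse (real (Suc m))" for m
  proof -
    define N where "N = Suc m"
    have N: "N > 0" by (simp add: N_def)
    have st: "norm (\<Phi> (real (Suc k) / N) - \<Phi> (real k / N)) \<le> M / N + C / N\<^sup>2" if "k < N" for k
    proof -
      have e: "real (Suc k) / N = real k / N + 1 / N" by (simp add: add_divide_distrib)
      have le1: "real k / N + 1 / N \<le> 1" using that N by (simp add: field_simps)
      have a: "norm (\<Phi> (real k / N + 1 / N) - \<Phi> (real k / N) - of_real (1/N) * \<Psi> (real k / N)) \<le> C * (1/N)\<^sup>2"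
        by (rule q) (use N le1 in auto)
      have kk: "real k / N \<le> 1" using that N by simp
      have b: "norm (of_real (1/N) * \<Psi> (real k / N)) \<le> (1/N) * M"
        unfolding norm_mult norm_of_real using M[of "real k / N"] kk N by (intro mult_mono) auto
      have "\<Phi> (real k / N + 1 / N) - \<Phi> (real k / N) =
        (\<Phi> (real k / N + 1 / N) - \<Phi> (real k / N) - of_real (1/N) * \<Psi> (real k / N)) + of_real (1/N) * \<Psi> (real k / N)" by simp
      then have "norm (\<Phi> (real k / N + 1 / N) - \<Phi> (real k / N)) \<le> C * (1/N)\<^sup>2 + (1/N) * M"
        using norm_triangle_le[OF add_mono[OF a b]] by metis
      then show ?thesis unfolding e by (simp add: power_divide)
    qed
    have "\<Phi> 1 - \<Phi> 0 = (\<Sum>k<N. \<Phi> (real (Suc k) / N) - \<Phi> (real k / N))"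
      using N by (subst sum_lessThan_telescope) auto
    also have "norm \<dots> \<le> (\<Sum>k<N. M / N + C / N\<^sup>2)" by (rule sum_norm_le) (use st in auto)
    also have "\<dots> = M + C * inverse (real N)" using N by (simp add: field_simps power2_eq_square)
    finally show ?thesis by (simp add: N_def)
  qed
  have "(\<lambda>m. M + C * inverse (real (Suc m))) \<longlonglongrightarrow> M + C * 0"
    by (intro tendsto_intros LIMSEQ_inverse_real_of_nat)
  then show ?thesis using 1 by (intro LIMSEQ_le_const[of _ M]) auto
qed

lemma integrable_cut:
  fixes g :: "real^2 \<Rightarrow> 'b::{banach,second_countable_topology}"
  assumes c: "continuous_on UNIV c" "\<And>y. \<bar>c y\<bar> \<le> M" "\<And>y. y \<notin> S \<Longrightarrow> c y = (0::real)"
    and g: "set_integrable lebesgue S g"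
  shows "integrable lebesgue (\<lambda>y. c y *\<^sub>R g y)"
proof (rule Bochner_Integration.integrable_bound[of _ "\<lambda>y. M *\<^sub>R (indicator S y *\<^sub>R g y)"])
  have ig: "integrable lebesgue (\<lambda>y. indicator S y *\<^sub>R g y)" using g by (simp add: set_integrable_def)
  then show "integrable lebesgue (\<lambda>y. M *\<^sub>R (indicator S y *\<^sub>R g y))" by (rule integrable_scaleR_right)
  have "c \<in> borel_measurable borel" using c(1) by (rule borel_measurable_continuous_onI)
  then have "c \<in> borel_measurable lebesgue" by (simp add: measurable_completion)
  then have "(\<lambda>y. c y *\<^sub>R (indicator S y *\<^sub>R g y)) \<in> borel_measurable lebesgue"
    by (rule borel_measurable_scaleR[OF _ borel_measurable_integrable[OF ig]])
  also have "(\<lambda>y. c y *\<^sub>R (indicator S y *\<^sub>R g y)) = (\<lambda>y. c y *\<^sub>R g y)"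
    using c(3) by (auto simp: indicator_def fun_eq_iff)
  finally show "(\<lambda>y. c y *\<^sub>R g y) \<in> borel_measurable lebesgue" .
  show "AE y in lebesgue. norm (c y *\<^sub>R g y) \<le> norm (M *\<^sub>R (indicator S y *\<^sub>R g y))"
  proof (rule AE_I2)
    fix y
    have "\<bar>c y\<bar> \<le> \<bar>M\<bar>" using c(2)[of y] by linarith
    from mult_right_mono[OF this, of "norm (g y)"]
    show "norm (c y *\<^sub>R g y) \<le> norm (M *\<^sub>R (indicator S y *\<^sub>R g y))"
      using c(3)[of y] by (cases "y \<in> S") auto
  qed
qed

lemma integral_lincomb:
  fixes p q :: "'a \<Rightarrow> 'b::{banach,second_countable_topology}"
  assumes "integrable M p" "integrable M q"
  shows "(LINT x|M. c *\<^sub>R p x + d *\<^sub>R q x) = c *\<^sub>R (LINT x|M. p x) + d *\<^sub>R (LINT x|M. q x)"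
  using assms by simp

lemma norm_combination_le:
  fixes w :: "complex^2" and v :: "real^2"
  shows "norm (v $ 1 *\<^sub>R w $ 1 + v $ 2 *\<^sub>R w $ 2) \<le> norm v * norm w"
proof (rule power2_le_imp_le)
  have nw: "(norm w)\<^sup>2 = (norm (w $ 1))\<^sup>2 + (norm (w $ 2))\<^sup>2"
    by (simp add: norm_vec_def L2_set_def UNIV_2)
  have "(norm (v $ 1 *\<^sub>R w $ 1 + v $ 2 *\<^sub>R w $ 2))\<^sup>2 \<le> (\<bar>v $ 1\<bar> * norm (w $ 1) + \<bar>v $ 2\<bar> * norm (w $ 2))\<^sup>2"
    by (intro power_mono order_trans[OF norm_triangle_ineq]) auto
  also have "\<dots> \<le> (norm v)\<^sup>2 * (norm w)\<^sup>2"
  proof -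
    have "(p * c + q * d)\<^sup>2 \<le> (p\<^sup>2 + q\<^sup>2) * (c\<^sup>2 + d\<^sup>2)" for p q c d :: real
    proof -
      have "(p\<^sup>2 + q\<^sup>2) * (c\<^sup>2 + d\<^sup>2) - (p * c + q * d)\<^sup>2 = (p * d - q * c)\<^sup>2" by (simp add: power2_eq_square algebra_simps)
      then show ?thesis by (metis diff_ge_0_iff_ge zero_le_power2)
    qed
    from this[of "\<bar>v $ 1\<bar>" "norm (w $ 1)" "\<bar>v $ 2\<bar>" "norm (w $ 2)"] show ?thesis
      by (simp add: nw norm_vec2)
  qed
  finally show "(norm (v $ 1 *\<^sub>R w $ 1 + v $ 2 *\<^sub>R w $ 2))\<^sup>2 \<le> (norm v * norm w)\<^sup>2" by (simp add: power_mult_distrib)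
qed simp

text \<open>
  Let the test function travel from its place to its translate by \<open>v\<close>. The derivative of the integral
  along the way is an integral of \<open>g\<close> against the derivative of a test function in direction \<open>v\<close>, which the
  weak gradient turns into an integral of \<open>G\<close>. So only values of \<open>G\<close> on the translates of the support enter.
  Translating the test function rather than \<open>g\<close> leaves \<open>g\<close> untouched.
\<close>

lemma tensor_translation_bound:
  fixes g :: "real^2 \<Rightarrow> complex" and G :: "real^2 \<Rightarrow> complex^2" and a b v :: "real^2"
  assumes wg: "has_weak_gradient g G"
    and U: "smooth_seq U" "\<And>n t. t \<notin> {a $ 1..b $ 1} \<Longrightarrow> U n t = 0" "\<And>t. 0 \<le> U 0 t" "\<And>t. U 0 t \<le> 1"
    and V: "smooth_seq V" "\<And>n t. t \<notin> {a $ 2..b $ 2} \<Longrightarrow> V n t = 0" "\<And>t. 0 \<le> V 0 t" "\<And>t. V 0 t \<le> 1"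
    and W: "0 \<le> W" and ab: "a $ 1 \<le> b $ 1" "a $ 2 \<le> b $ 2"
    and AE: "AE y in lebesgue. \<forall>t\<in>{0..1}. y - t *\<^sub>R v \<in> cbox a b \<longrightarrow> norm (G y) \<le> W"
  defines "\<phi> \<equiv> \<lambda>x. U 0 (x $ 1) * V 0 (x $ 2)"
  shows "norm ((LINT y|lebesgue. \<phi> (y - v) *\<^sub>R g y) - (LINT y|lebesgue. \<phi> y *\<^sub>R g y)) \<le> norm v * W * ((b $ 1 - a $ 1) * (b $ 2 - a $ 2))"
proof -
  define T where "T i j z = U i (z $ 1) * V j (z $ 2)" for i j and z :: "real^2"
  have \<phi>T: "\<phi> = T 0 0" by (simp add: \<phi>_def T_def fun_eq_iff)
  have Tz: "T i j z = 0" if "z \<notin> cbox a b" for i j z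
    using that U(2)[of "z $ 1" i] V(2)[of "z $ 2" j] by (auto simp: T_def mem_box_cart forall_2)
  have Tc: "continuous_on UNIV (\<lambda>y. T i j (y - c))" for i j c
    unfolding T_def
    by (intro continuous_intros continuous_on_compose2[OF smooth_seq_cont[OF U(1)]] continuous_on_compose2[OF smooth_seq_cont[OF V(1)]]) auto
  have "\<exists>M\<ge>0. \<forall>z. \<bar>T i j z\<bar> \<le> M" for i j
  proof -
    obtain M1 where M1: "M1 \<ge> 0" "\<And>t. \<bar>U i t\<bar> \<le> M1"
      using bounded_compact_support[OF smooth_seq_cont[OF U(1)] U(2)] by metis
    obtain M2 where M2: "M2 \<ge> 0" "\<And>t. \<bar>V j t\<bar> \<le> M2"
      using bounded_compact_support[OF smooth_seq_cont[OF V(1)] V(2)] by metis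
    have "\<bar>T i j z\<bar> \<le> M1 * M2" for z
      unfolding T_def abs_mult using M1 M2 by (intro mult_mono) auto
    then show ?thesis using M1 M2 by (intro exI[of _ "M1 * M2"]) auto
  qed
  then obtain MT where MT: "\<And>i j. MT i j \<ge> 0" "\<And>i j z. \<bar>T i j z\<bar> \<le> MT i j" by metis
  obtain R0 where R0: "\<And>z. z \<in> cbox a b \<Longrightarrow> norm z \<le> R0"
    using bounded_cbox[of a b] by (auto simp: bounded_iff)
  define S where "S = cball (0::real^2) (R0 + norm v)"
  have Sz: "T i j (y - t *\<^sub>R v) = 0" if "0 \<le> t" "t \<le> 1" "y \<notin> S" for i j t y
  proof (rule Tz)
    have "norm y \<le> norm (y - t *\<^sub>R v) + norm (t *\<^sub>R v)" by (metis diff_add_cancel norm_triangle_ineq)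
    moreover have "norm (t *\<^sub>R v) \<le> norm v" using that mult_right_mono[of t 1 "norm v"] by simp
    ultimately show "y - t *\<^sub>R v \<notin> cbox a b" using that R0[of "y - t *\<^sub>R v"] by (auto simp: S_def)
  qed
  have gS: "set_integrable lebesgue S g" and GS: "set_integrable lebesgue S G"
    using wg by (auto simp: has_weak_gradient_def S_def)
  have GSi: "set_integrable lebesgue S (\<lambda>y. G y $ i)" for i
    using integrable_bounded_linear[OF bounded_linear_vec_nth[of i] GS[unfolded set_integrable_def]]
    by (simp add: set_integrable_def)
  have iT: "integrable lebesgue (\<lambda>y. T i j (y - t *\<^sub>R v) *\<^sub>R g y)" if "0 \<le> t" "t \<le> 1" for i j t
    by (rule integrable_cut[OF Tc MT(2) Sz gS]) (use that in auto)
  have iTG: "integrable lebesgue (\<lambda>y. T i j (y - t *\<^sub>R v) *\<^sub>R (G y $ k))" if "0 \<le> t" "t \<le> 1" for i j t k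
    by (rule integrable_cut[OF Tc MT(2) Sz GSi]) (use that in auto)
  define \<Phi> where "\<Phi> t = (LINT y|lebesgue. T 0 0 (y - t *\<^sub>R v) *\<^sub>R g y)" for t
  define D where "D z = v $ 1 * T 1 0 z + v $ 2 * T 0 1 z" for z
  define \<Psi> where "\<Psi> t = - (LINT y|lebesgue. D (y - t *\<^sub>R v) *\<^sub>R g y)" for t
  define C where "C = (v $ 1)\<^sup>2 * MT 2 0 + 2 * \<bar>v $ 1 * v $ 2\<bar> * MT 1 1 + (v $ 2)\<^sup>2 * MT 0 2"
  have C0: "0 \<le> C" unfolding C_def using MT(1) by (intro add_nonneg_nonneg mult_nonneg_nonneg) auto
  have iD: "integrable lebesgue (\<lambda>y. D (y - t *\<^sub>R v) *\<^sub>R g y)" if "0 \<le> t" "t \<le> 1" for t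
  proof -
    have "integrable lebesgue (\<lambda>y. v $ 1 *\<^sub>R (T 1 0 (y - t *\<^sub>R v) *\<^sub>R g y) + v $ 2 *\<^sub>R (T 0 1 (y - t *\<^sub>R v) *\<^sub>R g y))"
      using iT[OF that] by (intro Bochner_Integration.integrable_add integrable_scaleR_right)
    then show ?thesis by (simp add: D_def scaleR_add_left)
  qed
  \<comment> \<open>A bound for the second order remainder that is uniform in \<open>z\<close> replaces differentiation under the
    integral sign.\<close>
  have taylor: "\<bar>T 0 0 (z - r *\<^sub>R v) - T 0 0 z + r * D z\<bar> \<le> C * r\<^sup>2" if r: "0 < r" for z r
  proof -
    define E where "E z = (v $ 1)\<^sup>2 * T 2 0 z + 2 * (v $ 1 * v $ 2) * T 1 1 z + (v $ 2)\<^sup>2 * T 0 2 z" for z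
    define df where "df m t = (if m = 0 then T 0 0 (z - t *\<^sub>R v) else if m = 1 then - D (z - t *\<^sub>R v) else E (z - t *\<^sub>R v))" for m :: nat and t
    have dU: "((\<lambda>t. U i ((z - t *\<^sub>R v) $ 1)) has_real_derivative - (v $ 1) * U (Suc i) ((z - t *\<^sub>R v) $ 1)) (at t)" for i t
      using smooth_seq_line_derivative[OF U(1)] by simp
    have dV: "((\<lambda>t. V i ((z - t *\<^sub>R v) $ 2)) has_real_derivative - (v $ 2) * V (Suc i) ((z - t *\<^sub>R v) $ 2)) (at t)" for i t
      using smooth_seq_line_derivative[OF V(1)] by simp
    have dT: "((\<lambda>t. T i j (z - t *\<^sub>R v)) has_real_derivative - (v $ 1) * T (Suc i) j (z - t *\<^sub>R v) - v $ 2 * T i (Suc j) (z - t *\<^sub>R v)) (at t)" for i j t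
      unfolding T_def by (rule DERIV_cong[OF DERIV_mult[OF dU dV]]) (simp add: algebra_simps)
    have "\<exists>t>0. t < r \<and> df 0 r = (\<Sum>m<2. df m 0 / fact m * r ^ m) + df 2 t / fact 2 * r ^ 2"
    proof (rule Maclaurin[OF r _ refl])
      show "\<forall>m t. m < 2 \<and> 0 \<le> t \<and> t \<le> r \<longrightarrow> (df m has_real_derivative df (Suc m) t) (at t)"
      proof (intro allI impI)
        fix m t assume "m < (2::nat) \<and> 0 \<le> t \<and> t \<le> r"
        then consider "m = 0" | "m = 1" by linarith
        then show "(df m has_real_derivative df (Suc m) t) (at t)"
        proof cases
          case 1 then show ?thesis using dT[of 0 0 t] by (simp add: df_def[abs_def] D_def)
        next
          case 2
          have "((\<lambda>t. - D (z - t *\<^sub>R v)) has_real_derivative E (z - t *\<^sub>R v)) (at t)"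
            unfolding D_def E_def
            by (rule DERIV_cong[OF DERIV_minus[OF DERIV_add[OF DERIV_cmult[OF dT] DERIV_cmult[OF dT]]]])
               (simp add: power2_eq_square algebra_simps numeral_2_eq_2)
          then show ?thesis using 2 by (simp add: df_def[abs_def])
        qed
      qed
    qed simp
    then obtain t where t: "df 0 r = (\<Sum>m<2. df m 0 / fact m * r ^ m) + df 2 t / fact 2 * r ^ 2" by blast
    have "T 0 0 (z - r *\<^sub>R v) - T 0 0 z + r * D z = E (z - t *\<^sub>R v) / 2 * r\<^sup>2"
      using t by (simp add: df_def numeral_2_eq_2)
    moreover have "\<bar>E z\<bar> \<le> C" for z
    proof -
      have "\<bar>E z\<bar> \<le> \<bar>(v $ 1)\<^sup>2 * T 2 0 z\<bar> + \<bar>2 * (v $ 1 * v $ 2) * T 1 1 z\<bar> + \<bar>(v $ 2)\<^sup>2 * T 0 2 z\<bar>"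
        unfolding E_def by linarith
      also have "\<dots> \<le> C" unfolding C_def abs_mult using MT(2)
        by (intro add_mono mult_mono) auto
      finally show ?thesis .
    qed
    then have "\<bar>E (z - t *\<^sub>R v)\<bar> \<le> C" .
    then have "\<bar>E (z - t *\<^sub>R v) / 2\<bar> \<le> C" using C0 by simp
    then have "\<bar>E (z - t *\<^sub>R v) / 2 * r\<^sup>2\<bar> \<le> C * r\<^sup>2"
      unfolding abs_mult[of "_ / 2"] using C0 by (intro mult_mono) auto
    ultimately show ?thesis by simp
  qed
  have step: "norm (\<Phi> (t + r) - \<Phi> t - of_real r * \<Psi> t) \<le> (C * (LINT y|lebesgue. norm (indicator S y *\<^sub>R g y))) * r\<^sup>2"
    if t: "0 \<le> t" "0 < r" "t + r \<le> 1" for t r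
  proof -
    let ?X = "\<lambda>y. T 0 0 (y - t *\<^sub>R v - r *\<^sub>R v) - T 0 0 (y - t *\<^sub>R v) + r * D (y - t *\<^sub>R v)"
    have "\<Phi> (t + r) - \<Phi> t - of_real r * \<Psi> t = (LINT y|lebesgue. T 0 0 (y - (t + r) *\<^sub>R v) *\<^sub>R g y - T 0 0 (y - t *\<^sub>R v) *\<^sub>R g y + r *\<^sub>R (D (y - t *\<^sub>R v) *\<^sub>R g y))"
      unfolding \<Phi>_def \<Psi>_def using t iT[of t] iT[of "t + r"] iD[of t]
      by (simp add: scaleR_conv_of_real)
    also have "\<dots> = (LINT y|lebesgue. ?X y *\<^sub>R g y)"
      by (intro Bochner_Integration.integral_cong refl) (simp add: algebra_simps)
    finally have e: "\<Phi> (t + r) - \<Phi> t - of_real r * \<Psi> t = (LINT y|lebesgue. ?X y *\<^sub>R g y)" .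
    have bd: "norm (?X y *\<^sub>R g y) \<le> (C * r\<^sup>2) * norm (indicator S y *\<^sub>R g y)" for y
    proof (cases "y \<in> S")
      case True
      then show ?thesis using taylor[OF t(2), of "y - t *\<^sub>R v"] by (auto intro!: mult_right_mono)
    next
      case False
      have e: "y - t *\<^sub>R v - r *\<^sub>R v = y - (t + r) *\<^sub>R v" by (simp add: algebra_simps)
      have z: "T i j (y - t *\<^sub>R v) = 0" "T i j (y - (t + r) *\<^sub>R v) = 0" for i j
        using False Sz[of t y] Sz[of "t + r" y] t by auto
      show ?thesis using C0 unfolding e D_def z by simp
    qed
    have "norm (LINT y|lebesgue. ?X y *\<^sub>R g y) \<le> (LINT y|lebesgue. (C * r\<^sup>2) * norm (indicator S y *\<^sub>R g y))"
    proof (rule Bochner_Integration.integral_norm_bound_integral)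
      have "integrable lebesgue (\<lambda>y. T 0 0 (y - (t + r) *\<^sub>R v) *\<^sub>R g y - T 0 0 (y - t *\<^sub>R v) *\<^sub>R g y + r *\<^sub>R (D (y - t *\<^sub>R v) *\<^sub>R g y))"
        using t by (intro Bochner_Integration.integrable_add Bochner_Integration.integrable_diff integrable_scaleR_right iT iD) auto
      then show "integrable lebesgue (\<lambda>y. ?X y *\<^sub>R g y)"
        by (rule Bochner_Integration.integrable_cong[THEN iffD1, rotated 2]) (auto simp: algebra_simps)
    qed (use bd gS in \<open>auto simp: set_integrable_def simp del: norm_scaleR\<close>)
    then show ?thesis unfolding e integral_mult_right_zero by (simp only: mult_ac)
  qed
  have \<Psi>b: "norm (\<Psi> t) \<le> norm v * W * ((b $ 1 - a $ 1) * (b $ 2 - a $ 2))" if t: "0 \<le> t" "t \<le> 1" for t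
  proof -
    let ?U = "\<lambda>n \<tau>. 1 ^ n * U n (1 * \<tau> + (- t * v $ 1))" and ?V = "\<lambda>n \<tau>. 1 ^ n * V n (1 * \<tau> + (- t * v $ 2))"
    have sU: "smooth_seq ?U" and sV: "smooth_seq ?V" by (intro smooth_seq_affine U(1) V(1))+
    define \<phi>t where "\<phi>t = (\<lambda>x::real^2. ?U 0 (x $ 1) * ?V 0 (x $ 2))"
    have T': "?U i (y $ 1) * ?V j (y $ 2) = T i j (y - t *\<^sub>R v)" for i j and y :: "real^2" by (simp add: T_def)
    have \<phi>t_eq: "\<phi>t = (\<lambda>x. T 0 0 (x - t *\<^sub>R v))" unfolding \<phi>t_def T' ..
    have tf: "test_function \<phi>t"
      unfolding \<phi>t_def
      by (rule test_function_tensor[OF sU sV, where a = "a + t *\<^sub>R v" and b = "b + t *\<^sub>R v"]) (auto intro!: U(2) V(2))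
    have fd: "frechet_derivative \<phi>t (at y) h = h $ 1 * T 1 0 (y - t *\<^sub>R v) + h $ 2 * T 0 1 (y - t *\<^sub>R v)" for y h
      using frechet_derivative_at[OF has_derivative_tensor[OF sU sV, of 0 0 y], symmetric]
      unfolding \<phi>t_eq T' by simp
    have w: "(LINT x|lebesgue. frechet_derivative \<phi>t (at x) (axis i 1) *\<^sub>R g x) = - (LINT x|lebesgue. \<phi>t x *\<^sub>R (G x $ i))" for i
      using wg tf by (auto simp: has_weak_gradient_def)
    have w1: "(LINT x|lebesgue. T 1 0 (x - t *\<^sub>R v) *\<^sub>R g x) = - (LINT x|lebesgue. T 0 0 (x - t *\<^sub>R v) *\<^sub>R (G x $ 1))"
      using w[of 1] unfolding fd unfolding \<phi>t_eq by (simp add: axis_def)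
    have w2: "(LINT x|lebesgue. T 0 1 (x - t *\<^sub>R v) *\<^sub>R g x) = - (LINT x|lebesgue. T 0 0 (x - t *\<^sub>R v) *\<^sub>R (G x $ 2))"
      using w[of 2] unfolding fd unfolding \<phi>t_eq by (simp add: axis_def)
    have "\<Psi> t = - (v $ 1 *\<^sub>R (LINT x|lebesgue. T 1 0 (x - t *\<^sub>R v) *\<^sub>R g x) + v $ 2 *\<^sub>R (LINT x|lebesgue. T 0 1 (x - t *\<^sub>R v) *\<^sub>R g x))"
    proof -
      have "(LINT x|lebesgue. D (x - t *\<^sub>R v) *\<^sub>R g x) = (LINT x|lebesgue. v $ 1 *\<^sub>R (T 1 0 (x - t *\<^sub>R v) *\<^sub>R g x) + v $ 2 *\<^sub>R (T 0 1 (x - t *\<^sub>R v) *\<^sub>R g x))"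
        by (simp add: D_def scaleR_add_left)
      then show ?thesis unfolding \<Psi>_def integral_lincomb[OF iT[OF t] iT[OF t]] by simp
    qed
    also have "\<dots> = (LINT x|lebesgue. v $ 1 *\<^sub>R (T 0 0 (x - t *\<^sub>R v) *\<^sub>R (G x $ 1)) + v $ 2 *\<^sub>R (T 0 0 (x - t *\<^sub>R v) *\<^sub>R (G x $ 2)))"
      unfolding w1 w2 integral_lincomb[OF iTG[OF t] iTG[OF t]] by simp
    also have "\<dots> = (LINT x|lebesgue. T 0 0 (x - t *\<^sub>R v) *\<^sub>R (v $ 1 *\<^sub>R G x $ 1 + v $ 2 *\<^sub>R G x $ 2))"
      by (intro Bochner_Integration.integral_cong refl) (simp add: algebra_simps)
    finally have e: "\<Psi> t = (LINT x|lebesgue. T 0 0 (x - t *\<^sub>R v) *\<^sub>R (v $ 1 *\<^sub>R G x $ 1 + v $ 2 *\<^sub>R G x $ 2))" .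
    let ?Q = "cbox (a + t *\<^sub>R v) (b + t *\<^sub>R v)"
    have Qm: "measure lebesgue ?Q = (b $ 1 - a $ 1) * (b $ 2 - a $ 2)"
    proof -
      have "?Q \<noteq> {}" using ab by (auto simp: interval_ne_empty_cart forall_2)
      then show ?thesis by (simp add: content_cbox_cart prod.insert UNIV_2)
    qed
    have iQ: "integrable lebesgue (\<lambda>x. (norm v * W) * indicator ?Q x)"
      by (intro integrable_mult_right integrable_real_indicator) (use emeasure_lborel_cbox_finite[of "a + t *\<^sub>R v" "b + t *\<^sub>R v"] in auto)
    have iT2: "integrable lebesgue (\<lambda>x. T 0 0 (x - t *\<^sub>R v) *\<^sub>R (v $ 1 *\<^sub>R G x $ 1 + v $ 2 *\<^sub>R G x $ 2))"
    proof -
      have "integrable lebesgue (\<lambda>x. v $ 1 *\<^sub>R (T 0 0 (x - t *\<^sub>R v) *\<^sub>R (G x $ 1)) + v $ 2 *\<^sub>R (T 0 0 (x - t *\<^sub>R v) *\<^sub>R (G x $ 2)))"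
        by (intro Bochner_Integration.integrable_add integrable_scaleR_right iTG t)
      then show ?thesis by (simp add: scaleR_add_right mult.commute)
    qed
    have "norm (\<Psi> t) \<le> (LINT x|lebesgue. norm (T 0 0 (x - t *\<^sub>R v) *\<^sub>R (v $ 1 *\<^sub>R G x $ 1 + v $ 2 *\<^sub>R G x $ 2)))"
      unfolding e by (rule integral_norm_bound)
    also have "\<dots> \<le> (LINT x|lebesgue. (norm v * W) * indicator ?Q x)"
    proof (rule integral_mono_AE[OF integrable_norm[OF iT2] iQ])
      show "AE x in lebesgue. norm (T 0 0 (x - t *\<^sub>R v) *\<^sub>R (v $ 1 *\<^sub>R G x $ 1 + v $ 2 *\<^sub>R G x $ 2)) \<le> (norm v * W) * indicator ?Q x"
        using AE
      proof eventually_elim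
        fix x assume x: "\<forall>t\<in>{0..1}. x - t *\<^sub>R v \<in> cbox a b \<longrightarrow> norm (G x) \<le> W"
        show "norm (T 0 0 (x - t *\<^sub>R v) *\<^sub>R (v $ 1 *\<^sub>R G x $ 1 + v $ 2 *\<^sub>R G x $ 2)) \<le> (norm v * W) * indicator ?Q x"
        proof (cases "x - t *\<^sub>R v \<in> cbox a b")
          case True
          then have xQ: "x \<in> ?Q" by (auto simp: mem_box_cart algebra_simps)
          have T01: "\<bar>T 0 0 z\<bar> \<le> 1" for z unfolding T_def using U V by (simp add: mult_le_one)
          have "norm (T 0 0 (x - t *\<^sub>R v) *\<^sub>R (v $ 1 *\<^sub>R G x $ 1 + v $ 2 *\<^sub>R G x $ 2)) \<le> 1 * (norm v * norm (G x))"
            unfolding norm_scaleR by (intro mult_mono T01 norm_combination_le) auto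
          also have "\<dots> \<le> norm v * W"
          proof -
            have "norm (G x) \<le> W" using x True t by auto
            then show ?thesis by (simp add: mult_left_mono)
          qed
          finally show ?thesis using xQ by simp
        next
          case False
          then show ?thesis using Tz W by simp
        qed
      qed
    qed
    also have "\<dots> = (norm v * W) * measure lebesgue ?Q" by simp
    finally show ?thesis unfolding Qm .
  qed
  have "norm (\<Phi> 1 - \<Phi> 0) \<le> norm v * W * ((b $ 1 - a $ 1) * (b $ 2 - a $ 2))"
    by (rule telescoping_derivative_bound[OF step \<Psi>b])
  then show ?thesis by (simp add: \<Phi>_def \<phi>T)
qed

text \<open>
  Take the test functions to be products of two plateaus and pass to the limit by dominated convergence.
\<close>

lemma box_translation_bound:
  fixes g :: "real^2 \<Rightarrow> complex" and G :: "real^2 \<Rightarrow> complex^2" and a b v :: "real^2"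
  assumes wg: "has_weak_gradient g G"
    and W: "0 \<le> W" and ab: "a $ 1 \<le> b $ 1" "a $ 2 \<le> b $ 2"
    and AE: "AE y in lebesgue. \<forall>t\<in>{0..1}. y - t *\<^sub>R v \<in> cbox a b \<longrightarrow> norm (G y) \<le> W"
  shows "norm (integral (cbox (a + v) (b + v)) g - integral (cbox a b) g) \<le> norm v * W * ((b $ 1 - a $ 1) * (b $ 2 - a $ 2))"
proof -
  define \<phi> where "\<phi> m x = plateau (a $ 1) (b $ 1) m 0 (x $ 1) * plateau (a $ 2) (b $ 2) m 0 (x $ 2)" for m and x :: "real^2"
  have lim: "(\<lambda>m. LINT y|lebesgue. \<phi> m (y - w) *\<^sub>R g y) \<longlonglongrightarrow> integral (cbox (a + w) (b + w)) g" for w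
  proof -
    let ?S = "cbox (a + w) (b + w)" and ?B = "box (a + w) (b + w)"
    have gS: "set_integrable lebesgue ?S g" using wg by (auto simp: has_weak_gradient_def)
    then have gB: "set_integrable lebesgue ?B g"
      by (rule set_integrable_subset) (auto simp: box_subset_cbox)
    have \<phi>c: "continuous_on UNIV (\<lambda>y. \<phi> m (y - w))" for m
      unfolding \<phi>_def
      by (intro continuous_intros continuous_on_compose2[OF smooth_seq_cont[OF smooth_seq_plateau]]) auto
    have \<phi>1: "\<bar>\<phi> m x\<bar> \<le> 1" for m x
      unfolding \<phi>_def abs_mult using plateau_bounds by (simp add: mult_le_one)
    have \<phi>0: "\<phi> m (y - w) = 0" if "y \<notin> ?S" for m y
    proof -
      have "\<not> (a $ 1 \<le> (y - w) $ 1 \<and> (y - w) $ 1 \<le> b $ 1 \<and> a $ 2 \<le> (y - w) $ 2 \<and> (y - w) $ 2 \<le> b $ 2)"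
        using that by (auto simp: mem_box_cart forall_2 algebra_simps)
      then show ?thesis using plateau_eq_0[of "(y - w) $ 1" "a $ 1" "b $ 1" m 0] plateau_eq_0[of "(y - w) $ 2" "a $ 2" "b $ 2" m 0] by (auto simp: \<phi>_def)
    qed
    have i\<phi>: "integrable lebesgue (\<lambda>y. \<phi> m (y - w) *\<^sub>R g y)" for m
      by (rule integrable_cut[OF \<phi>c \<phi>1 \<phi>0 gS])
    have "(\<lambda>m. LINT y|lebesgue. \<phi> m (y - w) *\<^sub>R g y) \<longlonglongrightarrow> (LINT y|lebesgue. indicator ?B y *\<^sub>R g y)"
    proof (rule integral_dominated_convergence[where w = "\<lambda>y. norm (indicator ?S y *\<^sub>R g y)"])
      show "(\<lambda>y. indicator ?B y *\<^sub>R g y) \<in> borel_measurable lebesgue"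
        using gB unfolding set_integrable_def by (rule borel_measurable_integrable)
      show "(\<lambda>y. \<phi> m (y - w) *\<^sub>R g y) \<in> borel_measurable lebesgue" for m
        using i\<phi> by (rule borel_measurable_integrable)
      show "integrable lebesgue (\<lambda>y. norm (indicator ?S y *\<^sub>R g y))"
        using gS unfolding set_integrable_def by (rule integrable_norm)
      have "(\<lambda>m. \<phi> m (y - w)) \<longlonglongrightarrow> indicator ?B y" for y
      proof -
        have "(\<lambda>m. \<phi> m (y - w)) \<longlonglongrightarrow> indicator {a $ 1<..<b $ 1} ((y - w) $ 1) * indicator {a $ 2<..<b $ 2} ((y - w) $ 2)"
          unfolding \<phi>_def by (intro tendsto_mult plateau_tendsto)
        also have "indicator {a $ 1<..<b $ 1} ((y - w) $ 1) * indicator {a $ 2<..<b $ 2} ((y - w) $ 2) = (indicator ?B y :: real)"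
          by (auto simp: indicator_def mem_box_cart forall_2 algebra_simps)
        finally show ?thesis .
      qed
      then show "AE y in lebesgue. (\<lambda>m. \<phi> m (y - w) *\<^sub>R g y) \<longlonglongrightarrow> indicator ?B y *\<^sub>R g y"
        by (intro AE_I2 tendsto_scaleR tendsto_const)
      show "AE y in lebesgue. norm (\<phi> m (y - w) *\<^sub>R g y) \<le> norm (indicator ?S y *\<^sub>R g y)" for m
      proof (rule AE_I2)
        fix y
        show "norm (\<phi> m (y - w) *\<^sub>R g y) \<le> norm (indicator ?S y *\<^sub>R g y)"
        proof (cases "y \<in> ?S")
          case True
          then show ?thesis using mult_right_mono[OF \<phi>1[of m "y - w"] norm_ge_zero[of "g y"]] by simp
        next
          case False
          then show ?thesis using \<phi>0[OF False] by simp
        qed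
      qed
    qed
    also have "(LINT y|lebesgue. indicator ?B y *\<^sub>R g y) = integral ?B g"
      using set_lebesgue_integral_eq_integral(2)[OF gB] by (simp add: set_lebesgue_integral_def)
    also have "\<dots> = integral ?S g" by (rule integral_open_interval)
    finally show ?thesis .
  qed
  have bd: "norm ((LINT y|lebesgue. \<phi> m (y - v) *\<^sub>R g y) - (LINT y|lebesgue. \<phi> m (y - 0) *\<^sub>R g y)) \<le> norm v * W * ((b $ 1 - a $ 1) * (b $ 2 - a $ 2))" for m
    unfolding \<phi>_def diff_zero
    by (rule tensor_translation_bound[where U = "plateau (a $ 1) (b $ 1) m" and V = "plateau (a $ 2) (b $ 2) m",
          OF wg smooth_seq_plateau _ plateau_bounds smooth_seq_plateau _ plateau_bounds W ab AE])
       (auto simp: plateau_eq_0)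
  have "(\<lambda>m. norm ((LINT y|lebesgue. \<phi> m (y - v) *\<^sub>R g y) - (LINT y|lebesgue. \<phi> m (y - 0) *\<^sub>R g y))) \<longlonglongrightarrow>
     norm (integral (cbox (a + v) (b + v)) g - integral (cbox (a + 0) (b + 0)) g)"
    by (intro tendsto_norm tendsto_diff lim)
  then show ?thesis using bd LIMSEQ_le_const2 by (metis (no_types, lifting) add.right_neutral)
qed

lemma AE_imp_negligible: "AE x in lebesgue. P x \<Longrightarrow> negligible {x. \<not> P x}"
  by (simp add: negligible_iff_null_sets eventually_ae_filter)
     (metis (mono_tags, lifting) null_sets_completion_subset)

text \<open>
  At a Lebesgue point \<open>x\<close> the value of \<open>g\<close> is the limit of its averages over small boxes at \<open>x\<close>. By
  \<open>box_translation_bound\<close> the averages at \<open>x\<close> and \<open>x + v\<close> differ by at most \<open>\<bar>v\<bar>\<close> times the supremum of \<open>\<bar>G\<bar>\<close> near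
  the segment between them. So \<open>g\<close> is Lipschitz on a set of full measure, which is dense, and extends
  from there; the weighted bounds survive the limit because the weight is continuous.
\<close>

lemma weak_gradient_continuous_rep:
  fixes g :: "real^2 \<Rightarrow> complex" and G :: "real^2 \<Rightarrow> complex^2"
  assumes wg: "has_weak_gradient g G" and s: "0 \<le> s" and B: "0 \<le> B"
    and gB: "AE x in lebesgue. norm (g x) \<le> B * wt s x"
    and GB: "AE x in lebesgue. norm (G x) \<le> B * wt s x"
  obtains h where "continuous_on UNIV h" "AE x in lebesgue. h x = g x"
    "\<And>x. norm (h x) \<le> B * wt s x"
    "\<And>x y. norm (x - y) \<le> 1 \<Longrightarrow> norm (h x - h y) \<le> 4 powr s * B * norm (x - y) * wt s x"
proof -
  have intg: "g integrable_on cbox a b" for a b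
    using wg set_lebesgue_integral_eq_integral(1)[of "cbox a b" g] by (auto simp: has_weak_gradient_def)
  obtain N where N: "negligible N" and avg: "\<And>x e. x \<notin> N \<Longrightarrow> 0 < e \<Longrightarrow>
      \<exists>d>0. \<forall>r. 0 < r \<and> r < d \<longrightarrow> norm (integral (cbox x (x + r *\<^sub>R One)) g /\<^sub>R r ^ DIM(real^2) - g x) < e"
    using integrable_ccontinuous_explicit[of g, OF intg] by blast
  have One: "(One :: real^2) $ i = 1" for i
  proof -
    have "One \<bullet> axis i (1::real) = 1" by (simp add: inner_sum_left inner_Basis axis_in_Basis_iff)
    then show ?thesis by (simp add: inner_axis)
  qed
  have DIM: "DIM(real^2) = 2" by simp
  define X where "X = {x. x \<notin> N \<and> norm (g x) \<le> B * wt s x}"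
  have AEX: "AE x in lebesgue. x \<in> X"
  proof -
    have "AE x in lebesgue. x \<notin> N" using N by (simp add: negligible_iff_null_sets AE_not_in)
    with gB show ?thesis by eventually_elim (simp add: X_def)
  qed
  \<comment> \<open>Allowing \<open>norm v \<le> 2\<close> here, and not only \<open>norm v \<le> 1\<close>, leaves room for approximating two points at
    distance \<open>1\<close> by points of \<open>X\<close>. The constant \<open>4 powr s\<close> still suffices, as
    \<open>\<bar>y - x\<bar> \<le> 5/2\<close> gives \<open>2 * (1 + \<bar>y - x\<bar>\<^sup>2) \<le> 4\<^sup>2\<close>.\<close>
  have lip: "norm (g (x + v) - g x) \<le> norm v * (B * (4 powr s * wt s x))" if x: "x \<notin> N" "x + v \<notin> N" and v: "norm v \<le> 2" for x v
  proof (rule field_le_epsilon)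
    fix e :: real assume e: "e > 0"
    define W where "W = B * (4 powr s * wt s x)"
    have W: "0 \<le> W" using B wt_pos[of s x] by (simp add: W_def)
    obtain d1 where d1: "d1 > 0" "\<And>r. 0 < r \<Longrightarrow> r < d1 \<Longrightarrow> norm (integral (cbox x (x + r *\<^sub>R One)) g /\<^sub>R r\<^sup>2 - g x) < e/2"
      using avg[OF x(1), of "e/2"] e unfolding DIM by auto
    obtain d2 where d2: "d2 > 0" "\<And>r. 0 < r \<Longrightarrow> r < d2 \<Longrightarrow> norm (integral (cbox (x+v) (x + v + r *\<^sub>R One)) g /\<^sub>R r\<^sup>2 - g (x+v)) < e/2"
      using avg[OF x(2), of "e/2"] e unfolding DIM by auto
    define r where "r = min (min d1 d2) (1/4) / 2"
    have r: "0 < r" "r < d1" "r < d2" "r \<le> 1/4" using d1(1) d2(1) by (auto simp: r_def min_def)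
    let ?b = "x + r *\<^sub>R (One :: real^2)"
    have b: "?b $ i = x $ i + r" for i
      by (simp only: vector_add_component vector_scaleR_component One mult_1_right real_scaleR_def)
    have eqb: "?b + v = x + v + r *\<^sub>R One" by (simp add: algebra_simps)
    have near: "wt s y \<le> 4 powr s * wt s x" if t: "t \<in> {0..1}" and y: "y - t *\<^sub>R v \<in> cbox x ?b" for t y
    proof -
      define z where "z = y - t *\<^sub>R v - x"
      have "x $ i \<le> (y - t *\<^sub>R v) $ i" "(y - t *\<^sub>R v) $ i \<le> x $ i + r" for i
        using y unfolding mem_box_cart b by auto
      then have zr: "\<bar>z $ i\<bar> \<le> r" for i by (simp add: z_def abs_le_iff algebra_simps)
      have "norm z \<le> r + r" using norm_le_l1_cart[of z] zr[of 1] zr[of 2] by (simp add: UNIV_2)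
      moreover have "norm (t *\<^sub>R v) \<le> 2" using t v mult_mono[of t 1 "norm v" 2] by simp
      moreover have "y - x = z + t *\<^sub>R v" by (simp add: z_def)
      ultimately have n: "norm (y - x) \<le> 5/2" using norm_triangle_ineq[of z "t *\<^sub>R v"] r by simp
      have "(japanese (y - x))\<^sup>2 \<le> 8" unfolding japanese_sq using power_mono[OF n, of 2] by (simp add: power2_eq_square)
      then have "(sqrt 2 * japanese (y - x))\<^sup>2 \<le> 4\<^sup>2" by (simp add: power_mult_distrib)
      then have le4: "sqrt 2 * japanese (y - x) \<le> 4" by (rule power2_le_imp_le) simp
      have "wt s y \<le> (sqrt 2 * japanese (y - x)) powr s * wt s x" using wt_shift[OF s, of x "y - x"] by simp
      also have "\<dots> \<le> 4 powr s * wt s x"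
        using le4 s japanese_pos[of "y - x"] wt_pos[of s x] by (intro mult_right_mono powr_mono2) auto
      finally show ?thesis .
    qed
    have "AE y in lebesgue. \<forall>t\<in>{0..1}. y - t *\<^sub>R v \<in> cbox x ?b \<longrightarrow> norm (G y) \<le> W"
      using GB
    proof eventually_elim
      fix y assume y: "norm (G y) \<le> B * wt s y"
      show "\<forall>t\<in>{0..1}. y - t *\<^sub>R v \<in> cbox x ?b \<longrightarrow> norm (G y) \<le> W"
        using order_trans[OF y mult_left_mono[OF near B]] by (auto simp: W_def)
    qed
    moreover have "x $ 1 \<le> ?b $ 1" "x $ 2 \<le> ?b $ 2" "(?b $ 1 - x $ 1) * (?b $ 2 - x $ 2) = r\<^sup>2"
      unfolding b using r(1) by (simp_all add: power2_eq_square)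
    ultimately have "norm (integral (cbox (x + v) (?b + v)) g - integral (cbox x ?b) g) \<le> norm v * W * r\<^sup>2"
      using box_translation_bound[OF wg W, of x ?b v] by metis
    then have "norm (integral (cbox (x + v) (x + v + r *\<^sub>R One)) g - integral (cbox x ?b) g) / r\<^sup>2 \<le> norm v * W"
      using r(1) unfolding eqb by (simp add: divide_le_eq)
    also have "norm (integral (cbox (x + v) (x + v + r *\<^sub>R One)) g - integral (cbox x ?b) g) / r\<^sup>2
       = norm (integral (cbox (x + v) (x + v + r *\<^sub>R One)) g /\<^sub>R r\<^sup>2 - integral (cbox x ?b) g /\<^sub>R r\<^sup>2)"
      by (simp flip: scaleR_diff_right add: divide_inverse)
    finally have m: "norm (integral (cbox (x + v) (x + v + r *\<^sub>R One)) g /\<^sub>R r\<^sup>2 - integral (cbox x ?b) g /\<^sub>R r\<^sup>2) \<le> norm v * W" .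
    define p where "p = integral (cbox (x + v) (x + v + r *\<^sub>R One)) g /\<^sub>R r\<^sup>2"
    define q where "q = integral (cbox x ?b) g /\<^sub>R r\<^sup>2"
    have 1: "norm (q - g x) < e/2" "norm (p - g (x + v)) < e/2" "norm (p - q) \<le> norm v * W"
      using d1(2)[of r] d2(2)[of r] r m by (auto simp: p_def q_def)
    have "norm (g (x + v) - g x) \<le> norm (p - g (x + v)) + norm (p - q) + norm (q - g x)"
      using norm_triangle_ineq[of "(g (x + v) - p) + (p - q)" "q - g x"] norm_triangle_ineq[of "g (x + v) - p" "p - q"]
      by (simp add: norm_minus_commute)
    then show "norm (g (x + v) - g x) \<le> norm v * (B * (4 powr s * wt s x)) + e"
      using 1 by (simp add: W_def)
  qed
  have e4: "(1::real) \<le> 4 powr s" using s by (simp add: ge_one_powr_ge_zero)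
  have "(2 * B * 4 powr s)-lipschitz_on X g"
  proof (rule lipschitz_onI)
    fix x y assume xy: "x \<in> X" "y \<in> X"
    show "dist (g x) (g y) \<le> 2 * B * 4 powr s * dist x y"
    proof (cases "norm (x - y) \<le> 1")
      case True
      then have "norm (g x - g y) \<le> norm (x - y) * (B * (4 powr s * wt s y))"
        using lip[of y "x - y"] xy by (simp add: X_def)
      also have "\<dots> \<le> norm (x - y) * (B * (4 powr s * 2))"
        using B wt_le_1[OF s, of y] by (intro mult_left_mono) auto
      finally show ?thesis by (simp add: dist_norm mult_ac)
    next
      case False
      have "norm (g x) \<le> B" "norm (g y) \<le> B"
        using xy mult_left_mono[OF wt_le_1[OF s, of x] B] mult_left_mono[OF wt_le_1[OF s, of y] B] by (auto simp: X_def)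
      then have "norm (g x - g y) \<le> 2 * B * 1 * 1" using norm_triangle_ineq4[of "g x" "g y"] by simp
      also have "\<dots> \<le> 2 * B * 4 powr s * norm (x - y)" using B e4 False by (intro mult_mono) auto
      finally show ?thesis by (simp add: dist_norm)
    qed
  qed (use B in simp)
  from lipschitz_extend_closure[OF this] obtain h where
    h: "(2 * B * 4 powr s)-lipschitz_on (closure X) h" "\<And>x. x \<in> X \<Longrightarrow> h x = g x" by blast
  have clX: "closure X = UNIV"
  proof -
    have "negligible (- X)" using AE_imp_negligible[OF AEX] by (simp add: Compl_eq)
    then have "interior (- X) = {}"
      using open_not_negligible[OF open_interior] negligible_subset[OF _ interior_subset] by blast
    then show ?thesis unfolding interior_complement by auto
  qed
  have hc: "continuous_on UNIV h" using h(1) clX lipschitz_on_continuous_on by metis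
  have seq: "\<exists>xs. (\<forall>n. xs n \<in> X) \<and> xs \<longlonglongrightarrow> x" for x
    using closure_sequential[of x X] clX by auto
  have hlim: "(\<lambda>n. h (xs n)) \<longlonglongrightarrow> h x" if "xs \<longlonglongrightarrow> x" for xs x
    using continuous_on_tendsto_compose[OF hc that] by simp
  have wlim: "(\<lambda>n. wt s (xs n)) \<longlonglongrightarrow> wt s x" if "xs \<longlonglongrightarrow> x" for xs and x :: "real^2"
    using continuous_on_tendsto_compose[OF continuous_on_wt[OF continuous_on_id, of UNIV s] that] by simp
  show ?thesis
  proof (rule that[OF hc])
    show "AE x in lebesgue. h x = g x" using AEX by eventually_elim (rule h(2))
    show "norm (h x) \<le> B * wt s x" for x
    proof -
      obtain xs where xs: "\<And>n. xs n \<in> X" "xs \<longlonglongrightarrow> x" using seq by blast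
      show ?thesis
        by (rule LIMSEQ_le[OF tendsto_norm[OF hlim[OF xs(2)]] tendsto_mult[OF tendsto_const wlim[OF xs(2)]]])
          (use xs(1) h(2) in \<open>auto simp: X_def\<close>)
    qed
    show "norm (h x - h y) \<le> 4 powr s * B * norm (x - y) * wt s x" if xy: "norm (x - y) \<le> 1" for x y
    proof -
      obtain xs where xs: "\<And>n. xs n \<in> X" "xs \<longlonglongrightarrow> x" using seq by blast
      obtain ys where ys: "\<And>n. ys n \<in> X" "ys \<longlonglongrightarrow> y" using seq by blast
      have d: "(\<lambda>n. norm (xs n - ys n)) \<longlonglongrightarrow> norm (x - y)" by (intro tendsto_norm tendsto_diff xs ys)
      have "eventually (\<lambda>n. norm (xs n - ys n) < 2) sequentially" using order_tendstoD(2)[OF d, of 2] xy by simp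
      then have ev: "eventually (\<lambda>n. norm (h (xs n) - h (ys n)) \<le> 4 powr s * B * norm (xs n - ys n) * wt s (xs n)) sequentially"
      proof eventually_elim
        fix n assume n: "norm (xs n - ys n) < 2"
        have "norm (g (xs n + (ys n - xs n)) - g (xs n)) \<le> norm (ys n - xs n) * (B * (4 powr s * wt s (xs n)))"
          using xs(1)[of n] ys(1)[of n] n by (intro lip) (auto simp: X_def norm_minus_commute)
        then show "norm (h (xs n) - h (ys n)) \<le> 4 powr s * B * norm (xs n - ys n) * wt s (xs n)"
          using h(2)[OF xs(1)[of n]] h(2)[OF ys(1)[of n]] by (simp add: norm_minus_commute mult_ac)
      qed
      show ?thesis
        by (rule tendsto_le[OF sequentially_bot tendsto_mult[OF tendsto_mult[OF tendsto_const d] wlim[OF xs(2)]]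
            tendsto_norm[OF tendsto_diff[OF hlim[OF xs(2)] hlim[OF ys(2)]]] ev])
    qed
  qed
qed

section \<open>The continuous operator and the conclusion\<close>

lemma lebesgue_integral_spike:
  fixes f g :: "'a::euclidean_space \<Rightarrow> 'b::euclidean_space"
  assumes f: "set_integrable lebesgue S f" and N: "negligible N" and eq: "\<And>x. x \<in> S - N \<Longrightarrow> g x = f x"
  shows "set_lebesgue_integral lebesgue S g = set_lebesgue_integral lebesgue S f"
proof -
  have g: "set_integrable lebesgue S g" by (rule absolutely_integrable_spike[OF f N eq])
  show ?thesis
    unfolding set_lebesgue_integral_eq_integral(2)[OF f] set_lebesgue_integral_eq_integral(2)[OF g]
    by (rule integral_spike[OF N]) (simp add: eq)
qed

lemma negligible_affine_preimage:
  fixes f f' :: "real^2 \<Rightarrow> real^2"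
  assumes "linear f'" "\<And>x. f' (f x) = x" "negligible N"
  shows "negligible {x. K + f x \<in> N}"
proof (rule negligible_subset)
  show "negligible (f' ` (+) (- K) ` N)"
    by (rule negligible_differentiable_image_negligible[OF order_refl negligible_translation[OF assms(3)]
          linear_imp_differentiable_on[OF assms(1)]])
  show "{x. K + f x \<in> N} \<subseteq> f' ` (+) (- K) ` N"
  proof
    fix x assume "x \<in> {x. K + f x \<in> N}"
    then have "- K + (K + f x) \<in> (+) (- K) ` N" by (intro imageI) simp
    then have "f x \<in> (+) (- K) ` N" by (simp only: add.assoc[symmetric] left_minus add_0_left)
    then show "x \<in> f' ` (+) (- K) ` N" by (metis assms(2) imageI)
  qed
qed

text \<open>
  The operator is defined by \<open>g\<close> itself, of which only the class modulo null sets is controlled. For every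
  slope \<open>l \<noteq> 0\<close> the three points at which \<open>g\<close> is evaluated are images of \<open>x\<close> under invertible affine maps, so
  \<open>g\<close> may be replaced by \<open>h\<close> for almost every \<open>x\<close>. For \<open>l = 0\<close> the third point is \<open>K\<close> for all \<open>x\<close> and the
  argument fails, but a single slope does not contribute to the outer integral.
\<close>

lemma trilinear_eq_integral:
  fixes g h :: "real^2 \<Rightarrow> complex"
  assumes hc: "continuous_on UNIV h" and ae: "AE x in lebesgue. h x = g x"
    and int: "\<And>l. integrable lborel (\<lambda>x. integrand h K x l)"
    and cont: "continuous_on {-1..1} (\<lambda>l. LINT x|lborel. integrand h K x l)"
  shows "trilinear g g g K = integral {-1..1} (\<lambda>l. LINT x|lborel. integrand h K x l)"
proof -
  define N where "N = {x. h x \<noteq> g x}"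
  have N: "negligible N"
    using AE_imp_negligible[OF ae] by (simp add: N_def)
  have inner: "(LINT x|lebesgue. integrand g K x l) = (LINT x|lborel. integrand h K x l)" if l: "l \<noteq> 0" for l
  proof -
    have nz: "1 + l * l \<noteq> 0" by (metis add_pos_nonneg less_irrefl zero_le_square zero_less_one)
    have pl: "perp (perp x) = - x" for x by (simp add: vec_eq_iff forall_2)
    have n1: "negligible {x. K + x \<in> N}"
      by (rule negligible_affine_preimage[where f' = "\<lambda>x. x", OF linear_id[unfolded id_def] refl N])
    have n2: "negligible {x. K + l *\<^sub>R perp x \<in> N}"
    proof (rule negligible_affine_preimage[OF _ _ N])
      show "linear (\<lambda>y. (- (1/l)) *\<^sub>R perp y)" by (rule linear_compose_scale_right[OF linear_perp])
      show "(- (1/l)) *\<^sub>R perp (l *\<^sub>R perp x) = x" for x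
        using l by (simp add: linear_cmul[OF linear_perp] pl)
    qed
    have n3: "negligible {x. K + (x + l *\<^sub>R perp x) \<in> N}"
    proof (rule negligible_affine_preimage[OF _ _ N])
      show "linear (\<lambda>y. (1 / (1 + l * l)) *\<^sub>R (y - l *\<^sub>R perp y))"
        by (intro linear_compose_scale_right linear_compose_sub linear_perp linear_id[unfolded id_def])
      show "(1 / (1 + l * l)) *\<^sub>R ((x + l *\<^sub>R perp x) - l *\<^sub>R perp (x + l *\<^sub>R perp x)) = x" for x
      proof -
        have "(x + l *\<^sub>R perp x) - l *\<^sub>R perp (x + l *\<^sub>R perp x) = (1 + l * l) *\<^sub>R x"
          by (simp add: linear_cmul[OF linear_perp] linear_add[OF linear_perp] pl algebra_simps)
        then show ?thesis using nz by simp
      qed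
    qed
    have n: "negligible ({x. K + x \<in> N} \<union> {x. K + l *\<^sub>R perp x \<in> N} \<union> {x. K + (x + l *\<^sub>R perp x) \<in> N})"
      by (intro negligible_Un n1 n2 n3)
    have pm: "(\<lambda>x. integrand h K x l) \<in> borel_measurable lborel"
      using borel_measurable_continuous_onI[OF integrand_continuous[OF hc]] by simp
    have pi: "set_integrable lebesgue UNIV (\<lambda>x. integrand h K x l)"
      using int[of l] integrable_completion[OF pm] by (simp add: set_integrable_def)
    have "set_lebesgue_integral lebesgue UNIV (\<lambda>x. integrand g K x l) = set_lebesgue_integral lebesgue UNIV (\<lambda>x. integrand h K x l)"
      by (rule lebesgue_integral_spike[OF pi n]) (auto simp: N_def integrand_def add.assoc)
    then show ?thesis using integral_completion[OF pm] by (simp add: set_lebesgue_integral_def)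
  qed
  have si: "set_integrable lebesgue {-1..1} (\<lambda>l. LINT x|lborel. integrand h K x l)"
    using cont by (intro absolutely_integrable_continuous_real)
  have "trilinear g g g K = set_lebesgue_integral lebesgue {-1..1} (\<lambda>l. LINT x|lebesgue. integrand g K x l)"
    by (simp add: trilinear_def integrand_def)
  also have "\<dots> = set_lebesgue_integral lebesgue {-1..1} (\<lambda>l. LINT x|lborel. integrand h K x l)"
    by (rule lebesgue_integral_spike[OF si negligible_sing[of 0]]) (simp add: inner)
  also have "\<dots> = integral {-1..1} (\<lambda>l. LINT x|lborel. integrand h K x l)"
    by (rule set_lebesgue_integral_eq_integral(2)[OF si])
  finally show ?thesis .
qed

lemma continuous_rep_eq:
  assumes hc: "continuous_on UNIV h" and ae: "AE x in lebesgue. h x = g x"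
  shows "continuous_rep g = h"
  unfolding continuous_rep_def
proof (rule the_equality)
  show "continuous_on UNIV h \<and> (AE x in lebesgue. h x = g x)" using assms by simp
  fix k assume k: "continuous_on UNIV k \<and> (AE x in lebesgue. k x = g x)"
  have "AE x in lebesgue. k x = h x" using ae k[THEN conjunct2] by eventually_elim simp
  then have "negligible {x. k x \<noteq> h x}" by (rule AE_imp_negligible)
  moreover have "open {x. k x \<noteq> h x}"
    using k hc by (intro open_Collect_neq) auto
  ultimately have "{x. k x \<noteq> h x} = {}" using open_not_negligible by blast
  then show "k = h" by auto
qed

text \<open>
  The essential supremum over a space of positive measure is nonnegative for a nonnegative function;
  if the function is not measurable it is \<open>\<infinity>\<close>.
\<close>

lemma X_norm_nonneg: "0 \<le> X_norm s f"
proof (rule ccontr)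
  assume neg: "\<not> 0 \<le> X_norm s f"
  have "AE x in lebesgue. ereal (japanese x powr s * norm (f x)) \<le> X_norm s f"
    unfolding X_norm_def by (rule esssup_AE)
  then have "AE x::real^2 in lebesgue. False"
  proof eventually_elim
    fix x assume "ereal (japanese x powr s * norm (f x)) \<le> X_norm s f"
    moreover have "0 \<le> ereal (japanese x powr s * norm (f x))" by simp
    ultimately show False using neg by (meson order_trans)
  qed
  then show False by (simp add: eventually_False ae_filter_eq_bot_iff)
qed

lemma X_norm_AE:
  assumes "X_norm s f \<le> ereal B"
  shows "AE x in lebesgue. norm (f x) \<le> B * wt s x"
proof -
  have "AE x in lebesgue. ereal (japanese x powr s * norm (f x)) \<le> X_norm s f"
    unfolding X_norm_def by (rule esssup_AE)
  then show ?thesis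
  proof eventually_elim
    fix x assume "ereal (japanese x powr s * norm (f x)) \<le> X_norm s f"
    then have "ereal (japanese x powr s * norm (f x)) \<le> ereal B" using assms by (rule order_trans)
    then show "norm (f x) \<le> B * wt s x"
      using japanese_pos[of x] by (simp add: wt_def powr_minus field_simps)
  qed
qed

theorem theorem2p3:
  fixes \<sigma> :: real
  assumes "\<sigma> > 2"
  shows "\<exists>C>0. \<forall>(g :: real^2 \<Rightarrow> complex) (G :: real^2 \<Rightarrow> complex^2) (B :: real).
           has_weak_gradient g G \<and> X_norm (\<sigma> + 1) g + X_norm (\<sigma> + 1) G \<le> ereal B \<longrightarrow>
           (\<forall>L>1. X_norm_lattice L \<sigma>
                (\<lambda>K. trilinear g g g K -
                     trilinear_discrete L (continuous_rep g) (continuous_rep g) (continuous_rep g) K)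
              \<le> ereal (C * (B ^ 3 / ln L)))"
proof (intro exI conjI allI impI)
  \<comment> \<open>The summand \<open>1\<close> pays for the degenerate rectangle, all of whose corners are \<open>K\<close>.\<close>
  define C where "C = C_int \<sigma> * \<bar>C_core \<sigma>\<bar> + 1"
  have Cp0: "0 \<le> C_int \<sigma>" by (simp add: C_int_def)
  show "C > 0" unfolding C_def using Cp0 by (intro add_nonneg_pos mult_nonneg_nonneg) auto
  fix g :: "real^2 \<Rightarrow> complex" and G :: "real^2 \<Rightarrow> complex^2" and B L :: real
  assume hyp: "has_weak_gradient g G \<and> X_norm (\<sigma> + 1) g + X_norm (\<sigma> + 1) G \<le> ereal B" and L: "L > 1"
  let ?s = "\<sigma> + 1"
  have xg: "X_norm ?s g \<le> ereal B" and xG: "X_norm ?s G \<le> ereal B"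
    using hyp X_norm_nonneg[of ?s g] X_norm_nonneg[of ?s G]
    by (metis add.right_neutral add_left_mono order_trans, metis add.left_neutral add_right_mono order_trans)
  have B: "0 \<le> B" using order_trans[OF X_norm_nonneg xg] by simp
  have s: "0 \<le> ?s" using assms by simp
  obtain h where h: "continuous_on UNIV h" "AE x in lebesgue. h x = g x"
    "\<And>x. norm (h x) \<le> B * wt ?s x"
    "\<And>x y. norm (x - y) \<le> 1 \<Longrightarrow> norm (h x - h y) \<le> 4 powr ?s * B * norm (x - y) * wt ?s x"
    using weak_gradient_continuous_rep[OF conjunct1[OF hyp] s B X_norm_AE[OF xg] X_norm_AE[OF xG]] by blast
  have rep: "continuous_rep g = h" by (rule continuous_rep_eq[OF h(1,2)])
  have lnL: "ln L > 0" using L by simp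
  have main: "japanese K powr \<sigma> * norm (trilinear g g g K - trilinear_discrete L h h h K) \<le> C * (B ^ 3 / ln L)"
    if K: "K \<in> scaled_lattice L" for K
  proof -
    define A where "A = C_int \<sigma> * B ^ 3 * wt \<sigma> K"
    have A: "0 \<le> A" using Cp0 B wt_pos[of \<sigma> K] by (simp add: A_def)
    have pb1: "norm (integrand h K x l) \<le> A * Phi \<sigma> K x" for x l
      unfolding A_def by (rule integrand_bounds(1)[OF assms B h(3,4)])
    have pb2: "norm (integrand h K x l - integrand h K y l) \<le> A * norm (x - y) * (Phi \<sigma> K x + Phi \<sigma> K y)" if "\<bar>l\<bar> \<le> 1" for x y l
      unfolding A_def using that by (rule integrand_bounds(2)[OF assms B h(3,4), rotated])
    have pb3: "norm (integrand h K x l - integrand h K x m) \<le> A * \<bar>l - m\<bar> * Phi \<sigma> K x" for x l m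
      unfolding A_def by (rule integrand_bounds(3)[OF assms B h(3,4)])
    have pb4: "norm (integrand h K x l) \<le> A * (wt ?s x + wt (1 + \<sigma>/2) (K + x) * wt (\<sigma>/2) (l *\<^sub>R perp x) / japanese K)" for x l
      unfolding A_def by (rule integrand_bounds(4)[OF assms B h(3,4)])
    define f where "f = (\<lambda>((q,p),M). integrand h K ((real q / L) *\<^sub>R pt M) (of_int p / real q))"
    define I where "I = (\<lambda>l. LINT x|lborel. integrand h K x l)"
    have core1: "(\<lambda>z. norm (f z)) summable_on rect_index"
      unfolding f_def by (rule rectangle_sum_asymptotics(1)[OF assms A L integrand_continuous[OF h(1)] pb1 pb2 pb3 pb4])
    have core2: "continuous_on {-1..1} I"
      unfolding I_def by (rule rectangle_sum_asymptotics(2)[OF assms A L integrand_continuous[OF h(1)] pb1 pb2 pb3 pb4])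
    have core3: "norm (of_real (pi\<^sup>2/6 / L\<^sup>2) * infsum f rect_index - of_real (ln L) * integral {-1..1} I) \<le> C_core \<sigma> * A"
      unfolding f_def I_def by (rule rectangle_sum_asymptotics(3)[OF assms A L integrand_continuous[OF h(1)] pb1 pb2 pb3 pb4])
    have int: "integrable lborel (\<lambda>x. integrand h K x l)" for l
      by (rule Bochner_Integration.integrable_bound[of _ "\<lambda>x. A * Phi \<sigma> K x"])
        (use Phi_integral[OF assms] pb1 A Phi_pos borel_measurable_continuous_onI[OF integrand_continuous[OF h(1)]] in \<open>auto simp: abs_mult less_imp_le\<close>)
    have T: "trilinear g g g K = integral {-1..1} I"
      unfolding I_def by (rule trilinear_eq_integral[OF h(1,2) int core2[unfolded I_def]])
    let ?z = "pi\<^sup>2/6"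
    define h3 where "h3 = h K * cnj (h K) * h K"
    define E where "E = infsum f rect_index"
    have L0: "L > 0" using L by simp
    have TL: "trilinear_discrete L h h h K = of_real (?z / (2 * L\<^sup>2 * ln L)) * (h3 + 2 * E)"
      unfolding trilinear_discrete_def h3_def E_def f_def
      by (subst resonant_sum[OF L0 K core1[unfolded f_def]]) (rule refl)
    have z: "?z \<le> 2" "0 \<le> ?z" using zeta2_partial_sum(2)[of 1] by auto
    have h3: "norm h3 \<le> B ^ 3 * wt \<sigma> K"
    proof -
      have w: "wt ?s K \<le> 1" "wt ?s K \<le> wt \<sigma> K" "0 \<le> wt ?s K"
        using wt_le_1[OF s, of K] wt_exp_mono[of \<sigma> ?s K] wt_pos[of ?s K] by auto
      have "norm h3 \<le> (B * wt ?s K) * (B * wt ?s K) * (B * wt ?s K)"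
        unfolding h3_def norm_mult complex_mod_cnj using h(3)[of K] B w by (intro mult_mono) auto
      also have "\<dots> = B ^ 3 * (wt ?s K * wt ?s K * wt ?s K)" by (simp add: power3_eq_cube)
      also have "\<dots> \<le> B ^ 3 * (1 * 1 * wt \<sigma> K)"
        using B w by (intro mult_left_mono mult_mono) auto
      finally show ?thesis by simp
    qed
    have eq: "trilinear g g g K - trilinear_discrete L h h h K =
        - (of_real (1 / ln L) * (of_real (?z / L\<^sup>2) * E - of_real (ln L) * integral {-1..1} I)) - of_real (?z / (2 * L\<^sup>2 * ln L)) * h3"
    proof -
      have e1: "of_real (?z / (2 * L\<^sup>2 * ln L)) * 2 = (of_real (1 / ln L) * of_real (?z / L\<^sup>2) :: complex)"
      proof -
        have "?z / (2 * L\<^sup>2 * ln L) * 2 = 1 / ln L * (?z / L\<^sup>2)" by simp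
        then show ?thesis by (metis of_real_mult of_real_numeral)
      qed
      have e2: "of_real (1 / ln L) * of_real (ln L) = (1::complex)"
        using lnL by (simp flip: of_real_mult)
      have alg: "J - c * (h' + 2 * E) = - (a * (b * E - d * J)) - c * h'"
        if "c * 2 = a * b" "a * d = 1" for J c h' E a b d :: complex
      proof -
        have "- (a * (b * E - d * J)) - c * h' = (a * d) * J - (a * b) * E - c * h'" by (simp add: algebra_simps)
        then show ?thesis unfolding that(1)[symmetric] that(2) by (simp add: algebra_simps)
      qed
      show ?thesis unfolding T TL by (rule alg[OF e1 e2])
    qed
    have "norm (trilinear g g g K - trilinear_discrete L h h h K) \<le>
       norm (of_real (1 / ln L) * (of_real (?z / L\<^sup>2) * E - of_real (ln L) * integral {-1..1} I)) + norm (of_real (?z / (2 * L\<^sup>2 * ln L)) * h3)"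
      unfolding eq using norm_triangle_ineq4 norm_minus_cancel by metis
    also have "\<dots> \<le> (1 / ln L) * (C_core \<sigma> * A) + (1 / ln L) * (B ^ 3 * wt \<sigma> K)"
    proof (rule add_mono)
      show "norm (of_real (1 / ln L) * (of_real (?z / L\<^sup>2) * E - of_real (ln L) * integral {-1..1} I)) \<le> (1 / ln L) * (C_core \<sigma> * A)"
        unfolding norm_mult norm_of_real E_def using core3 lnL by (simp add: divide_right_mono)
      have L2: "1 \<le> L\<^sup>2" using L by (simp add: one_le_power)
      have "?z / (2 * L\<^sup>2 * ln L) \<le> 1 / ln L"
      proof -
        have "?z / (2 * L\<^sup>2) \<le> 1" using z L2 by (simp add: divide_le_eq)
        from divide_right_mono[OF this, of "ln L"] lnL show ?thesis by simp
      qed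
      moreover have "0 \<le> ?z / (2 * L\<^sup>2 * ln L)" using z lnL by simp
      ultimately show "norm (of_real (?z / (2 * L\<^sup>2 * ln L)) * h3) \<le> (1 / ln L) * (B ^ 3 * wt \<sigma> K)"
        unfolding norm_mult norm_of_real using h3 lnL by (intro mult_mono) auto
    qed
    also have "\<dots> = (C_int \<sigma> * C_core \<sigma> + 1) * (B ^ 3 / ln L) * wt \<sigma> K"
      by (simp add: A_def algebra_simps add_divide_distrib)
    also have "\<dots> \<le> C * (B ^ 3 / ln L) * wt \<sigma> K"
      unfolding C_def using Cp0 B lnL wt_pos[of \<sigma> K]
      by (intro mult_right_mono add_right_mono mult_left_mono) auto
    finally have "japanese K powr \<sigma> * norm (trilinear g g g K - trilinear_discrete L h h h K) \<le>
        japanese K powr \<sigma> * (C * (B ^ 3 / ln L) * wt \<sigma> K)" by (rule mult_left_mono) simp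
    also have "\<dots> = C * (B ^ 3 / ln L)"
      using japanese_pos[of K] by (simp add: wt_def powr_minus)
    finally show ?thesis .
  qed
  show "X_norm_lattice L \<sigma> (\<lambda>K. trilinear g g g K - trilinear_discrete L (continuous_rep g) (continuous_rep g) (continuous_rep g) K)
        \<le> ereal (C * (B ^ 3 / ln L))"
    unfolding X_norm_lattice_def rep by (rule SUP_least) (use main in simp)
qed

end
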